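(* Let $b:\mathbb{R}^d\to\mathbb{R}^d$ be such that (i) there is $L>0$ with $|b(x)-b(y)|\le L|x-y|$ for all $x,y\in\mathbb{R}^d$; (ii) there are $K,\mathcal{R}>0$ with $\langle x-y,b(x)-b(y)\rangle\le -K|x-y|^2$ for all $x,y$ with $|x-y|>\mathcal{R}$. Let $\bar b:\mathbb{R}^d\times\mathbb{R}^n\to\mathbb{R}^d$ be an unbiased estimator of $b$ for which there are constants $\sigma,\alpha>0$ such that for any $x\in\mathbb{R}^d$, any $h>0$ and any random variable $U$ (used with step size $h$) with $\mathbb{E}[\bar b(x,U)]=b(x)$, $$\mathbb{E}|\bar b(x,U)-b(x)|^2\le\sigma^2(1+|x|^2)h^\alpha .$$ Let $\mu_0\in\mathcal{P}_2(\mathbb{R}^d)$ and for $h>0$ define the chains $X_{k+1}=X_k+b(X_k)h+\sqrt h\,\xi_{k+1}$, $X_0\sim\mu_0$, and $\bar X_{k+1}=\bar X_k+\bar b(\bar X_k,U_k)h+\sqrt h\,\xi_{k+1}$, $\bar X_0\sim\mu_0$. Let $\pi$ be the unique invariant probability measure of $dY_t=b(Y_t)\,dt+dW_t$. Then there exist constants $h_0,\bar C_1,\bar C_2>0$ (independent of $h$ and $k$) such that for all $h\in(0,h_0)$ and all $k\ge1$ $$W_2(\mathcal{L}(\bar X_k),\pi)\le W_2(\mathcal{L}(X_k),\pi)+\bar C_2h^{\alpha/4},\qquad W_1(\mathcal{L}(\bar X_k),\pi)\le W_1(\mathcal{L}(X_k),\pi)+\bar C_1h^{\alpha/2}.$$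
   Context: $|\cdot|$ is the Euclidean norm; $\mathcal{L}(X)$ is the law of $X$; $\mathcal{P}_2(\mathbb{R}^d)$ is the set of square-integrable probability measures; $W_p$ is the $L^p$-Wasserstein distance with respect to $|\cdot|$. $(\xi_k)_{k\ge1}$ are i.i.d. $N(0,I)$ on $\mathbb{R}^d$; $(U_k)_{k\ge0}$ are i.i.d. copies of an $\mathbb{R}^n$-valued random variable $U$ with $\mathbb{E}[\bar b(x,U)]=b(x)$ for all $x\in\mathbb{R}^d$, independent of $(\xi_k)_{k\ge1}$; the initial conditions are independent of $(\xi_k)$ and $(U_k)$. The $h$-dependence in the variance bound reflects that the choice of the estimator (that is, of $\bar b$ and $U$) may depend on the step size $h$, while $\sigma$ and $\alpha$ do not depend on $h$. $(W_t)$ is a standard $d$-dimensional Brownian motion; under (i)-(ii) the SDE has a unique invariant probability measure. *)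

theory Defs
  imports "HOL-Probability.Probability"
begin

section \<open>Wasserstein distances\<close>

definition couplings ::
  "(real ^ 'd) measure \<Rightarrow> (real ^ 'd) measure \<Rightarrow> ((real ^ 'd) \<times> (real ^ 'd)) measure set" where
  "couplings \<mu> \<nu> = {\<gamma>. sets \<gamma> = sets (borel \<Otimes>\<^sub>M borel) \<and>
     distr \<gamma> borel fst = \<mu> \<and> distr \<gamma> borel snd = \<nu>}"

text \<open>The distance takes values in \<open>ennreal\<close>, so that no finiteness of moments is presupposed.
  The library has no \<open>p\<close>-th root on \<open>ennreal\<close>; the case distinction provides it.\<close>

definition wasserstein :: "real \<Rightarrow> (real ^ 'd) measure \<Rightarrow> (real ^ 'd) measure \<Rightarrow> ennreal" where
  "wasserstein p \<mu> \<nu> =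
     (let c = (INF \<gamma> \<in> couplings \<mu> \<nu>. \<integral>\<^sup>+ z. ennreal (dist (fst z) (snd z) powr p) \<partial>\<gamma>)
      in if c = \<infinity> then \<infinity> else ennreal (enn2real c powr (1 / p)))"

definition P2 :: "(real ^ 'd) measure set" where
  "P2 = {\<mu>. prob_space \<mu> \<and> sets \<mu> = sets borel \<and> integrable \<mu> (\<lambda>x. (norm x)\<^sup>2)}"

section \<open>Independence of random variables of different types\<close>

text \<open>The library's \<open>indep_var\<close> forces both random variables to have the same value type, which
  excludes, for instance, a vector and a process. This is its definition without that restriction.\<close>

definition independent_rvs ::
  "'w measure \<Rightarrow> 'a measure \<Rightarrow> ('w \<Rightarrow> 'a) \<Rightarrow> 'b measure \<Rightarrow> ('w \<Rightarrow> 'b) \<Rightarrow> bool" where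
  "independent_rvs M A X B Y \<longleftrightarrow>
     X \<in> measurable M A \<and> Y \<in> measurable M B \<and>
     prob_space.indep_set M {X -` S \<inter> space M | S. S \<in> sets A} {Y -` S \<inter> space M | S. S \<in> sets B}"

section \<open>Gaussian laws and Brownian motion\<close>

text \<open>The centred Gaussian law with covariance matrix \<open>v I\<close>. Note that the library function
  \<open>normal_density\<close> takes the standard deviation, not the variance.\<close>

definition gaussian :: "real \<Rightarrow> (real ^ 'd) measure" where
  "gaussian v = density lborel (\<lambda>x. ennreal (\<Prod>i\<in>UNIV. normal_density 0 (sqrt v) (x $ i)))"

definition brownian_motion :: "'w measure \<Rightarrow> (real \<Rightarrow> 'w \<Rightarrow> real ^ 'd) \<Rightarrow> bool" where
  "brownian_motion M W \<longleftrightarrow>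
     prob_space M \<and>
     (\<forall>t\<ge>0. W t \<in> borel_measurable M) \<and>
     (AE \<omega> in M. W 0 \<omega> = 0) \<and>
     (\<forall>s t. 0 \<le> s \<and> s < t \<longrightarrow> distr M borel (\<lambda>\<omega>. W t \<omega> - W s \<omega>) = gaussian (t - s)) \<and>
     (\<forall>(m::nat) \<tau>. 0 \<le> \<tau> 0 \<and> incseq \<tau> \<longrightarrow>
        prob_space.indep_vars M (\<lambda>_. borel) (\<lambda>i \<omega>. W (\<tau> (Suc i)) \<omega> - W (\<tau> i) \<omega>) {..<m}) \<and>
     (AE \<omega> in M. continuous_on {0..} (\<lambda>t. W t \<omega>))"

section \<open>The equation \<open>dY = b(Y) dt + dW\<close> and its invariant measures\<close>

text \<open>As the noise is additive, the integral form of the equation involves no stochastic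
  integral: it is an identity between paths.\<close>

definition sde_solution ::
  "(real ^ 'd \<Rightarrow> real ^ 'd) \<Rightarrow> 'w measure \<Rightarrow> (real \<Rightarrow> 'w \<Rightarrow> real ^ 'd) \<Rightarrow>
   (real \<Rightarrow> 'w \<Rightarrow> real ^ 'd) \<Rightarrow> bool" where
  "sde_solution b M W Y \<longleftrightarrow>
     brownian_motion M W \<and>
     (\<forall>t\<ge>0. Y t \<in> borel_measurable M) \<and>
     independent_rvs M borel (Y 0)
       (Pi\<^sub>M {0..} (\<lambda>_. borel)) (\<lambda>\<omega>. \<lambda>t\<in>{0..}. W t \<omega>) \<and>
     (AE \<omega> in M. continuous_on {0..} (\<lambda>t. Y t \<omega>) \<and>
        (\<forall>t\<ge>0. Y t \<omega> = Y 0 \<omega> + integral {0..t} (\<lambda>s. b (Y s \<omega>)) + W t \<omega>))"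

text \<open>The law \<open>\<pi>\<close> is invariant if every solution with initial law \<open>\<pi>\<close> has law \<open>\<pi>\<close> at all times.
  One cannot quantify over all types of sample points inside a formula. The type chosen here can
  carry an arbitrary initial value together with an independent Brownian path (as a probability
  space, \<open>M\<close> may be concentrated on the continuous paths), hence a solution for every initial law
  when \<open>b\<close> is Lipschitz. As the law of a solution is then determined by its initial law, other
  sample spaces would not change the notion.\<close>

definition sde_invariant :: "(real ^ 'd \<Rightarrow> real ^ 'd) \<Rightarrow> (real ^ 'd) measure \<Rightarrow> bool" where
  "sde_invariant b \<pi> \<longleftrightarrow>
     prob_space \<pi> \<and> sets \<pi> = sets borel \<and>
     (\<forall>(M :: ((real ^ 'd) \<times> (real \<Rightarrow> real ^ 'd)) measure) W Y.
        sde_solution b M W Y \<and> distr M borel (Y 0) = \<pi> \<longrightarrow>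
        (\<forall>t\<ge>0. distr M borel (Y t) = \<pi>))"

section \<open>The two Markov chains\<close>

text \<open>In both chains \<open>\<xi> 0\<close> is never used: the Gaussian noise is indexed from \<open>1\<close>, the noise of
  the estimator from \<open>0\<close>.\<close>

primrec euler_chain ::
  "real \<Rightarrow> (real ^ 'd \<Rightarrow> real ^ 'd) \<Rightarrow> (nat \<Rightarrow> 'w \<Rightarrow> real ^ 'd) \<Rightarrow> ('w \<Rightarrow> real ^ 'd) \<Rightarrow>
   nat \<Rightarrow> 'w \<Rightarrow> real ^ 'd" where
  "euler_chain h b \<xi> X0 0 = X0"
| "euler_chain h b \<xi> X0 (Suc k) = (\<lambda>\<omega>. euler_chain h b \<xi> X0 k \<omega>
     + h *\<^sub>R b (euler_chain h b \<xi> X0 k \<omega>) + sqrt h *\<^sub>R \<xi> (Suc k) \<omega>)"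

primrec inaccurate_chain ::
  "real \<Rightarrow> (real ^ 'd \<Rightarrow> real ^ 'n \<Rightarrow> real ^ 'd) \<Rightarrow> (nat \<Rightarrow> 'w \<Rightarrow> real ^ 'n) \<Rightarrow>
   (nat \<Rightarrow> 'w \<Rightarrow> real ^ 'd) \<Rightarrow> ('w \<Rightarrow> real ^ 'd) \<Rightarrow> nat \<Rightarrow> 'w \<Rightarrow> real ^ 'd" where
  "inaccurate_chain h bbar U \<xi> X0 0 = X0"
| "inaccurate_chain h bbar U \<xi> X0 (Suc k) = (\<lambda>\<omega>. inaccurate_chain h bbar U \<xi> X0 k \<omega>
     + h *\<^sub>R bbar (inaccurate_chain h bbar U \<xi> X0 k \<omega>) (U k \<omega>) + sqrt h *\<^sub>R \<xi> (Suc k) \<omega>)"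

text \<open>Mutual independence of an initial condition \<open>Z\<close>, of the sequence \<open>\<xi>\<close> (from index \<open>1\<close>)
  and of the sequence \<open>U\<close>, each seen as one random variable, together with independence of the
  terms within each of the two sequences.\<close>

definition independent_inputs ::
  "'w measure \<Rightarrow> ('w \<Rightarrow> real ^ 'd) \<Rightarrow> (nat \<Rightarrow> 'w \<Rightarrow> real ^ 'd) \<Rightarrow> (nat \<Rightarrow> 'w \<Rightarrow> real ^ 'n) \<Rightarrow> bool"
  where
  "independent_inputs M Z \<xi> U \<longleftrightarrow>
     prob_space.indep_vars M (\<lambda>_. borel) \<xi> {1..} \<and>
     prob_space.indep_vars M (\<lambda>_. borel) U UNIV \<and>
     independent_rvs M
       (Pi\<^sub>M {1..} (\<lambda>_. borel)) (\<lambda>\<omega>. \<lambda>k\<in>{1..}. \<xi> k \<omega>)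
       (Pi\<^sub>M UNIV (\<lambda>_. borel)) (\<lambda>\<omega> k. U k \<omega>) \<and>
     independent_rvs M borel Z
       (Pi\<^sub>M {1..} (\<lambda>_. borel) \<Otimes>\<^sub>M Pi\<^sub>M UNIV (\<lambda>_. borel))
       (\<lambda>\<omega>. (\<lambda>k\<in>{1..}. \<xi> k \<omega>, \<lambda>k. U k \<omega>))"

end

theory Submission
  imports Defs
begin

text \<open>The measure \<open>\<pi>\<close> plays no role: by the triangle inequality it suffices to bound the distance of the
  laws of the two chains at time \<open>k\<close>, uniformly in \<open>k\<close>. Two Euler steps from \<open>x\<close> and \<open>y\<close> are coupled by
  making the Gaussian increments agree with the largest possible probability and reflecting them
  otherwise. For the cost \<open>f r = 1 - exp (- a r) + \<epsilon> r\<^sup>2\<close> with \<open>a\<close> large and \<open>\<epsilon>\<close> small, concavity near the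
  origin and dissipativity at infinity make the expected cost decrease by a factor \<open>1 - c h\<close>. The
  estimator perturbs the step by \<open>O(h\<^bsup>1 + \<alpha>/2\<^esup>)\<close> in mean square (relative to \<open>1 + |y|\<close>), and second
  moments stay bounded, so the costs \<open>S\<^sub>k\<close> satisfy \<open>S\<^sub>k\<^sub>+\<^sub>1 \<le> (1 - c h/2) S\<^sub>k + C h\<^bsup>1 + \<alpha>/2\<^esup>\<close>,
  whence \<open>S\<^sub>k = O(h\<^bsup>\<alpha>/2\<^esup>)\<close>. Finally \<open>f\<close> dominates multiples of both \<open>r\<close> and \<open>r\<^sup>2\<close>, which gives the
  rates \<open>\<alpha>/2\<close> for \<open>W\<^sub>1\<close> and \<open>\<alpha>/4\<close> for \<open>W\<^sub>2\<close>.\<close>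

section \<open>Approximate gluing and the triangle inequality for Wasserstein distances\<close>

text \<open>Dissipativity holds only beyond distance \<open>R\<close>, so using the same noise in
  both chains need not contract at short range; there the contraction must come from the noise. In
  discrete time a plain reflection overshoots once the distance is below the noise size sqrt h,
  hence the attempt to merge the two points first. The obstacle is to estimate the expected cost
  after such a step without an Ito formula. A reflection principle for a single Gaussian step
  rewrites it as a Gaussian average of the odd extension of the cost. Averaging over z and -z
  reduces contraction to an inequality for symmetric second differences in one real variable,
  weighted by a tail probability and a second moment. The shift of the coupling is computed from the
  exact drift at both points, so the estimator error stays an additive displacement of one point;
  its root mean square scale h^(\<alpha>/2) serves as the weight in Young's inequality and yields
  the source term. Each coupled step is the image of a product measure under an explicit measurable
  map, so couplings need not be selected measurably.\<close>

lemma obtain_measurable_cells: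
  fixes \<epsilon> :: real
  assumes "\<epsilon> > 0"
  obtains c :: "'a::{metric_space, second_countable_topology} \<Rightarrow> nat"
  where "c \<in> borel \<rightarrow>\<^sub>M count_space UNIV" "\<And>x y. c x = c y \<Longrightarrow> dist x y \<le> \<epsilon>"
proof -
  obtain D :: "'a set" where D: "countable D" "\<And>X. open X \<Longrightarrow> X \<noteq> {} \<Longrightarrow> \<exists>d\<in>D. d \<in> X"
    using countable_dense_setE by metis
  have "D \<noteq> {}" using D(2)[of UNIV] by auto
  define d where "d = from_nat_into D"
  have dense: "\<exists>n. dist (d n) x < \<epsilon> / 2" for x
  proof -
    obtain z where "z \<in> D" "z \<in> ball x (\<epsilon>/2)"
      using D(2)[of "ball x (\<epsilon>/2)"] assms by auto
    then show ?thesis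
      using from_nat_into_surj[OF D(1)] by (metis d_def dist_commute mem_ball)
  qed
  \<comment> \<open>The index of the first dense point within \<open>\<epsilon> / 2\<close>. Taking
    the least index makes the cells disjoint and Borel, and two points with the same index share a
    centre.\<close>
  define c where "c x = (LEAST n. dist (d n) x < \<epsilon> / 2)" for x
  have c: "dist (d (c x)) x < \<epsilon> / 2" for x
    unfolding c_def using dense by (rule LeastI_ex)
  show ?thesis
  proof
    show "c \<in> borel \<rightarrow>\<^sub>M count_space UNIV"
      unfolding c_def by measurable
    fix x y assume "c x = c y"
    then have "dist (d (c x)) x < \<epsilon> / 2" "dist (d (c x)) y < \<epsilon> / 2" using c[of x] c[of y] by auto
    then show "dist x y \<le> \<epsilon>"
      using dist_triangle3[of x y "d (c x)"] by simp
  qed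
qed

lemma couplingsD:
  assumes "\<gamma> \<in> couplings \<mu> \<nu>"
  shows "sets \<gamma> = sets (borel \<Otimes>\<^sub>M borel)" "distr \<gamma> borel fst = \<mu>" "distr \<gamma> borel snd = \<nu>"
  using assms by (auto simp: couplings_def)

lemma couplings_prob_space:
  assumes "\<gamma> \<in> couplings \<mu> \<nu>" "prob_space \<mu>"
  shows "prob_space \<gamma>"
proof (rule prob_space_distrD)
  show "fst \<in> \<gamma> \<rightarrow>\<^sub>M borel"
    using couplingsD(1)[OF assms(1)] measurable_cong_sets by blast
  show "prob_space (distr \<gamma> borel fst)"
    using assms couplingsD(2) by metis
qed

text \<open>Gluing two couplings exactly would require a disintegration. Making them conditionally
  independent given only the cell of the middle variable, in a countable partition into cells of
  small diameter, is elementary and good enough for the triangle inequality.\<close>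

lemma approximate_gluing:
  fixes \<gamma>1 \<gamma>2 :: "((real ^ 'd) \<times> (real ^ 'd)) measure"
  assumes \<gamma>1: "\<gamma>1 \<in> couplings \<mu> \<nu>" and \<gamma>2: "\<gamma>2 \<in> couplings \<nu> \<rho>"
    and \<mu>: "prob_space \<mu>" and \<nu>: "prob_space \<nu>" and "\<epsilon> > 0"
  obtains \<Gamma> where "sets \<Gamma> = sets ((borel \<Otimes>\<^sub>M borel) \<Otimes>\<^sub>M (borel \<Otimes>\<^sub>M borel))"
    "distr \<Gamma> (borel \<Otimes>\<^sub>M borel) fst = \<gamma>1" "distr \<Gamma> (borel \<Otimes>\<^sub>M borel) snd = \<gamma>2"
    "AE w in \<Gamma>. dist (snd (fst w)) (fst (snd w)) \<le> \<epsilon>"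
proof -
  interpret G1: prob_space \<gamma>1 using couplings_prob_space[OF \<gamma>1 \<mu>] .
  interpret G2: prob_space \<gamma>2 using couplings_prob_space[OF \<gamma>2 \<nu>] .
  interpret N: prob_space \<nu> by fact
  obtain c :: "real ^ 'd \<Rightarrow> nat" where [measurable]: "c \<in> borel \<rightarrow>\<^sub>M count_space UNIV"
    and c: "\<And>x y. c x = c y \<Longrightarrow> dist x y \<le> \<epsilon>"
    using obtain_measurable_cells[OF \<open>\<epsilon> > 0\<close>] by metis
  note s1[simp, measurable_cong] = couplingsD(1)[OF \<gamma>1] and s2[simp, measurable_cong] = couplingsD(1)[OF \<gamma>2]
  have sp1[simp]: "space \<gamma>1 = UNIV" and sp2[simp]: "space \<gamma>2 = UNIV"
    using sets_eq_imp_space_eq[OF s1] sets_eq_imp_space_eq[OF s2] by (auto simp: space_pair_measure)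
  have sN[simp, measurable_cong]: "sets \<nu> = sets borel" and spN[simp]: "space \<nu> = UNIV"
    using couplingsD(3)[OF \<gamma>1] by auto
  define g where "g n = emeasure \<nu> (c -` {n})" for n
  have cell_sets[measurable]: "c -` {n} \<in> sets borel" for n
    using measurable_sets[of c borel "count_space UNIV" "{n}"] by simp
  have meas_cell: "{v. c (fst v) = n} \<in> sets (borel \<Otimes>\<^sub>M borel)"
    "{v. c (snd v) = n} \<in> sets (borel \<Otimes>\<^sub>M borel)" for n
  proof -
    have "{v \<in> space (borel \<Otimes>\<^sub>M borel). c (fst v) = n} \<in> sets (borel \<Otimes>\<^sub>M borel)"
      "{v \<in> space (borel \<Otimes>\<^sub>M borel). c (snd v) = n} \<in> sets (borel \<Otimes>\<^sub>M borel)"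
      by measurable
    then show "{v. c (fst v) = n} \<in> sets (borel \<Otimes>\<^sub>M borel)"
      "{v. c (snd v) = n} \<in> sets (borel \<Otimes>\<^sub>M borel)"
      by (auto simp: space_pair_measure)
  qed
  have g2: "g n = (\<integral>\<^sup>+v. indicator {v. c (fst v) = n} v \<partial>\<gamma>2)" for n
  proof -
    have "g n = emeasure (distr \<gamma>2 borel fst) (c -` {n})"
      unfolding g_def couplingsD(2)[OF \<gamma>2] ..
    also have "\<dots> = emeasure \<gamma>2 {v. c (fst v) = n}"
      by (subst emeasure_distr) (auto intro!: arg_cong[where f="emeasure \<gamma>2"])
    also have "\<dots> = (\<integral>\<^sup>+v. indicator {v. c (fst v) = n} v \<partial>\<gamma>2)"
      by (rule nn_integral_indicator[symmetric]) (use meas_cell in auto)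
    finally show ?thesis .
  qed
  have g1: "g n = (\<integral>\<^sup>+v. indicator {v. c (snd v) = n} v \<partial>\<gamma>1)" for n
  proof -
    have "g n = emeasure (distr \<gamma>1 borel snd) (c -` {n})"
      unfolding g_def couplingsD(3)[OF \<gamma>1] ..
    also have "\<dots> = emeasure \<gamma>1 {v. c (snd v) = n}"
      by (subst emeasure_distr) (auto intro!: arg_cong[where f="emeasure \<gamma>1"])
    also have "\<dots> = (\<integral>\<^sup>+v. indicator {v. c (snd v) = n} v \<partial>\<gamma>1)"
      by (rule nn_integral_indicator[symmetric]) (use meas_cell in auto)
    finally show ?thesis .
  qed
  have gfin: "g n \<noteq> \<infinity>" for n
    unfolding g_def by simp
  have gpos: "AE y in \<nu>. g (c y) \<noteq> 0"
  proof -
    have "AE y in \<nu>. g n = 0 \<longrightarrow> c y \<noteq> n" for n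
    proof (cases "g n = 0")
      case True
      then show ?thesis
        by (intro AE_I[of _ _ "c -` {n}"]) (auto simp: g_def)
    qed auto
    then have "AE y in \<nu>. \<forall>n. g n = 0 \<longrightarrow> c y \<noteq> n"
      unfolding AE_all_countable by auto
    then show ?thesis by eventually_elim auto
  qed
  have gpos1: "AE u in \<gamma>1. g (c (snd u)) \<noteq> 0"
    using gpos unfolding couplingsD(3)[OF \<gamma>1, symmetric] by (subst (asm) AE_distr_iff) auto
  have gpos2: "AE u in \<gamma>2. g (c (fst u)) \<noteq> 0"
    using gpos unfolding couplingsD(2)[OF \<gamma>2, symmetric] by (subst (asm) AE_distr_iff) auto
  \<comment> \<open>Density of the glued law with respect to the product. Conditional independence
    given a common cell requires the weight 1 / \<nu>(cell) there. On null cells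
    \<open>inverse\<close> is infinite; \<open>gpos1\<close> and \<open>gpos2\<close> say that these
    are almost surely not met.\<close>
  define f :: "((real ^ 'd) \<times> (real ^ 'd)) \<times> ((real ^ 'd) \<times> (real ^ 'd)) \<Rightarrow> ennreal"
    where "f w = (if c (snd (fst w)) = c (fst (snd w)) then inverse (g (c (snd (fst w)))) else 0)" for w
  have f[measurable]: "f \<in> borel_measurable ((borel \<Otimes>\<^sub>M borel) \<Otimes>\<^sub>M (borel \<Otimes>\<^sub>M borel))"
  proof -
    define E :: "(((real ^ 'd) \<times> (real ^ 'd)) \<times> ((real ^ 'd) \<times> (real ^ 'd))) set"
      where "E = {w. c (snd (fst w)) = c (fst (snd w))}"
    have "E = (\<Union>n. (UNIV \<times> c -` {n}) \<times> (c -` {n} \<times> UNIV))"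
      unfolding E_def by auto
    also have "\<dots> \<in> sets ((borel \<Otimes>\<^sub>M borel) \<Otimes>\<^sub>M (borel \<Otimes>\<^sub>M borel))"
      by (intro sets.countable_UN' pair_measureI cell_sets) auto
    finally have [measurable]: "E \<in> sets ((borel \<Otimes>\<^sub>M borel) \<Otimes>\<^sub>M (borel \<Otimes>\<^sub>M borel))" .
    have "f = (\<lambda>w. inverse (g (c (snd (fst w)))) * indicator E w)"
      unfolding f_def E_def by (auto simp: fun_eq_iff split: split_indicator)
    then show ?thesis by simp
  qed
  have fu: "(\<lambda>v. f (u, v)) \<in> borel_measurable \<gamma>2" and fv: "(\<lambda>u. f (u, v)) \<in> borel_measurable \<gamma>1" for u v
    using measurable_compose[OF measurable_Pair1' f, of u] measurable_compose[OF measurable_Pair2' f, of v]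
    by (simp_all add: measurable_cong_sets[OF s1] measurable_cong_sets[OF s2] space_pair_measure)
  interpret P: pair_sigma_finite \<gamma>1 \<gamma>2 ..
  have f1: "(\<integral>\<^sup>+v. f (u, v) \<partial>\<gamma>2) = 1" if "g (c (snd u)) \<noteq> 0" for u
  proof -
    have "(\<integral>\<^sup>+v. f (u, v) \<partial>\<gamma>2)
        = (\<integral>\<^sup>+v. inverse (g (c (snd u))) * indicator {v. c (fst v) = c (snd u)} v \<partial>\<gamma>2)"
      unfolding f_def by (intro nn_integral_cong) (auto split: split_indicator)
    also have "\<dots> = inverse (g (c (snd u))) * g (c (snd u))"
      unfolding g2 by (rule nn_integral_cmult) measurable
    also have "\<dots> = 1"
      using that gfin[of "c (snd u)"]
      by (subst mult.commute) (simp add: divide_ennreal_def[symmetric] ennreal_divide_self less_top)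
    finally show ?thesis .
  qed
  have f2: "(\<integral>\<^sup>+u. f (u, v) \<partial>\<gamma>1) = 1" if "g (c (fst v)) \<noteq> 0" for v
  proof -
    have "(\<integral>\<^sup>+u. f (u, v) \<partial>\<gamma>1)
        = (\<integral>\<^sup>+u. inverse (g (c (fst v))) * indicator {u. c (snd u) = c (fst v)} u \<partial>\<gamma>1)"
      unfolding f_def by (intro nn_integral_cong) (auto split: split_indicator)
    also have "\<dots> = inverse (g (c (fst v))) * g (c (fst v))"
      unfolding g1 by (rule nn_integral_cmult) measurable
    also have "\<dots> = 1"
      using that gfin[of "c (fst v)"]
      by (subst mult.commute) (simp add: divide_ennreal_def[symmetric] ennreal_divide_self less_top)
    finally show ?thesis .
  qed
  define \<Gamma> where "\<Gamma> = density (\<gamma>1 \<Otimes>\<^sub>M \<gamma>2) f"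
  have sets12: "sets (\<gamma>1 \<Otimes>\<^sub>M \<gamma>2) = sets ((borel \<Otimes>\<^sub>M borel) \<Otimes>\<^sub>M (borel \<Otimes>\<^sub>M borel))"
    by (intro sets_pair_measure_cong) auto
  show ?thesis
  proof
    show sG: "sets \<Gamma> = sets ((borel \<Otimes>\<^sub>M borel) \<Otimes>\<^sub>M (borel \<Otimes>\<^sub>M borel))"
      unfolding \<Gamma>_def using sets12 by simp
    show "distr \<Gamma> (borel \<Otimes>\<^sub>M borel) fst = \<gamma>1"
    proof (rule measure_eqI)
      fix A assume "A \<in> sets (distr \<Gamma> (borel \<Otimes>\<^sub>M borel) fst)"
      then have A[measurable]: "A \<in> sets (borel \<Otimes>\<^sub>M borel)" by simp
      have "emeasure (distr \<Gamma> (borel \<Otimes>\<^sub>M borel) fst) A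
        = (\<integral>\<^sup>+w. f w * indicator A (fst w) \<partial>(\<gamma>1 \<Otimes>\<^sub>M \<gamma>2))"
        unfolding \<Gamma>_def
        apply (subst nn_integral_indicator[symmetric], simp)
        apply (subst nn_integral_distr, measurable)
        apply (subst nn_integral_density, measurable)
        done
      also have "\<dots> = (\<integral>\<^sup>+u. \<integral>\<^sup>+v. f (u, v) * indicator A u \<partial>\<gamma>2 \<partial>\<gamma>1)"
        by (subst G2.nn_integral_fst[symmetric]) auto
      also have "\<dots> = (\<integral>\<^sup>+u. (\<integral>\<^sup>+v. f (u, v) \<partial>\<gamma>2) * indicator A u \<partial>\<gamma>1)"
        by (intro nn_integral_cong nn_integral_multc fu)
      also have "\<dots> = (\<integral>\<^sup>+u. indicator A u \<partial>\<gamma>1)"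
        using gpos1 by (intro nn_integral_cong_AE) (auto simp: f1)
      also have "\<dots> = emeasure \<gamma>1 A" by simp
      finally show "emeasure (distr \<Gamma> (borel \<Otimes>\<^sub>M borel) fst) A = emeasure \<gamma>1 A" .
    qed simp
    show "distr \<Gamma> (borel \<Otimes>\<^sub>M borel) snd = \<gamma>2"
    proof (rule measure_eqI)
      fix A assume "A \<in> sets (distr \<Gamma> (borel \<Otimes>\<^sub>M borel) snd)"
      then have A[measurable]: "A \<in> sets (borel \<Otimes>\<^sub>M borel)" by simp
      have "emeasure (distr \<Gamma> (borel \<Otimes>\<^sub>M borel) snd) A
        = (\<integral>\<^sup>+w. f w * indicator A (snd w) \<partial>(\<gamma>1 \<Otimes>\<^sub>M \<gamma>2))"
        unfolding \<Gamma>_def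
        apply (subst nn_integral_indicator[symmetric], simp)
        apply (subst nn_integral_distr, measurable)
        apply (subst nn_integral_density, measurable)
        done
      also have "\<dots> = (\<integral>\<^sup>+v. \<integral>\<^sup>+u. f (u, v) * indicator A v \<partial>\<gamma>1 \<partial>\<gamma>2)"
        by (subst P.nn_integral_snd[symmetric]) auto
      also have "\<dots> = (\<integral>\<^sup>+v. (\<integral>\<^sup>+u. f (u, v) \<partial>\<gamma>1) * indicator A v \<partial>\<gamma>2)"
        by (intro nn_integral_cong nn_integral_multc fv)
      also have "\<dots> = (\<integral>\<^sup>+v. indicator A v \<partial>\<gamma>2)"
        using gpos2 by (intro nn_integral_cong_AE) (auto simp: f2)
      also have "\<dots> = emeasure \<gamma>2 A" by simp
      finally show "emeasure (distr \<Gamma> (borel \<Otimes>\<^sub>M borel) snd) A = emeasure \<gamma>2 A" .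
    qed simp
    have "AE w in \<gamma>1 \<Otimes>\<^sub>M \<gamma>2. 0 < f w \<longrightarrow> dist (snd (fst w)) (fst (snd w)) \<le> \<epsilon>"
      by (intro AE_I2) (auto simp: f_def intro!: c)
    then show "AE w in \<Gamma>. dist (snd (fst w)) (fst (snd w)) \<le> \<epsilon>"
      unfolding \<Gamma>_def by (subst AE_density) auto
  qed
qed

text \<open>Bernoulli's inequality: a convex function lies above its tangent at 1. The point 0 is
  treated apart because convexity is invoked on the open half-line.\<close>

lemma powr_ge_tangent:
  fixes t p :: real
  assumes "p \<ge> 1" "t \<ge> 0"
  shows "1 + p * (t - 1) \<le> t powr p"
proof (cases "t = 0")
  case False
  with assms have t: "t > 0" by auto
  have "p * 1 powr (p - 1) * (t - 1) \<le> t powr p - 1 powr p"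
  proof (rule convex_on_imp_above_tangent[where A="{0<..}"])
    show "convex_on {0<..} (\<lambda>x. x powr p)" using powr_convex[OF assms(1)] .
    show "((\<lambda>x. x powr p) has_real_derivative p * 1 powr (p - 1)) (at 1 within {0<..})"
      by (auto intro!: derivative_eq_intros)
  qed (use t in \<open>auto simp: interior_open\<close>)
  then show ?thesis by simp
qed (use assms in simp)

text \<open>Jensen's inequality with weights a/S, b/S, c/S, obtained by summing the tangent
  inequalities at the weighted mean \<open>m\<close>. It does the work of Minkowski's inequality: if
  three terms have p-th moments at most a^p, b^p and c^p, their sum has p-th moment at most
  S^p.\<close>

lemma powr_sum3_le:
  fixes p :: real
  assumes p: "p \<ge> 1" and pos: "a > 0" "b > 0" "c > 0" and x: "x \<ge> 0" "y \<ge> 0" "z \<ge> 0"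
  defines "S \<equiv> a + b + c"
  shows "(x + y + z) powr p
    \<le> S powr p * (a / S * (x / a) powr p + b / S * (y / b) powr p + c / S * (z / c) powr p)"
proof (cases "x + y + z = 0")
  case True
  then show ?thesis using pos by (simp add: S_def)
next
  case False
  have S: "S > 0" using pos by (simp add: S_def)
  define m where "m = (x + y + z) / S"
  have m: "m > 0" unfolding m_def using False x S by (intro divide_pos_pos) linarith+
  have tan: "e * (m powr p * (1 + p * (u / (e * m) - 1))) \<le> e * (u / e) powr p" if "e > 0" "u \<ge> 0" for e u
  proof -
    have "m powr p * (1 + p * (u / (e * m) - 1)) \<le> m powr p * (u / (e * m)) powr p"
      using that m p by (intro mult_left_mono powr_ge_tangent) auto
    also have "\<dots> = (u / e) powr p"
      using that m by (simp add: powr_divide powr_mult)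
    finally show ?thesis using that by simp
  qed
  have "S * m powr p = m powr p * (S * (1 - p) + p * (x + y + z) / m)"
    using m S False by (simp add: m_def field_simps)
  also have "\<dots> = a * (m powr p * (1 + p * (x / (a * m) - 1))) + b * (m powr p * (1 + p * (y / (b * m) - 1)))
      + c * (m powr p * (1 + p * (z / (c * m) - 1)))"
    using m pos by (simp add: S_def field_simps)
  also have "\<dots> \<le> a * (x / a) powr p + b * (y / b) powr p + c * (z / c) powr p"
    using tan[OF pos(1) x(1)] tan[OF pos(2) x(2)] tan[OF pos(3) x(3)] by linarith
  finally have *: "m powr p \<le> (a * (x / a) powr p + b * (y / b) powr p + c * (z / c) powr p) / S"
    using S by (simp add: field_simps)
  have "(x + y + z) powr p = S powr p * m powr p"
    using S x m_def by (simp add: powr_divide)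
  also have "\<dots> \<le> S powr p * ((a * (x / a) powr p + b * (y / b) powr p + c * (z / c) powr p) / S)"
    using * by (intro mult_left_mono) auto
  finally show ?thesis by (simp add: add_divide_distrib)
qed

definition transport_cost :: "real \<Rightarrow> ((real ^ 'd) \<times> (real ^ 'd)) measure \<Rightarrow> ennreal" where
  "transport_cost p \<gamma> = (\<integral>\<^sup>+ z. ennreal (dist (fst z) (snd z) powr p) \<partial>\<gamma>)"

lemma wasserstein_le_of_coupling:
  assumes "\<gamma> \<in> couplings \<mu> \<nu>" "transport_cost p \<gamma> \<le> ennreal (a powr p)" "a \<ge> 0" "p > 0"
  shows "wasserstein p \<mu> \<nu> \<le> ennreal a"
proof -
  define c where "c = (INF \<gamma> \<in> couplings \<mu> \<nu>. \<integral>\<^sup>+ z. ennreal (dist (fst z) (snd z) powr p) \<partial>\<gamma>)"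
  have "c \<le> transport_cost p \<gamma>"
    unfolding c_def transport_cost_def using assms(1) by (rule INF_lower)
  then have c: "c \<le> ennreal (a powr p)" using assms(2) by simp
  then have "c \<noteq> \<infinity>" by (auto simp: top_unique)
  moreover have "enn2real c powr (1 / p) \<le> (a powr p) powr (1 / p)"
    using c assms by (intro powr_mono2 enn2real_leI) auto
  moreover have "(a powr p) powr (1 / p) = a"
    using assms by (simp add: powr_powr)
  ultimately show ?thesis
    unfolding wasserstein_def c_def[symmetric] Let_def by (simp add: ennreal_leI)
qed

text \<open>The infimum over couplings need not be attained, so a strict bound is what produces an
  actual coupling. The resulting slack is removed in \<open>wasserstein_triangle\<close>.\<close>

lemma obtain_coupling:
  assumes "wasserstein p \<mu> \<nu> < ennreal a" "p > 0"
  obtains \<gamma> where "\<gamma> \<in> couplings \<mu> \<nu>" "transport_cost p \<gamma> \<le> ennreal (a powr p)"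
proof -
  define c where "c = (INF \<gamma> \<in> couplings \<mu> \<nu>. \<integral>\<^sup>+ z. ennreal (dist (fst z) (snd z) powr p) \<partial>\<gamma>)"
  have c: "c \<noteq> \<infinity>" "ennreal (enn2real c powr (1 / p)) < ennreal a"
    using assms(1) unfolding wasserstein_def c_def[symmetric] Let_def by (auto split: if_splits)
  have "enn2real c powr (1 / p) < a"
    using c(2) by (simp add: ennreal_less_iff)
  then have "(enn2real c powr (1 / p)) powr p < a powr p"
    using assms(2) by (intro powr_less_mono2) auto
  then have "enn2real c < a powr p"
    using assms(2) by (simp add: powr_powr)
  then have "c < ennreal (a powr p)"
    using c(1) by (metis ennreal_enn2real ennreal_less_iff enn2real_nonneg infinity_ennreal_def less_top)
  then obtain \<gamma> where "\<gamma> \<in> couplings \<mu> \<nu>" "transport_cost p \<gamma> < ennreal (a powr p)"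
    unfolding c_def transport_cost_def INF_less_iff by auto
  then show ?thesis using that by (auto simp: less_imp_le)
qed

text \<open>The glued law carries both couplings, with the two middle points within
  \<open>\<epsilon>\<close> of each other. The outer distance is then at most a sum of three
  distances, whose p-costs are at most a^p, \<epsilon>^p and b^p, and \<open>powr_sum3_le\<close>
  combines them.\<close>

lemma wasserstein_less_triangle:
  fixes \<mu> \<nu> \<rho> :: "(real ^ 'd) measure"
  assumes prob: "prob_space \<mu>" "prob_space \<nu>" and p: "p \<ge> 1"
    and less: "wasserstein p \<mu> \<nu> < ennreal a" "wasserstein p \<nu> \<rho> < ennreal b" and "\<epsilon> > 0"
  shows "wasserstein p \<mu> \<rho> \<le> ennreal (a + \<epsilon> + b)"
proof -
  have pos: "a > 0" "b > 0"
  proof -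
    show "a > 0" using less(1) ennreal_neg[of a] by (cases "a > 0") auto
    show "b > 0" using less(2) ennreal_neg[of b] by (cases "b > 0") auto
  qed
  have p0: "p > 0" using p by simp
  obtain \<gamma>1 where \<gamma>1: "\<gamma>1 \<in> couplings \<mu> \<nu>" "transport_cost p \<gamma>1 \<le> ennreal (a powr p)"
    using obtain_coupling[OF less(1) p0] by metis
  obtain \<gamma>2 where \<gamma>2: "\<gamma>2 \<in> couplings \<nu> \<rho>" "transport_cost p \<gamma>2 \<le> ennreal (b powr p)"
    using obtain_coupling[OF less(2) p0] by metis
  obtain \<Gamma> where sG[simp, measurable_cong]: "sets \<Gamma> = sets ((borel \<Otimes>\<^sub>M borel) \<Otimes>\<^sub>M (borel \<Otimes>\<^sub>M borel))"
    and G: "distr \<Gamma> (borel \<Otimes>\<^sub>M borel) fst = \<gamma>1" "distr \<Gamma> (borel \<Otimes>\<^sub>M borel) snd = \<gamma>2"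
    and close: "AE w in \<Gamma>. dist (snd (fst w)) (fst (snd w)) \<le> \<epsilon>"
    by (rule approximate_gluing[OF \<gamma>1(1) \<gamma>2(1) prob \<open>\<epsilon> > 0\<close>])
  have G_prob: "prob_space \<Gamma>"
    by (rule prob_space_distrD[of fst _ "borel \<Otimes>\<^sub>M borel"])
      (auto simp: G(1) couplings_prob_space[OF \<gamma>1(1) prob(1)])
  define S where "S = a + \<epsilon> + b"
  have S: "S > 0" using pos \<open>\<epsilon> > 0\<close> by (simp add: S_def)
  define \<gamma> where "\<gamma> = distr \<Gamma> (borel \<Otimes>\<^sub>M borel) (\<lambda>w. (fst (fst w), snd (snd w)))"
  have "\<gamma> \<in> couplings \<mu> \<rho>"
    unfolding couplings_def
  proof (safe; (simp add: \<gamma>_def; fail)?)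
    have "distr \<gamma> borel fst = distr \<Gamma> borel (fst \<circ> fst)"
      unfolding \<gamma>_def by (subst distr_distr) (auto simp: comp_def)
    also have "\<dots> = distr \<gamma>1 borel fst"
      unfolding G(1)[symmetric] by (subst distr_distr) auto
    finally show "distr \<gamma> borel fst = \<mu>" using couplingsD[OF \<gamma>1(1)] by simp
    have "distr \<gamma> borel snd = distr \<Gamma> borel (snd \<circ> snd)"
      unfolding \<gamma>_def by (subst distr_distr) (auto simp: comp_def)
    also have "\<dots> = distr \<gamma>2 borel snd"
      unfolding G(2)[symmetric] by (subst distr_distr) auto
    finally show "distr \<gamma> borel snd = \<rho>" using couplingsD[OF \<gamma>2(1)] by simp
  qed
  moreover have "transport_cost p \<gamma> \<le> ennreal (S powr p)"
  proof -
    have scaled: "(\<integral>\<^sup>+z. ennreal ((dist (fst z) (snd z) / e) powr p) \<partial>\<gamma>') \<le> 1"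
      if [measurable_cong]: "sets \<gamma>' = sets (borel \<Otimes>\<^sub>M borel)"
        and cost: "transport_cost p \<gamma>' \<le> ennreal (e powr p)" and "e > 0" for e and \<gamma>' :: "((real ^ 'd) \<times> (real ^ 'd)) measure"
    proof -
      have "(\<integral>\<^sup>+z. ennreal ((dist (fst z) (snd z) / e) powr p) \<partial>\<gamma>')
          = (\<integral>\<^sup>+z. ennreal (1 / e powr p) * ennreal (dist (fst z) (snd z) powr p) \<partial>\<gamma>')"
        using \<open>e > 0\<close> by (intro nn_integral_cong) (simp add: powr_divide ennreal_mult[symmetric])
      also have "\<dots> = ennreal (1 / e powr p) * transport_cost p \<gamma>'"
        unfolding transport_cost_def by (rule nn_integral_cmult) measurable
      also have "\<dots> \<le> ennreal (1 / e powr p) * ennreal (e powr p)"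
        by (intro mult_left_mono cost) auto
      also have "\<dots> = 1"
        using \<open>e > 0\<close> by (simp add: ennreal_mult[symmetric])
      finally show ?thesis .
    qed
    let ?A = "\<lambda>w. dist (fst (fst w)) (snd (fst w)) / a"
    let ?E = "\<lambda>w. dist (snd (fst w)) (fst (snd w)) / \<epsilon>"
    let ?B = "\<lambda>w. dist (fst (snd w)) (snd (snd w)) / b"
    have A: "(\<integral>\<^sup>+w. ennreal (?A w powr p) \<partial>\<Gamma>) \<le> 1"
      using scaled[OF couplingsD(1)[OF \<gamma>1(1)] \<gamma>1(2) pos(1)] unfolding G(1)[symmetric]
      by (subst (asm) nn_integral_distr) auto
    have B: "(\<integral>\<^sup>+w. ennreal (?B w powr p) \<partial>\<Gamma>) \<le> 1"
      using scaled[OF couplingsD(1)[OF \<gamma>2(1)] \<gamma>2(2) pos(2)] unfolding G(2)[symmetric]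
      by (subst (asm) nn_integral_distr) auto
    have "(\<integral>\<^sup>+w. ennreal (?E w powr p) \<partial>\<Gamma>) \<le> (\<integral>\<^sup>+w. 1 \<partial>\<Gamma>)"
      using close
    proof (intro nn_integral_mono_AE, eventually_elim)
      case (elim w)
      then have "?E w powr p \<le> 1 powr p"
        using p \<open>\<epsilon> > 0\<close> by (intro powr_mono2) auto
      then show ?case by simp
    qed
    then have E: "(\<integral>\<^sup>+w. ennreal (?E w powr p) \<partial>\<Gamma>) \<le> 1"
      using prob_space.emeasure_space_1[OF G_prob] by simp
    have "transport_cost p \<gamma> = (\<integral>\<^sup>+w. ennreal (dist (fst (fst w)) (snd (snd w)) powr p) \<partial>\<Gamma>)"
      unfolding transport_cost_def \<gamma>_def by (subst nn_integral_distr) auto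
    also have "\<dots> \<le> (\<integral>\<^sup>+w. ennreal (S powr p) * (ennreal (a / S) * ennreal (?A w powr p)
      + ennreal (\<epsilon> / S) * ennreal (?E w powr p) + ennreal (b / S) * ennreal (?B w powr p)) \<partial>\<Gamma>)"
    proof (intro nn_integral_mono)
      fix w :: "((real ^ 'd) \<times> (real ^ 'd)) \<times> ((real ^ 'd) \<times> (real ^ 'd))"
      let ?x = "dist (fst (fst w)) (snd (fst w))" and ?y = "dist (snd (fst w)) (fst (snd w))"
        and ?z = "dist (fst (snd w)) (snd (snd w))"
      have "dist (fst (fst w)) (snd (snd w)) \<le> ?x + ?y + ?z"
        using dist_triangle[of "fst (fst w)" "snd (snd w)" "snd (fst w)"]
          dist_triangle[of "snd (fst w)" "snd (snd w)" "fst (snd w)"] by linarith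
      then have "dist (fst (fst w)) (snd (snd w)) powr p \<le> (?x + ?y + ?z) powr p"
        using p by (intro powr_mono2) auto
      also have "\<dots> \<le> S powr p * (a / S * ?A w powr p + \<epsilon> / S * ?E w powr p + b / S * ?B w powr p)"
        unfolding S_def using p pos \<open>\<epsilon> > 0\<close> by (intro powr_sum3_le) auto
      finally have "ennreal (dist (fst (fst w)) (snd (snd w)) powr p) \<le>
         ennreal (S powr p * (a / S * ?A w powr p + \<epsilon> / S * ?E w powr p + b / S * ?B w powr p))"
        by (rule ennreal_leI)
      also have "\<dots> = ennreal (S powr p) * (ennreal (a / S) * ennreal (?A w powr p)
      + ennreal (\<epsilon> / S) * ennreal (?E w powr p) + ennreal (b / S) * ennreal (?B w powr p))"
        using S pos \<open>\<epsilon> > 0\<close> by (simp add: ennreal_mult ennreal_plus del: times_divide_eq_left)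
      finally show "ennreal (dist (fst (fst w)) (snd (snd w)) powr p) \<le> \<dots>" .
    qed
    also have "\<dots> = ennreal (S powr p) * (ennreal (a / S) * (\<integral>\<^sup>+w. ennreal (?A w powr p) \<partial>\<Gamma>)
      + ennreal (\<epsilon> / S) * (\<integral>\<^sup>+w. ennreal (?E w powr p) \<partial>\<Gamma>) + ennreal (b / S) * (\<integral>\<^sup>+w. ennreal (?B w powr p) \<partial>\<Gamma>))"
      by (simp add: nn_integral_cmult nn_integral_add)
    also have "\<dots> \<le> ennreal (S powr p) * (ennreal (a / S) * 1 + ennreal (\<epsilon> / S) * 1 + ennreal (b / S) * 1)"
      using A E B by (intro mult_left_mono add_mono) auto
    also have "ennreal (a / S) * 1 + ennreal (\<epsilon> / S) * 1 + ennreal (b / S) * 1 = ennreal ((a + \<epsilon> + b) / S)"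
      using S pos \<open>\<epsilon> > 0\<close> by (simp add: ennreal_plus[symmetric] add_divide_distrib del: ennreal_plus)
    also have "(a + \<epsilon> + b) / S = 1"
      using S unfolding S_def by simp
    finally show ?thesis by simp
  qed
  ultimately show ?thesis
    using wasserstein_le_of_coupling[of \<gamma> \<mu> \<rho> p S] S p by (simp add: S_def)
qed

lemma wasserstein_triangle:
  fixes \<mu> \<nu> \<rho> :: "(real ^ 'd) measure"
  assumes "prob_space \<mu>" "prob_space \<nu>" "p \<ge> 1"
  shows "wasserstein p \<mu> \<rho> \<le> wasserstein p \<mu> \<nu> + wasserstein p \<nu> \<rho>"
proof (rule ennreal_le_epsilon)
  fix e :: real assume fin: "wasserstein p \<mu> \<nu> + wasserstein p \<nu> \<rho> < top" and "0 < e"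
  from fin obtain u v where uv: "wasserstein p \<mu> \<nu> = ennreal u" "wasserstein p \<nu> \<rho> = ennreal v" "u \<ge> 0" "v \<ge> 0"
    by (cases "wasserstein p \<mu> \<nu>"; cases "wasserstein p \<nu> \<rho>") auto
  \<comment> \<open>The slack e is shared equally by the two strict bounds and the diameter of the
    cells.\<close>
  have "wasserstein p \<mu> \<rho> \<le> ennreal ((u + e / 3) + e / 3 + (v + e / 3))"
    by (rule wasserstein_less_triangle[OF assms(1,2,3)]) (use uv \<open>e > 0\<close> in \<open>auto simp: ennreal_less_iff simp del: ennreal_plus\<close>)
  also have "(u + e / 3) + e / 3 + (v + e / 3) = u + v + e" by simp
  also have "ennreal (u + v + e) = wasserstein p \<mu> \<nu> + wasserstein p \<nu> \<rho> + ennreal e"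
    using uv \<open>e > 0\<close> by (simp add: ennreal_plus)
  finally show "wasserstein p \<mu> \<rho> \<le> wasserstein p \<mu> \<nu> + wasserstein p \<nu> \<rho> + ennreal e" .
qed

section \<open>The standard Gaussian law\<close>

lemma nn_integral_lborel_plus:
  fixes f :: "'a::euclidean_space \<Rightarrow> ennreal"
  assumes "f \<in> borel_measurable borel"
  shows "(\<integral>\<^sup>+x. f (a + x) \<partial>lborel) = (\<integral>\<^sup>+x. f x \<partial>lborel)"
  using assms by (subst (2) lborel_distr_plus[of a, symmetric]) (simp add: nn_integral_distr)

lemma nn_integral_lborel_minus:
  fixes f :: "'a::euclidean_space \<Rightarrow> ennreal"
  assumes "f \<in> borel_measurable borel"
  shows "(\<integral>\<^sup>+x. f (a - x) \<partial>lborel) = (\<integral>\<^sup>+x. f x \<partial>lborel)"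
  using assms by (subst (2) lborel_affine[of "-1" a]) (auto simp: nn_integral_density nn_integral_distr density_1)

text \<open>Translation invariant measures are proportional to Lebesgue measure, by evaluating
  \<open>\<integral>\<integral> 1\<^sub>A(x) 1\<^sub>B(x + y) d\<mu>(x) dy\<close> in both orders; the unit ball fixes the constant.\<close>

lemma lborel_distr_orthogonal:
  fixes T :: "'a::euclidean_space \<Rightarrow> 'a"
  assumes T: "orthogonal_transformation T"
  shows "distr lborel borel T = lborel"
proof -
  have lin: "linear T" and nT: "\<And>x. norm (T x) = norm x"
    using T by (auto simp: orthogonal_transformation)
  have [measurable]: "T \<in> borel \<rightarrow>\<^sub>M borel"
    using lin by (simp add: borel_measurable_continuous_onI linear_continuous_on linear_conv_bounded_linear)
  define \<mu> where "\<mu> = distr lborel borel T"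
  have [simp, measurable_cong]: "sets \<mu> = sets borel" by (simp add: \<mu>_def)
  have ball: "emeasure \<mu> (ball 0 r) = emeasure lborel (ball 0 r :: 'a set)" for r
  proof -
    have "T -` ball 0 r = ball 0 r" by (auto simp: nT)
    then show ?thesis by (simp add: \<mu>_def emeasure_distr)
  qed
  have "sigma_finite_measure \<mu>"
  proof
    show "\<exists>A. countable A \<and> A \<subseteq> sets \<mu> \<and> \<Union> A = space \<mu> \<and> (\<forall>a\<in>A. emeasure \<mu> a \<noteq> \<infinity>)"
    proof (intro exI[of _ "range (\<lambda>n::nat. ball 0 (real n))"] conjI ballI)
      have "\<exists>n. norm x < real n" for x :: 'a by (rule reals_Archimedean2)
      then show "\<Union> (range (\<lambda>n::nat. ball 0 (real n))) = space \<mu>"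
        using sets_eq_imp_space_eq[of \<mu> borel] by auto
      show "emeasure \<mu> a \<noteq> \<infinity>" if "a \<in> range (\<lambda>n::nat. ball 0 (real n))" for a
        using that emeasure_lborel_ball_finite by (auto simp: ball less_top)
    qed auto
  qed
  then interpret \<mu>: sigma_finite_measure \<mu> .
  interpret pair_sigma_finite \<mu> "lborel :: 'a measure" ..
  \<comment> \<open>An orthogonal map conjugates the translation by a' to the translation by T a',
    so the image measure inherits translation invariance from Lebesgue measure.\<close>
  have trans: "(\<integral>\<^sup>+x. f (x - a) \<partial>\<mu>) = (\<integral>\<^sup>+x. f x \<partial>\<mu>)" if [measurable]: "f \<in> borel_measurable borel" for f a
  proof -
    obtain a' where a': "T a' = a"
      using orthogonal_transformation_surj[OF T] by (metis surjD)
    have "(\<integral>\<^sup>+x. f (x - a) \<partial>\<mu>) = (\<integral>\<^sup>+x. f (T (- a' + x)) \<partial>lborel)"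
      unfolding \<mu>_def by (subst nn_integral_distr) (auto simp: linear_diff[OF lin] linear_add[OF lin] linear_neg[OF lin] a')
    also have "\<dots> = (\<integral>\<^sup>+x. f (T x) \<partial>lborel)"
      by (rule nn_integral_lborel_plus) measurable
    also have "\<dots> = (\<integral>\<^sup>+x. f x \<partial>\<mu>)"
      unfolding \<mu>_def by (subst nn_integral_distr) auto
    finally show ?thesis .
  qed
  have swap: "emeasure \<mu> A * emeasure lborel B = emeasure \<mu> B * emeasure lborel A"
    if [measurable]: "A \<in> sets borel" "B \<in> sets borel" for A B
  proof -
    have "emeasure \<mu> A * emeasure lborel B = (\<integral>\<^sup>+x. indicator A x * (\<integral>\<^sup>+y. indicator B (x + y) \<partial>lborel) \<partial>\<mu>)"
      by (subst nn_integral_lborel_plus) (auto simp: nn_integral_multc)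
    also have "\<dots> = (\<integral>\<^sup>+x. \<integral>\<^sup>+y. indicator A x * indicator B (x + y) \<partial>lborel \<partial>\<mu>)"
      by (subst nn_integral_cmult) auto
    also have "\<dots> = (\<integral>\<^sup>+y. \<integral>\<^sup>+x. indicator A x * indicator B (x + y) \<partial>\<mu> \<partial>lborel)"
      by (subst Fubini') auto
    also have "\<dots> = (\<integral>\<^sup>+y. \<integral>\<^sup>+x. indicator A (x - y) * indicator B x \<partial>\<mu> \<partial>lborel)"
    proof (rule nn_integral_cong)
      show "(\<integral>\<^sup>+x. indicator A x * indicator B (x + y) \<partial>\<mu>) = (\<integral>\<^sup>+x. indicator A (x - y) * indicator B x \<partial>\<mu>)" for y
        using trans[of "\<lambda>x. indicator A x * indicator B (x + y)" y] by simp
    qed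
    also have "\<dots> = (\<integral>\<^sup>+x. \<integral>\<^sup>+y. indicator A (x - y) * indicator B x \<partial>lborel \<partial>\<mu>)"
      by (subst Fubini') auto
    also have "\<dots> = (\<integral>\<^sup>+x. indicator B x * (\<integral>\<^sup>+y. indicator A (x - y) \<partial>lborel) \<partial>\<mu>)"
      by (subst nn_integral_cmult[symmetric]) (auto simp: mult.commute)
    also have "\<dots> = emeasure \<mu> B * emeasure lborel A"
      by (subst nn_integral_lborel_minus) (auto simp: nn_integral_multc)
    finally show ?thesis .
  qed
  show ?thesis
    unfolding \<mu>_def[symmetric]
  proof (rule measure_eqI)
    fix A assume "A \<in> sets \<mu>"
    then have A: "A \<in> sets borel" by simp
    let ?b = "emeasure lborel (ball 0 1 :: 'a set)"
    have b: "?b \<noteq> 0" "?b \<noteq> \<infinity>"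
      using emeasure_lborel_ball_finite[of "0::'a" 1] content_ball_pos[of 1 "0::'a"]
      by (auto simp: measure_def)
    have "?b * emeasure \<mu> A = ?b * emeasure lborel A"
      using swap[OF A, of "ball 0 1"] ball by (simp add: mult.commute)
    then show "emeasure \<mu> A = emeasure lborel A"
      using b by (simp add: ennreal_mult_cancel_left)
  qed simp
qed

definition gauss_dens :: "real ^ 'd \<Rightarrow> real" where
  "gauss_dens z = (\<Prod>i\<in>UNIV. normal_density 0 1 (z $ i))"

lemma gauss_dens_measurable[measurable]: "gauss_dens \<in> borel_measurable borel"
  unfolding gauss_dens_def by measurable

lemma gauss_dens_pos: "gauss_dens z > 0"
  unfolding gauss_dens_def by (intro prod_pos) (auto simp: normal_density_pos)

lemma gaussian_1: "gaussian 1 = density lborel (\<lambda>z. ennreal (gauss_dens z))"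
  unfolding gaussian_def gauss_dens_def by simp

lemma sets_gaussian[simp, measurable_cong]: "sets (gaussian v) = sets borel"
  by (simp add: gaussian_def)

lemma space_gaussian[simp]: "space (gaussian v) = UNIV"
  by (simp add: gaussian_def)

lemma gauss_dens_exp: "gauss_dens (z :: real ^ 'd) = (1 / sqrt (2 * pi)) ^ CARD('d) * exp (- (norm z)\<^sup>2 / 2)"
proof -
  have "gauss_dens z = (\<Prod>i\<in>UNIV. 1 / sqrt (2 * pi) * exp (- (z $ i)\<^sup>2 / 2))"
    unfolding gauss_dens_def normal_density_def by simp
  also have "\<dots> = (1 / sqrt (2 * pi)) ^ CARD('d) * exp (\<Sum>i\<in>UNIV. - (z $ i)\<^sup>2 / 2)"
    by (simp add: prod.distrib exp_sum prod_dividef power_divide)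
  also have "(\<Sum>i\<in>UNIV. - (z $ i)\<^sup>2 / 2) = - (norm z)\<^sup>2 / 2"
    by (simp add: norm_vec_def L2_set_def sum_nonneg sum_negf sum_divide_distrib)
  finally show ?thesis .
qed

lemma gauss_dens_norm_cong:
  fixes z z' :: "real ^ 'd"
  shows "norm z = norm z' \<Longrightarrow> gauss_dens z = gauss_dens z'"
  by (simp add: gauss_dens_exp)

text \<open>Completing the square gives the likelihood ratio between a shifted and an unshifted
  Gaussian; this ratio becomes \<open>accept_prob\<close>.\<close>

lemma gauss_dens_plus:
  "gauss_dens (z + w) = gauss_dens z * exp (- (z \<bullet> w) - (norm w)\<^sup>2 / 2)"
proof -
  have *: "- (norm (z + w))\<^sup>2 / 2 = - (norm z)\<^sup>2 / 2 + (- (z \<bullet> w) - (norm w)\<^sup>2 / 2)"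
    by (simp add: power2_norm_eq_inner inner_add_left inner_add_right inner_commute add_divide_distrib diff_divide_distrib)
  show ?thesis unfolding gauss_dens_exp * exp_add by simp
qed

lemma nn_integral_gaussian:
  assumes "f \<in> borel_measurable borel"
  shows "(\<integral>\<^sup>+z. f z \<partial>gaussian 1) = (\<integral>\<^sup>+z. ennreal (gauss_dens z) * f z \<partial>lborel)"
  unfolding gaussian_1 using assms by (subst nn_integral_density) auto

lemma nn_integral_lborel_vec_prod:
  fixes f :: "real \<Rightarrow> ennreal"
  assumes [measurable]: "f \<in> borel_measurable borel"
  shows "(\<integral>\<^sup>+z. (\<Prod>i\<in>UNIV. f (z $ i)) \<partial>(lborel :: (real ^ 'd) measure)) = (\<integral>\<^sup>+x. f x \<partial>lborel) ^ CARD('d)"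
proof -
  have B: "(Basis :: (real ^ 'd) set) = (\<lambda>i. axis i 1) ` UNIV"
    by (auto simp: Basis_vec_def)
  have inj: "inj (\<lambda>i::'d. axis i (1::real))"
    by (auto simp: inj_def axis_eq_axis)
  have "(\<integral>\<^sup>+z. (\<Prod>i\<in>UNIV. f (z $ i)) \<partial>(lborel :: (real ^ 'd) measure))
      = (\<integral>\<^sup>+z. (\<Prod>b\<in>Basis. f (z \<bullet> b)) \<partial>(lborel :: (real ^ 'd) measure))"
    unfolding B by (subst prod.reindex) (auto simp: inj comp_def inner_axis)
  also have "\<dots> = (\<Prod>b\<in>(Basis :: (real ^ 'd) set). (\<integral>\<^sup>+x. f x \<partial>lborel))"
    by (rule nn_integral_lborel_prod) auto
  finally show ?thesis by simp
qed

lemma prob_space_gaussian: "prob_space (gaussian 1 :: (real ^ 'd) measure)"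
proof
  interpret prob_space "density lborel (normal_density 0 1)" by (rule prob_space_normal_density) simp
  have 1: "(\<integral>\<^sup>+x. ennreal (normal_density 0 1 x) \<partial>lborel) = 1"
    using emeasure_space_1 by (simp add: emeasure_density)
  have "emeasure (gaussian 1) (space (gaussian 1 :: (real ^ 'd) measure))
      = (\<integral>\<^sup>+z. (\<Prod>i\<in>UNIV. ennreal (normal_density 0 1 (z $ i))) \<partial>(lborel :: (real ^ 'd) measure))"
    by (simp add: gaussian_1 emeasure_density gauss_dens_def prod_ennreal)
  also have "\<dots> = 1"
    by (subst nn_integral_lborel_vec_prod) (auto simp: 1)
  finally show "emeasure (gaussian 1) (space (gaussian 1 :: (real ^ 'd) measure)) = 1" .
qed

text \<open>Serves to dominate the squared norm by a product over coordinates, so that the Gaussian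
  second moment is bounded by a power of a one-dimensional integral.\<close>

lemma sum_le_prod_one_plus:
  fixes t :: "'a \<Rightarrow> real"
  assumes "finite A" "\<And>i. i \<in> A \<Longrightarrow> t i \<ge> 0"
  shows "1 + (\<Sum>i\<in>A. t i) \<le> (\<Prod>i\<in>A. 1 + t i)"
  using assms
proof (induction A rule: finite_induct)
  case (insert x A)
  have "1 + (\<Sum>i\<in>insert x A. t i) \<le> (1 + t x) * (1 + (\<Sum>i\<in>A. t i))"
    using insert by (auto simp: algebra_simps sum_nonneg)
  also have "\<dots> \<le> (1 + t x) * (\<Prod>i\<in>A. 1 + t i)"
    using insert by (intro mult_left_mono) auto
  finally show ?case using insert by simp
qed simp

lemma integrable_gaussian_norm_square: "integrable (gaussian 1 :: (real ^ 'd) measure) (\<lambda>z. (norm z)\<^sup>2)"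
proof (rule integrableI_nonneg)
  let ?f = "\<lambda>x. ennreal ((1 + x\<^sup>2) * normal_density 0 1 x)"
  have "integrable lborel (\<lambda>x. normal_density 0 1 x * (x - 0) ^ (2 * 1))"
    using normal_moment_even[of 1 0 1] unfolding has_bochner_integral_iff by simp
  then have "integrable lborel (\<lambda>x. normal_density 0 1 x + normal_density 0 1 x * (x - 0) ^ (2 * 1))"
    by (intro Bochner_Integration.integrable_add) auto
  then have "integrable lborel (\<lambda>x. (1 + x\<^sup>2) * normal_density 0 1 x)"
    by (rule Bochner_Integration.integrable_cong[THEN iffD1, rotated 2]) (auto simp: algebra_simps power2_eq_square)
  then have fin: "(\<integral>\<^sup>+x. ?f x \<partial>lborel) < \<infinity>"
    by (subst (asm) integrable_iff_bounded) auto
  have "(\<integral>\<^sup>+z. ennreal ((norm z)\<^sup>2) \<partial>(gaussian 1 :: (real ^ 'd) measure)) = (\<integral>\<^sup>+z. ennreal (gauss_dens z) * ennreal ((norm z)\<^sup>2) \<partial>(lborel :: (real ^ 'd) measure))"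
    by (rule nn_integral_gaussian) measurable
  also have "\<dots> \<le> (\<integral>\<^sup>+z. (\<Prod>i\<in>UNIV. ?f (z $ i)) \<partial>(lborel :: (real ^ 'd) measure))"
  proof (rule nn_integral_mono)
    fix z :: "real ^ 'd"
    have "(norm z)\<^sup>2 = (\<Sum>i\<in>UNIV. (z $ i)\<^sup>2)"
      by (simp add: norm_vec_def L2_set_def sum_nonneg)
    also have "\<dots> \<le> (\<Prod>i\<in>UNIV. 1 + (z $ i)\<^sup>2)"
      using sum_le_prod_one_plus[of UNIV "\<lambda>i. (z $ i)\<^sup>2"] by simp
    finally have "gauss_dens z * (norm z)\<^sup>2 \<le> (\<Prod>i\<in>UNIV. (1 + (z $ i)\<^sup>2) * normal_density 0 1 (z $ i))"
      unfolding prod.distrib gauss_dens_def[symmetric] using gauss_dens_pos[of z]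
      by (simp add: mult.commute)
    then show "ennreal (gauss_dens z) * ennreal ((norm z)\<^sup>2) \<le> (\<Prod>i\<in>UNIV. ?f (z $ i))"
      using gauss_dens_pos[of z] by (simp add: prod_ennreal ennreal_mult[symmetric] ennreal_leI less_imp_le)
  qed
  also have "\<dots> = (\<integral>\<^sup>+x. ?f x \<partial>lborel) ^ CARD('d)"
    by (rule nn_integral_lborel_vec_prod) measurable
  also have "\<dots> < \<infinity>"
    using fin by (auto simp: power_less_top_ennreal)
  finally show "(\<integral>\<^sup>+z. ennreal ((norm z)\<^sup>2) \<partial>(gaussian 1 :: (real ^ 'd) measure)) < \<infinity>" .
qed auto

lemma gaussian_distr_orthogonal:
  fixes T :: "real ^ 'd \<Rightarrow> real ^ 'd"
  assumes T: "orthogonal_transformation T"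
  shows "distr (gaussian 1) borel T = gaussian 1"
proof (rule measure_eqI)
  have lin: "linear T" and nT: "\<And>x. norm (T x) = norm x"
    using T by (auto simp: orthogonal_transformation)
  have [measurable]: "T \<in> borel \<rightarrow>\<^sub>M borel"
    using lin by (simp add: borel_measurable_continuous_onI linear_continuous_on linear_conv_bounded_linear)
  fix A assume "A \<in> sets (distr (gaussian 1) borel T)"
  then have [measurable]: "A \<in> sets borel" by simp
  have "emeasure (distr (gaussian 1) borel T) A = (\<integral>\<^sup>+z. indicator A (T z) \<partial>gaussian 1)"
    by (subst nn_integral_indicator[symmetric], simp) (subst nn_integral_distr, auto)
  also have "\<dots> = (\<integral>\<^sup>+z. ennreal (gauss_dens (T z)) * indicator A (T z) \<partial>lborel)"
    by (subst nn_integral_gaussian) (auto simp: gauss_dens_norm_cong[OF nT])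
  also have "\<dots> = (\<integral>\<^sup>+z. ennreal (gauss_dens z) * indicator A z \<partial>distr lborel borel T)"
    by (subst nn_integral_distr) auto
  also have "\<dots> = (\<integral>\<^sup>+z. indicator A z \<partial>gaussian 1)"
    unfolding lborel_distr_orthogonal[OF T] by (subst nn_integral_gaussian) auto
  finally show "emeasure (distr (gaussian 1) borel T) A = emeasure (gaussian 1) A"
    by simp
qed simp

text \<open>Rotation invariance makes this probability the same for every unit vector, so a single
  \<open>p\<close> serves all directions in which two points may be separated.\<close>

lemma gaussian_projection_tail:
  obtains p where "p > 0" "\<And>e :: real ^ 'd. norm e = 1 \<Longrightarrow> p \<le> measure (gaussian 1) {z. \<bar>z \<bullet> e\<bar> \<ge> 1}"
proof -
  interpret prob_space "gaussian 1 :: (real ^ 'd) measure" by (rule prob_space_gaussian)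
  define e0 :: "real ^ 'd" where "e0 = axis undefined 1"
  have e0: "norm e0 = 1" by (simp add: e0_def)
  define p where "p = prob {z. \<bar>z \<bullet> e0\<bar> \<ge> 1}"
  have eq: "prob {z. \<bar>z \<bullet> e\<bar> \<ge> 1} = p" if e: "norm e = 1" for e :: "real ^ 'd"
  proof -
    obtain T where T: "orthogonal_transformation T" "T e = e0"
      by (rule orthogonal_transformation_exists[of e e0]) (use e e0 in auto)
    have [measurable]: "T \<in> borel \<rightarrow>\<^sub>M borel"
      using T(1) by (simp add: borel_measurable_continuous_onI linear_continuous_on linear_conv_bounded_linear orthogonal_transformation)
    have "T z \<bullet> e0 = z \<bullet> e" for z
      using T unfolding orthogonal_transformation_def by metis
    then have "{z. \<bar>z \<bullet> e\<bar> \<ge> 1} = T -` {z. \<bar>z \<bullet> e0\<bar> \<ge> 1} \<inter> space (gaussian 1)"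
      by auto
    then have "prob {z. \<bar>z \<bullet> e\<bar> \<ge> 1} = measure (distr (gaussian 1) borel T) {z. \<bar>z \<bullet> e0\<bar> \<ge> 1}"
      by (simp add: measure_distr)
    then show ?thesis by (simp add: gaussian_distr_orthogonal[OF T(1)] p_def)
  qed
  \<comment> \<open>If the tail were null, the closed slab {|z . e0| <= 1} would have full Lebesgue
    measure and hence be the whole space, but it misses 2 e0.\<close>
  have "p \<noteq> 0"
  proof
    assume "p = 0"
    then have "emeasure (gaussian 1) {z. \<bar>z \<bullet> e0\<bar> \<ge> 1} = 0"
      unfolding p_def by (simp add: emeasure_eq_measure)
    then have "AE z in gaussian 1. \<bar>z \<bullet> e0\<bar> < 1"
      by (intro AE_I[where N="{z. \<bar>z \<bullet> e0\<bar> \<ge> 1}"]) auto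
    then have "AE z in lborel. \<bar>z \<bullet> e0\<bar> < 1"
      unfolding gaussian_1 by (subst (asm) AE_density) (auto simp: gauss_dens_pos)
    then have "AE z in lebesgue. z \<in> {z. \<bar>z \<bullet> e0\<bar> \<le> 1}"
      by (intro AE_completion) (auto elim: eventually_mono)
    moreover have "closed {z. \<bar>z \<bullet> e0\<bar> \<le> 1}"
      by (intro closed_Collect_le continuous_intros)
    ultimately have "2 *\<^sub>R e0 \<in> {z. \<bar>z \<bullet> e0\<bar> \<le> 1}"
      using mem_closed_if_AE_lebesgue by blast
    then show False using e0 by (simp add: dot_square_norm)
  qed
  then have "p > 0" using measure_nonneg[of "gaussian 1"] p_def by (metis less_eq_real_def)
  then show ?thesis using that eq by fastforce
qed

section \<open>Maximal reflection coupling of two Gaussian laws\<close>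

text \<open>The likelihood ratio \<open>gauss_dens (z + w) / gauss_dens z\<close>, which may exceed
  1; the probability of accepting the shift is its minimum with 1.\<close>

definition accept_prob :: "real ^ 'd \<Rightarrow> real ^ 'd \<Rightarrow> real" where
  "accept_prob w z = exp (- (z \<bullet> w) - (norm w)\<^sup>2 / 2)"

text \<open>Reflection in the hyperplane orthogonal to \<open>w\<close>. For \<open>w = 0\<close>
  division by zero makes it the identity, so it is orthogonal in every case.\<close>

definition reflect :: "real ^ 'd \<Rightarrow> real ^ 'd \<Rightarrow> real ^ 'd" where
  "reflect w z = z - (2 * (z \<bullet> w) / (norm w)\<^sup>2) *\<^sub>R w"

text \<open>With w = (A - B)/s, the value z + w makes A + s z and B + s (z + w) coincide: accepting
  means merging the two points. The second component of the argument is the uniform threshold that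
  decides.\<close>

definition coupled_noise :: "real ^ 'd \<Rightarrow> (real ^ 'd) \<times> real \<Rightarrow> real ^ 'd" where
  "coupled_noise w zv =
     (if snd zv \<le> accept_prob w (fst zv) then fst zv + w else reflect w (fst zv))"

definition unif01 :: "real measure" where
  "unif01 = uniform_measure lborel {0..1}"

abbreviation pair_noise :: "((real ^ 'd) \<times> real) measure" where
  "pair_noise \<equiv> gaussian 1 \<Otimes>\<^sub>M unif01"

lemma sets_unif01[simp, measurable_cong]: "sets unif01 = sets borel"
  by (simp add: unif01_def)

lemma prob_space_unif01: "prob_space unif01"
  unfolding unif01_def by (intro prob_space_uniform_measure) auto

lemma coupled_noise_measurable:
  "(\<lambda>p. coupled_noise (fst p) (snd p)) \<in> borel_measurable (borel \<Otimes>\<^sub>M (borel \<Otimes>\<^sub>M borel))"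
  unfolding coupled_noise_def accept_prob_def reflect_def by measurable

lemma coupled_noise_measurable_noise: "coupled_noise w \<in> borel_measurable (borel \<Otimes>\<^sub>M borel)"
  unfolding coupled_noise_def accept_prob_def reflect_def by measurable

lemma orthogonal_reflect: "orthogonal_transformation (reflect w)"
  unfolding orthogonal_transformation_def
proof (intro conjI allI)
  show "linear (reflect w)"
    by (rule linearI) (simp_all add: reflect_def algebra_simps add_divide_distrib)
  show "reflect w u \<bullet> reflect w v = u \<bullet> v" for u v
    by (cases "w = 0")
      (simp_all add: reflect_def inner_diff_left inner_diff_right inner_commute power2_norm_eq_inner)
qed

lemma reflect_self: "reflect w w = - w"
  by (cases "w = 0") (simp_all add: reflect_def power2_norm_eq_inner scaleR_2)

lemma norm_reflect: "norm (reflect w z) = norm z"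
  using orthogonal_reflect[of w] by (simp add: orthogonal_transformation)

lemma norm_reflect_minus: "norm (reflect w z - w) = norm (z + w)"
proof -
  have "reflect w z - w = reflect w (z + w)"
    using orthogonal_reflect[of w] reflect_self[of w]
    by (simp add: orthogonal_transformation linear_add)
  then show ?thesis by (simp add: norm_reflect)
qed

lemma accept_prob_pos: "accept_prob w z > 0"
  by (simp add: accept_prob_def)

lemma gauss_dens_accept: "gauss_dens z * accept_prob w z = gauss_dens (z + w)"
  by (simp add: gauss_dens_plus accept_prob_def)

lemma nn_integral_unif01_threshold:
  assumes "a \<ge> 0"
  shows "(\<integral>\<^sup>+v. (if v \<le> a then A else B) \<partial>unif01)
    = ennreal (min 1 a) * A + ennreal (1 - min 1 a) * B"
proof -
  interpret prob_space unif01 by (rule prob_space_unif01)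
  have le: "emeasure unif01 {..a} = ennreal (min 1 a)"
  proof -
    have "{0..1} \<inter> {..a} = {0..min 1 a}" by auto
    then show ?thesis
      unfolding unif01_def using assms by (subst emeasure_uniform_measure) (auto simp: divide_ennreal_def)
  qed
  have gt: "emeasure unif01 {a<..} = ennreal (1 - min 1 a)"
  proof -
    have "{a<..} = space unif01 - {..a}" by (auto simp: sets_eq_imp_space_eq[OF sets_unif01])
    then have "emeasure unif01 {a<..} = 1 - ennreal (min 1 a)"
      by (simp add: emeasure_compl le emeasure_space_1)
    also have "\<dots> = ennreal (1 - min 1 a)"
      using assms by (simp add: ennreal_1[symmetric] ennreal_minus del: ennreal_1)
    finally show ?thesis .
  qed
  have "(\<integral>\<^sup>+v. (if v \<le> a then A else B) \<partial>unif01)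
      = (\<integral>\<^sup>+v. A * indicator {..a} v + B * indicator {a<..} v \<partial>unif01)"
    by (intro nn_integral_cong) (auto split: split_indicator)
  also have "\<dots> = A * emeasure unif01 {..a} + B * emeasure unif01 {a<..}"
    by (subst nn_integral_add) (auto simp: nn_integral_cmult_indicator)
  finally show ?thesis unfolding le gt by (simp add: mult.commute)
qed

lemma nn_integral_coupled_noise:
  fixes w :: "real ^ 'd"
  assumes H[measurable]: "H \<in> borel_measurable (borel \<Otimes>\<^sub>M borel)"
  shows "(\<integral>\<^sup>+p. H (fst p, coupled_noise w p) \<partial>pair_noise)
    = (\<integral>\<^sup>+z. ennreal (min 1 (accept_prob w z)) * H (z, z + w)
          + ennreal (1 - min 1 (accept_prob w z)) * H (z, reflect w z) \<partial>gaussian 1)"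
proof -
  interpret G: prob_space "gaussian 1 :: (real ^ 'd) measure" by (rule prob_space_gaussian)
  interpret V: prob_space unif01 by (rule prob_space_unif01)
  note [measurable] = coupled_noise_measurable_noise
  have "(\<integral>\<^sup>+p. H (fst p, coupled_noise w p) \<partial>pair_noise)
    = (\<integral>\<^sup>+z. \<integral>\<^sup>+v. H (z, coupled_noise w (z, v)) \<partial>unif01 \<partial>gaussian 1)"
    by (subst V.nn_integral_fst[symmetric]) auto
  also have "\<dots> = (\<integral>\<^sup>+z. \<integral>\<^sup>+v. (if v \<le> accept_prob w z then H (z, z + w) else H (z, reflect w z)) \<partial>unif01 \<partial>gaussian 1)"
    by (intro nn_integral_cong) (auto simp: coupled_noise_def)
  also have "\<dots> = (\<integral>\<^sup>+z. ennreal (min 1 (accept_prob w z)) * H (z, z + w)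
          + ennreal (1 - min 1 (accept_prob w z)) * H (z, reflect w z) \<partial>gaussian 1)"
    by (intro nn_integral_cong nn_integral_unif01_threshold less_imp_le accept_prob_pos)
  finally show ?thesis .
qed

lemma nn_integral_lborel_reflect:
  fixes f :: "real ^ 'd \<Rightarrow> ennreal"
  assumes [measurable]: "f \<in> borel_measurable borel"
  shows "(\<integral>\<^sup>+z. f (reflect w z) \<partial>lborel) = (\<integral>\<^sup>+z. f z \<partial>lborel)"
proof -
  have [measurable]: "reflect w \<in> borel_measurable borel"
    unfolding reflect_def by measurable
  show ?thesis
    by (subst (2) lborel_distr_orthogonal[OF orthogonal_reflect[of w], symmetric])
      (simp add: nn_integral_distr)
qed

text \<open>Write phi for \<open>gauss_dens\<close>. The accepted part, moved to z + w, has density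
  min(phi(z - w), phi(z)). The rejected part has density phi(z) - min(phi(z), phi(z + w)); since the
  reflection preserves norms and reverses \<open>w\<close>, its image has density phi(z) -
  min(phi(z), phi(z - w)). The two add up to phi.\<close>

lemma distr_coupled_noise:
  fixes w :: "real ^ 'd"
  shows "distr pair_noise borel (coupled_noise w) = gaussian 1"
proof (rule measure_eqI)
  note [measurable] = coupled_noise_measurable_noise
  have [measurable]: "reflect w \<in> borel_measurable borel" "accept_prob w \<in> borel_measurable borel"
    unfolding reflect_def accept_prob_def by measurable
  fix A assume "A \<in> sets (distr pair_noise borel (coupled_noise w))"
  then have [measurable]: "A \<in> sets borel" by simp
  let ?F = "indicator A :: _ \<Rightarrow> ennreal"
  let ?g = "\<lambda>z. ennreal (gauss_dens z - min (gauss_dens z) (gauss_dens (z - w))) * ?F z"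
  have "emeasure (distr pair_noise borel (coupled_noise w)) A
      = (\<integral>\<^sup>+p. ?F (coupled_noise w p) \<partial>pair_noise)"
    by (subst nn_integral_indicator[symmetric], simp) (subst nn_integral_distr, auto)
  also have "\<dots> = (\<integral>\<^sup>+z. ennreal (min 1 (accept_prob w z)) * ?F (z + w)
          + ennreal (1 - min 1 (accept_prob w z)) * ?F (reflect w z) \<partial>gaussian 1)"
    using nn_integral_coupled_noise[of "\<lambda>p. ?F (snd p)" w] by simp
  also have "\<dots> = (\<integral>\<^sup>+z. ennreal (gauss_dens z) * (ennreal (min 1 (accept_prob w z)) * ?F (z + w)
          + ennreal (1 - min 1 (accept_prob w z)) * ?F (reflect w z)) \<partial>lborel)"
    by (rule nn_integral_gaussian) measurable
  also have "\<dots> = (\<integral>\<^sup>+z. ennreal (min (gauss_dens (w + z - w)) (gauss_dens (w + z))) * ?F (w + z)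
       + ?g (reflect w z) \<partial>lborel)"
  proof (rule nn_integral_cong)
    fix z :: "real ^ 'd"
    have pos: "gauss_dens z > 0" by (rule gauss_dens_pos)
    have m: "gauss_dens z * min 1 (accept_prob w z) = min (gauss_dens z) (gauss_dens (z + w))"
      unfolding gauss_dens_accept[of z w, symmetric] using pos by (simp add: min_mult_distrib_left)
    have r: "gauss_dens (reflect w z) = gauss_dens z" "gauss_dens (reflect w z - w) = gauss_dens (z + w)"
      by (auto intro!: gauss_dens_norm_cong simp: norm_reflect norm_reflect_minus)
    have "gauss_dens z * (1 - min 1 (accept_prob w z)) = gauss_dens z - min (gauss_dens z) (gauss_dens (z + w))"
      unfolding m[symmetric] by (simp add: algebra_simps)
    then show "ennreal (gauss_dens z) * (ennreal (min 1 (accept_prob w z)) * ?F (z + w)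
          + ennreal (1 - min 1 (accept_prob w z)) * ?F (reflect w z))
      = ennreal (min (gauss_dens (w + z - w)) (gauss_dens (w + z))) * ?F (w + z) + ?g (reflect w z)"
      using pos less_imp_le[OF accept_prob_pos[of w z]] unfolding r
      by (simp add: distrib_left mult.assoc[symmetric] ennreal_mult[symmetric] m add.commute)
  qed
  also have "\<dots> = (\<integral>\<^sup>+z. ennreal (min (gauss_dens (z - w)) (gauss_dens z)) * ?F z \<partial>lborel)
       + (\<integral>\<^sup>+z. ?g z \<partial>lborel)"
    by (subst nn_integral_add, measurable)
      (subst nn_integral_lborel_plus[of "\<lambda>z. ennreal (min (gauss_dens (z - w)) (gauss_dens z)) * ?F z"],
       measurable, subst nn_integral_lborel_reflect[of ?g], measurable)
  also have "\<dots> = (\<integral>\<^sup>+z. ennreal (min (gauss_dens (z - w)) (gauss_dens z)) * ?F z + ?g z \<partial>lborel)"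
    by (rule nn_integral_add[symmetric]) measurable
  also have "\<dots> = (\<integral>\<^sup>+z. ennreal (gauss_dens z) * ?F z \<partial>lborel)"
  proof (rule nn_integral_cong)
    fix z :: "real ^ 'd"
    have "ennreal (min (gauss_dens (z - w)) (gauss_dens z)) + ennreal (gauss_dens z - min (gauss_dens z) (gauss_dens (z - w)))
        = ennreal (gauss_dens z)"
      using gauss_dens_pos[of z] gauss_dens_pos[of "z - w"]
      by (subst ennreal_plus[symmetric]) (auto simp: min.commute)
    then show "ennreal (min (gauss_dens (z - w)) (gauss_dens z)) * ?F z + ?g z = ennreal (gauss_dens z) * ?F z"
      by (simp add: distrib_right[symmetric])
  qed
  also have "\<dots> = emeasure (gaussian 1) A"
    by (subst nn_integral_gaussian[symmetric]) auto
  finally show "emeasure (distr pair_noise borel (coupled_noise w)) A = emeasure (gaussian 1) A" .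
qed simp

definition odd_ext :: "(real \<Rightarrow> real) \<Rightarrow> real \<Rightarrow> real" where
  "odd_ext f x = (if x \<ge> 0 then f x else - f (- x))"

lemma odd_ext_minus: "f 0 = 0 \<Longrightarrow> odd_ext f (- x) = - odd_ext f x"
  by (cases "x = 0") (auto simp: odd_ext_def)

lemma odd_ext_measurable:
  assumes [measurable]: "f \<in> borel_measurable borel"
  shows "odd_ext f \<in> borel_measurable borel"
  unfolding odd_ext_def[abs_def] by measurable

text \<open>The distance after the maximal reflection coupling is that of a Brownian motion absorbed at
  \<open>0\<close>, so by the reflection principle absorption is taken into account by extending \<open>f\<close> to an odd
  function.\<close>

lemma nn_integral_coupled_distance:
  fixes w :: "real ^ 'd"
  assumes f[measurable]: "f \<in> borel_measurable borel" and f0: "f 0 = 0" and f_nonneg: "\<And>x. x \<ge> 0 \<Longrightarrow> f x \<ge> 0"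
    and "s > 0" and "w \<noteq> 0"
    and int: "integrable (gaussian 1) (\<lambda>z. odd_ext f (s * (norm w + 2 * (z \<bullet> sgn w))))"
  shows "(\<integral>\<^sup>+p. ennreal (f (s * norm (w + fst p - coupled_noise w p))) \<partial>pair_noise)
    = ennreal (\<integral>z. odd_ext f (s * (norm w + 2 * (z \<bullet> sgn w))) \<partial>gaussian 1)"
proof -
  \<comment> \<open>\<open>s * q z\<close> is the signed distance of the two points, in the
    direction of \<open>w\<close>, after a reflection. In terms of \<open>q\<close> the likelihood
    ratio is exp(- |w| q / 2), which is below 1 exactly when q is positive: an overshooting
    reflection is always replaced by a merge.\<close>
  define q where "q z = norm w + 2 * (z \<bullet> sgn w)" for z
  note [measurable] = odd_ext_measurable[OF f]
  have [measurable]: "q \<in> borel_measurable borel" "accept_prob w \<in> borel_measurable borel"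
    unfolding q_def accept_prob_def by measurable
  have zw: "z \<bullet> w = norm w * (z \<bullet> sgn w)" for z
    using \<open>w \<noteq> 0\<close> by (simp add: sgn_div_norm)
  have acc: "accept_prob w z = exp (- (norm w * q z / 2))" for z
    unfolding accept_prob_def q_def zw by (simp add: field_simps power2_eq_square)
  have refl: "norm (w + z - reflect w z) = \<bar>q z\<bar>" for z
  proof -
    have "2 * (norm w * (z \<bullet> sgn w)) / (norm w)\<^sup>2 = 2 * (z \<bullet> sgn w) / norm w"
      using \<open>w \<noteq> 0\<close> by (simp add: power2_eq_square)
    then have "w + z - reflect w z = (1 + 2 * (z \<bullet> sgn w) / norm w) *\<^sub>R w"
      unfolding reflect_def zw by (simp add: scaleR_add_left)
    also have "norm \<dots> = \<bar>(1 + 2 * (z \<bullet> sgn w) / norm w) * norm w\<bar>"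
      by (simp add: abs_mult)
    also have "(1 + 2 * (z \<bullet> sgn w) / norm w) * norm w = q z"
      using \<open>w \<noteq> 0\<close> by (simp add: q_def field_simps)
    finally show ?thesis .
  qed
  \<comment> \<open>The expected cost, and the positive and negative parts of the integral of the
    odd extension. The goal is E = P - N, shown additively as E + N = P because these are extended
    nonnegative integrals.\<close>
  let ?E = "\<integral>\<^sup>+p. ennreal (f (s * norm (w + fst p - coupled_noise w p))) \<partial>pair_noise"
  let ?P = "\<integral>\<^sup>+z. ennreal (odd_ext f (s * q z)) \<partial>gaussian 1"
  let ?N = "\<integral>\<^sup>+z. ennreal (- odd_ext f (s * q z)) \<partial>gaussian 1"
  have E: "?E = (\<integral>\<^sup>+z. ennreal (1 - min 1 (accept_prob w z)) * ennreal (f (s * \<bar>q z\<bar>)) \<partial>gaussian 1)"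
  proof -
    have "?E = (\<integral>\<^sup>+z. ennreal (min 1 (accept_prob w z)) * ennreal (f (s * norm (w + z - (z + w))))
        + ennreal (1 - min 1 (accept_prob w z)) * ennreal (f (s * norm (w + z - reflect w z))) \<partial>gaussian 1)"
      using nn_integral_coupled_noise[of "\<lambda>p. ennreal (f (s * norm (w + fst p - snd p)))" w]
      by (simp only: fst_conv snd_conv) measurable
    then show ?thesis unfolding refl by (simp add: f0)
  qed
  have "?N = (\<integral>\<^sup>+z. ennreal (gauss_dens z) * ennreal (- odd_ext f (s * q z)) \<partial>lborel)"
    by (rule nn_integral_gaussian) measurable
  \<comment> \<open>The substitution z -> -w - z changes the sign of \<open>q\<close> and multiplies
    the density by \<open>accept_prob\<close>. It moves the negative part to where q is positive,
    with the weight of the merged mass.\<close>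
  also have "\<dots> = (\<integral>\<^sup>+z. ennreal (gauss_dens (- w - z)) * ennreal (- odd_ext f (s * q (- w - z))) \<partial>lborel)"
    by (rule nn_integral_lborel_minus[symmetric]) measurable
  also have "\<dots> = (\<integral>\<^sup>+z. ennreal (gauss_dens z) * (ennreal (accept_prob w z) * ennreal (odd_ext f (s * q z))) \<partial>lborel)"
  proof (rule nn_integral_cong)
    fix z :: "real ^ 'd"
    have "w \<bullet> sgn w = norm w"
      using \<open>w \<noteq> 0\<close> by (simp add: sgn_div_norm dot_square_norm power2_eq_square)
    then have "q (- w - z) = - q z"
      unfolding q_def by (simp add: inner_diff_left)
    moreover have "norm (- w - z) = norm (z + w)"
    proof -
      have "- w - z = - (z + w)" by simp
      then show ?thesis by (simp only: norm_minus_cancel)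
    qed
    then have "gauss_dens (- w - z) = gauss_dens z * accept_prob w z"
      unfolding gauss_dens_accept by (rule gauss_dens_norm_cong)
    ultimately show "ennreal (gauss_dens (- w - z)) * ennreal (- odd_ext f (s * q (- w - z)))
      = ennreal (gauss_dens z) * (ennreal (accept_prob w z) * ennreal (odd_ext f (s * q z)))"
      using odd_ext_minus[of f "s * q z", OF f0] less_imp_le[OF gauss_dens_pos[of z]] less_imp_le[OF accept_prob_pos[of w z]]
      by (simp add: ennreal_mult mult.assoc)
  qed
  also have "\<dots> = (\<integral>\<^sup>+z. ennreal (accept_prob w z) * ennreal (odd_ext f (s * q z)) \<partial>gaussian 1)"
    by (rule nn_integral_gaussian[symmetric]) measurable
  finally have N: "?N = \<dots>" .
  \<comment> \<open>Pointwise: for q > 0 the weights of rejection and acceptance add up to 1; for q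
    <= 0 rejection has weight 0 and the remaining terms vanish as \<open>ennreal\<close> of
    nonpositive numbers.\<close>
  have "?E + ?N = (\<integral>\<^sup>+z. ennreal (1 - min 1 (accept_prob w z)) * ennreal (f (s * \<bar>q z\<bar>))
      + ennreal (accept_prob w z) * ennreal (odd_ext f (s * q z)) \<partial>gaussian 1)"
    unfolding E N by (rule nn_integral_add[symmetric]) measurable
  also have "\<dots> = ?P"
  proof (rule nn_integral_cong)
    fix z :: "real ^ 'd"
    show "ennreal (1 - min 1 (accept_prob w z)) * ennreal (f (s * \<bar>q z\<bar>))
      + ennreal (accept_prob w z) * ennreal (odd_ext f (s * q z)) = ennreal (odd_ext f (s * q z))"
    proof (cases "q z > 0")
      case True
      then have a: "accept_prob w z \<le> 1" "accept_prob w z \<ge> 0"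
        unfolding acc by auto
      have "odd_ext f (s * q z) = f (s * q z)" "f (s * q z) \<ge> 0"
        using True \<open>s > 0\<close> f_nonneg by (auto simp: odd_ext_def)
      then show ?thesis
        using a True by (simp add: distrib_right[symmetric] ennreal_plus[symmetric] del: ennreal_plus)
    next
      case False
      then have a: "accept_prob w z \<ge> 1"
        unfolding acc by (simp add: mult_nonneg_nonpos)
      have "odd_ext f (s * q z) \<le> 0"
        using False \<open>s > 0\<close> f_nonneg[of "- (s * q z)"] f0 mult_nonneg_nonpos[of s "q z"]
        by (cases "q z = 0") (auto simp: odd_ext_def zero_le_mult_iff)
      then show ?thesis
        using a by (simp add: min_absorb1 ennreal_neg)
    qed
  qed
  finally have EN: "?E + ?N = ?P" .
  \<comment> \<open>Finiteness, from integrability of the odd extension, permits passing from E + N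
    = P to a subtraction of real numbers.\<close>
  have finP: "?P < \<infinity>" and finN: "?N < \<infinity>"
    using int unfolding real_integrable_def q_def[symmetric] by (auto simp: less_top)
  have "?E \<le> ?P" unfolding EN[symmetric] by simp
  then have finE: "?E < \<infinity>" using finP by (rule le_less_trans)
  define P where "P = enn2real ?P"
  define N where "N = enn2real ?N"
  define E where "E = enn2real ?E"
  have P: "?P = ennreal P" and N': "?N = ennreal N" and E': "?E = ennreal E"
    using finP finN finE by (simp_all add: P_def N_def E_def)
  have nonneg: "P \<ge> 0" "N \<ge> 0" "E \<ge> 0"
    by (simp_all add: P_def N_def E_def)
  have "ennreal E + ennreal N = ennreal P"
    using EN unfolding P N' E' .
  then have "P - N = E"
    using nonneg by (simp add: ennreal_plus[symmetric] del: ennreal_plus)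
  moreover have "(\<integral>z. odd_ext f (s * q z) \<partial>gaussian 1) = P - N"
    unfolding P_def N_def using int unfolding q_def[symmetric] by (rule real_lebesgue_integral_def)
  ultimately show ?thesis unfolding q_def[symmetric] E' by simp
qed

section \<open>A concave-quadratic cost\<close>

definition cost :: "real \<Rightarrow> real \<Rightarrow> real \<Rightarrow> real" where
  "cost a \<epsilon> r = 1 - exp (- a * r) + \<epsilon> * r\<^sup>2"

abbreviation expected_cost :: "real \<Rightarrow> real \<Rightarrow> ((real ^ 'd) \<times> (real ^ 'd)) measure \<Rightarrow> ennreal" where
  "expected_cost a \<epsilon> \<gamma> \<equiv> \<integral>\<^sup>+v. ennreal (cost a \<epsilon> (dist (fst v) (snd v))) \<partial>\<gamma>"

lemma cost_measurable[measurable]: "cost a \<epsilon> \<in> borel_measurable borel"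
  unfolding cost_def[abs_def] by measurable

lemma cost_0[simp]: "cost a \<epsilon> 0 = 0"
  by (simp add: cost_def)

lemma cost_nonneg: "a \<ge> 0 \<Longrightarrow> \<epsilon> \<ge> 0 \<Longrightarrow> r \<ge> 0 \<Longrightarrow> cost a \<epsilon> r \<ge> 0"
  by (simp add: cost_def)

lemma cost_mono: "a \<ge> 0 \<Longrightarrow> \<epsilon> \<ge> 0 \<Longrightarrow> 0 \<le> r \<Longrightarrow> r \<le> r' \<Longrightarrow> cost a \<epsilon> r \<le> cost a \<epsilon> r'"
  unfolding cost_def by (intro add_mono diff_mono mult_left_mono power_mono) (auto intro: mult_left_mono)

text \<open>Lets \<open>coupled_cost_le\<close> replace the distance before the noise by any upper
  bound \<open>\<rho>\<close>.\<close>

lemma odd_ext_cost_mono: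
  assumes "a \<ge> 0" "\<epsilon> \<ge> 0" "x \<le> y"
  shows "odd_ext (cost a \<epsilon>) x \<le> odd_ext (cost a \<epsilon>) y"
  using cost_mono[OF assms(1,2), of x y] cost_mono[OF assms(1,2), of "- y" "- x"]
    cost_nonneg[OF assms(1,2), of y] cost_nonneg[OF assms(1,2), of "- x"] assms(3)
  by (auto simp: odd_ext_def)

lemma abs_odd_ext_cost_le:
  assumes "a \<ge> 0" "\<epsilon> \<ge> 0"
  shows "\<bar>odd_ext (cost a \<epsilon>) x\<bar> \<le> 1 + \<epsilon> * x\<^sup>2"
  using assms exp_le_one_iff[of "- a * x"] exp_le_one_iff[of "a * x"]
  by (auto simp: odd_ext_def cost_def abs_le_iff mult_nonneg_nonpos intro: add_nonneg_nonneg
      order_trans[of _ 0] order_trans[of _ 1])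

section \<open>Symmetric second differences of the odd extension\<close>

lemma exp_plus_exp_minus_ge:
  fixes x :: real
  assumes "x \<ge> 0"
  shows "x\<^sup>2 / 2 \<le> exp x + exp (- x) - 2"
  using exp_lower_Taylor_quadratic[OF assms] exp_ge_add_one_self[of "- x"] by linarith

text \<open>For \<open>t \<le> \<rho>\<close> both points lie on the positive side and the second
  difference is the classical one; for \<open>\<rho> \<le> t\<close> the inner point has crossed 0
  and contributes minus the value at t - \<rho>.\<close>

lemma odd_ext_exp_pair:
  fixes a \<rho> t :: real
  assumes "a \<ge> 0" "\<rho> \<ge> 0" "t \<ge> 0"
  defines "g \<equiv> \<lambda>x. 1 - exp (- a * x)"
  shows "t \<le> \<rho> \<Longrightarrow> 2 * g \<rho> - (odd_ext g (\<rho> + t) + odd_ext g (\<rho> - t)) = exp (- a * \<rho>) * (exp (a * t) + exp (- (a * t)) - 2)"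
    and "\<rho> \<le> t \<Longrightarrow> 2 * g \<rho> - (odd_ext g (\<rho> + t) + odd_ext g (\<rho> - t)) = 2 * (1 - exp (- a * \<rho>)) - exp (- a * t) * (exp (a * \<rho>) - exp (- a * \<rho>))"
proof -
  assume "t \<le> \<rho>"
  then have "odd_ext g (\<rho> + t) + odd_ext g (\<rho> - t) = g (\<rho> + t) + g (\<rho> - t)"
    using assms by (simp add: odd_ext_def)
  then show "2 * g \<rho> - (odd_ext g (\<rho> + t) + odd_ext g (\<rho> - t)) = exp (- a * \<rho>) * (exp (a * t) + exp (- (a * t)) - 2)"
    unfolding g_def by (simp add: algebra_simps exp_add[symmetric])
next
  assume "\<rho> \<le> t"
  then have "odd_ext g (\<rho> + t) + odd_ext g (\<rho> - t) = g (\<rho> + t) - g (t - \<rho>)"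
    using assms by (cases "\<rho> = t") (simp_all add: odd_ext_def g_def)
  then show "2 * g \<rho> - (odd_ext g (\<rho> + t) + odd_ext g (\<rho> - t)) = 2 * (1 - exp (- a * \<rho>)) - exp (- a * t) * (exp (a * \<rho>) - exp (- a * \<rho>))"
    unfolding g_def by (simp add: algebra_simps exp_add[symmetric])
qed

lemma exp_minus_le_half:
  fixes u :: real
  assumes "0 \<le> u" "u \<le> 1"
  shows "exp (- u) \<le> 1 - u / 2"
proof -
  have "exp (- u) \<le> 1 / (1 + u)"
    using exp_ge_add_one_self[of u] assms by (simp add: exp_minus inverse_eq_divide frac_le)
  also have "\<dots> \<le> 1 - u / 2"
    using assms mult_left_le[of u u] by (simp add: field_simps)
  finally show ?thesis .
qed

text \<open>As a function of u the right-hand side is concave on [0, T] and vanishes at 0, so it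
  lies above its chord. Its value at T is (1 - exp(-T))^2, which is at least T^2/4.\<close>

lemma exp_pair_far:
  fixes u T :: real
  assumes "0 \<le> u" "u \<le> T" "T \<le> 1"
  shows "u * T / 4 \<le> 2 * (1 - exp (- u)) - exp (- T) * (exp u - exp (- u))"
proof (cases "T = 0")
  case False
  with assms have T: "T > 0" by auto
  define \<phi> where "\<phi> u = 2 * (1 - exp (- u)) - exp (- T) * (exp u - exp (- u))" for u
  have "convex_on {0..T} (\<lambda>u. - \<phi> u)"
  proof (rule f''_ge0_imp_convex)
    fix x assume x: "x \<in> {0..T}"
    show "((\<lambda>u. - \<phi> u) has_real_derivative - (2 * exp (- x) - exp (- T) * (exp x + exp (- x)))) (at x)"
      unfolding \<phi>_def by (auto intro!: derivative_eq_intros)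
    show "((\<lambda>x. - (2 * exp (- x) - exp (- T) * (exp x + exp (- x)))) has_real_derivative
        2 * exp (- x) + exp (- T) * (exp x - exp (- x))) (at x)"
      by (auto intro!: derivative_eq_intros simp: algebra_simps)
    have "exp (- x) \<le> exp x" using x by simp
    then show "0 \<le> 2 * exp (- x) + exp (- T) * (exp x - exp (- x))"
      by (intro add_nonneg_nonneg mult_nonneg_nonneg) auto
  qed auto
  then have "- \<phi> ((1 - u / T) *\<^sub>R 0 + (u / T) *\<^sub>R T) \<le> (1 - u / T) * - \<phi> 0 + (u / T) * - \<phi> T"
    using assms T by (intro convex_onD[of "{0..T}"]) (auto simp: field_simps)
  moreover have "\<phi> 0 = 0" by (simp add: \<phi>_def)
  ultimately have "(u / T) * \<phi> T \<le> \<phi> u"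
    using T by simp
  moreover have "u * T / 4 \<le> (u / T) * \<phi> T"
  proof -
    have "(T / 2)\<^sup>2 \<le> (1 - exp (- T))\<^sup>2"
      using exp_minus_le_half[of T] T assms by (intro power_mono) auto
    also have "\<dots> = \<phi> T"
      by (simp add: \<phi>_def power2_eq_square algebra_simps exp_add[symmetric])
    finally have "(u / T) * (T / 2)\<^sup>2 \<le> (u / T) * \<phi> T"
      using assms T by (intro mult_left_mono) auto
    then show ?thesis using T by (simp add: power2_eq_square)
  qed
  ultimately show ?thesis unfolding \<phi>_def by linarith
qed (use assms in simp)

text \<open>\<open>\<Delta>\<close> is the gain from concavity. It never hurts; it is of order s^2
  when the noise is smaller than the distance, and of order \<rho> s when it is larger. The last
  form is adapted to small distances: it vanishes with \<rho>, as the cost does, but still dominates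
  terms of order \<rho> s^2 when s is small.\<close>

lemma odd_ext_exp_pair_ge:
  fixes a \<rho> t s :: real
  assumes a: "a \<ge> 0" and \<rho>: "\<rho> \<ge> 0" and s: "s \<ge> 0"
  defines "g \<equiv> \<lambda>x. 1 - exp (- a * x)"
  defines "\<Delta> \<equiv> 2 * g \<rho> - (odd_ext g (\<rho> + t) + odd_ext g (\<rho> - t))"
  shows "0 \<le> \<Delta>"
    and "2 * s \<le> \<bar>t\<bar> \<Longrightarrow> 2 * s \<le> \<rho> \<Longrightarrow> 2 * (a\<^sup>2 * s\<^sup>2 * exp (- a * \<rho>)) \<le> \<Delta>"
    and "2 * s \<le> \<bar>t\<bar> \<Longrightarrow> \<rho> \<le> 2 * s \<Longrightarrow> 2 * a * s \<le> 1 \<Longrightarrow> 2 * (a\<^sup>2 * \<rho> * s / 4) \<le> \<Delta>"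
proof -
  have \<Delta>: "\<Delta> = 2 * g \<rho> - (odd_ext g (\<rho> + \<bar>t\<bar>) + odd_ext g (\<rho> - \<bar>t\<bar>))"
    unfolding \<Delta>_def by (cases "t \<ge> 0") auto
  have near: "exp (- a * \<rho>) * ((a * t)\<^sup>2 / 2) \<le> \<Delta>" if "\<bar>t\<bar> \<le> \<rho>"
    unfolding \<Delta> using odd_ext_exp_pair(1)[OF a \<rho> _ that] exp_plus_exp_minus_ge[of "a * \<bar>t\<bar>"] a
    by (simp add: g_def power_mult_distrib)
  \<comment> \<open>The exact gain increases with |t|, so |t| may be lowered to any
    \<open>t0\<close>: the choice \<open>t0 = \<bar>t\<bar>\<close> followed by bounds at
    \<open>\<rho>\<close>, or a direct choice such as \<open>t0 = 2 * s\<close>, makes it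
    explicit.\<close>
  have far: "2 * (1 - exp (- a * \<rho>)) - exp (- a * t0) * (exp (a * \<rho>) - exp (- a * \<rho>)) \<le> \<Delta>"
    if "\<rho> \<le> \<bar>t\<bar>" "t0 \<le> \<bar>t\<bar>" for t0
  proof -
    have "exp (- a * \<bar>t\<bar>) \<le> exp (- a * t0)" using that a by (simp add: mult_left_mono)
    moreover have "exp (- a * \<rho>) \<le> exp (a * \<rho>)" using a \<rho> by simp
    ultimately have "exp (- a * \<bar>t\<bar>) * (exp (a * \<rho>) - exp (- a * \<rho>)) \<le> exp (- a * t0) * (exp (a * \<rho>) - exp (- a * \<rho>))"
      by (intro mult_right_mono) auto
    then show ?thesis
      unfolding \<Delta> using odd_ext_exp_pair(2)[OF a \<rho> _ that(1)] by (simp add: g_def)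
  qed
  \<comment> \<open>Choosing \<open>t0 = \<rho>\<close> reduces the crossing case to the boundary
    value of the other formula.\<close>
  have diag: "exp (- a * \<rho>) * ((a * \<rho>)\<^sup>2 / 2) \<le> \<Delta>" if "\<rho> \<le> \<bar>t\<bar>"
  proof -
    have "exp (- a * \<rho>) * ((a * \<rho>)\<^sup>2 / 2) \<le> exp (- a * \<rho>) * (exp (a * \<rho>) + exp (- (a * \<rho>)) - 2)"
      using exp_plus_exp_minus_ge[of "a * \<rho>"] a \<rho> by simp
    also have "\<dots> = 2 * (1 - exp (- a * \<rho>)) - exp (- a * \<rho>) * (exp (a * \<rho>) - exp (- a * \<rho>))"
      by (simp add: algebra_simps exp_add[symmetric])
    also have "\<dots> \<le> \<Delta>" using far[OF that that] .
    finally show ?thesis .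
  qed
  show "0 \<le> \<Delta>"
  proof -
    have "0 \<le> exp (- a * \<rho>) * ((a * x)\<^sup>2 / 2)" for x by simp
    from this[of t] this[of \<rho>] show ?thesis
      using near diag by (cases "\<bar>t\<bar> \<le> \<rho>") linarith+
  qed
  show "2 * (a\<^sup>2 * s\<^sup>2 * exp (- a * \<rho>)) \<le> \<Delta>" if "2 * s \<le> \<bar>t\<bar>" "2 * s \<le> \<rho>"
  proof -
    have *: "2 * (a\<^sup>2 * s\<^sup>2 * exp (- a * \<rho>)) \<le> exp (- a * \<rho>) * ((a * r)\<^sup>2 / 2)" if "2 * s \<le> \<bar>r\<bar>" for r
    proof -
      have "(2 * s)\<^sup>2 \<le> \<bar>r\<bar>\<^sup>2" using that s by (intro power_mono) auto
      then have "a\<^sup>2 * (2 * s)\<^sup>2 \<le> a\<^sup>2 * r\<^sup>2" by (intro mult_left_mono) auto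
      then have "2 * (a\<^sup>2 * s\<^sup>2) \<le> (a * r)\<^sup>2 / 2" by (simp add: power_mult_distrib)
      then have "exp (- a * \<rho>) * (2 * (a\<^sup>2 * s\<^sup>2)) \<le> exp (- a * \<rho>) * ((a * r)\<^sup>2 / 2)"
        by (intro mult_left_mono) auto
      then show ?thesis by (simp add: mult_ac)
    qed
    show ?thesis
    proof (cases "\<bar>t\<bar> \<le> \<rho>")
      case True
      then show ?thesis using near[OF True] *[of t] that by linarith
    next
      case False
      then show ?thesis using diag *[of \<rho>] that \<rho> by linarith
    qed
  qed
  show "2 * (a\<^sup>2 * \<rho> * s / 4) \<le> \<Delta>" if "2 * s \<le> \<bar>t\<bar>" "\<rho> \<le> 2 * s" "2 * a * s \<le> 1"
  proof -
    have "(a * \<rho>) * (a * (2 * s)) / 4 \<le> 2 * (1 - exp (- (a * \<rho>))) - exp (- (a * (2 * s))) * (exp (a * \<rho>) - exp (- (a * \<rho>)))"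
      using that a \<rho> by (intro exp_pair_far mult_left_mono) auto
    also have "\<dots> \<le> \<Delta>" using far[of "2 * s"] that by simp
    finally show ?thesis by (simp add: power2_eq_square mult_ac)
  qed
qed

text \<open>The convex quadratic part of the cost loses under averaging. The first bound is
  independent of \<rho> beyond the leading term and is used for distances above the noise size; the
  second is linear in \<rho>, so that at small distances the loss has the same form \<rho> s as the
  gain.\<close>

lemma odd_ext_square_pair_le:
  fixes \<rho> t :: real
  assumes "\<rho> \<ge> 0"
  shows "odd_ext (\<lambda>x. x\<^sup>2) (\<rho> + t) + odd_ext (\<lambda>x. x\<^sup>2) (\<rho> - t) \<le> 2 * \<rho>\<^sup>2 + 2 * t\<^sup>2" (is "?S \<le> _")
    and "odd_ext (\<lambda>x. x\<^sup>2) (\<rho> + t) + odd_ext (\<lambda>x. x\<^sup>2) (\<rho> - t) \<le> 2 * \<rho>\<^sup>2 + 4 * \<rho> * \<bar>t\<bar>"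
proof -
  have near: "?S = 2 * \<rho>\<^sup>2 + 2 * t\<^sup>2" if "\<bar>t\<bar> \<le> \<rho>"
    using that by (simp add: odd_ext_def abs_le_iff power2_eq_square algebra_simps)
  have far: "?S = 4 * \<rho> * \<bar>t\<bar>" if "\<bar>t\<bar> > \<rho>"
    using that assms by (cases "t \<ge> 0") (auto simp: odd_ext_def power2_eq_square algebra_simps)
  have amgm: "4 * \<rho> * \<bar>t\<bar> \<le> 2 * \<rho>\<^sup>2 + 2 * t\<^sup>2"
    using zero_le_power2[of "\<rho> - \<bar>t\<bar>"] by (simp add: power2_eq_square algebra_simps)
  have near2: "2 * t\<^sup>2 \<le> 4 * \<rho> * \<bar>t\<bar>" if "\<bar>t\<bar> \<le> \<rho>"
  proof -
    have "t\<^sup>2 \<le> \<rho> * \<bar>t\<bar>"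
      using mult_right_mono[OF that, of "\<bar>t\<bar>"] by (simp add: power2_eq_square)
    then show ?thesis
      using mult_nonneg_nonneg[OF assms abs_ge_zero[of t]] by linarith
  qed
  show "?S \<le> 2 * \<rho>\<^sup>2 + 2 * t\<^sup>2"
  proof (cases "\<bar>t\<bar> \<le> \<rho>")
    case True
    then show ?thesis using near[OF True] by linarith
  next
    case False
    then show ?thesis using far amgm by linarith
  qed
  show "?S \<le> 2 * \<rho>\<^sup>2 + 4 * \<rho> * \<bar>t\<bar>"
  proof (cases "\<bar>t\<bar> \<le> \<rho>")
    case True
    then show ?thesis using near[OF True] near2[OF True] by linarith
  next
    case False
    then show ?thesis using far zero_le_power2[of \<rho>] by linarith
  qed
qed

lemma odd_ext_cost:
  "odd_ext (cost a \<epsilon>) x = odd_ext (\<lambda>x. 1 - exp (- a * x)) x + \<epsilon> * odd_ext (\<lambda>x. x\<^sup>2) x"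
  by (simp add: odd_ext_def cost_def algebra_simps)

text \<open>The two regimes in which the concavity of \<open>cost\<close> is exploited: distances above and below the
  size \<open>2 s\<close> of the noise.\<close>

lemma odd_ext_cost_pair:
  fixes a \<epsilon> \<rho> s \<zeta> :: real
  assumes a: "a \<ge> 0" and \<epsilon>: "\<epsilon> \<ge> 0" and \<rho>: "\<rho> \<ge> 0" and s: "s > 0"
  defines "S \<equiv> odd_ext (cost a \<epsilon>) (\<rho> + 2 * s * \<zeta>) + odd_ext (cost a \<epsilon>) (\<rho> - 2 * s * \<zeta>)"
  shows "S \<le> 2 * cost a \<epsilon> \<rho> + 2 * (4 * \<epsilon> * s\<^sup>2) * (1 + \<zeta>\<^sup>2)"
    and "2 * s \<le> \<rho> \<Longrightarrow>
      S \<le> 2 * cost a \<epsilon> \<rho> - 2 * (a\<^sup>2 * s\<^sup>2 * exp (- a * \<rho>)) * indicator {x. 1 \<le> \<bar>x\<bar>} \<zeta> + 2 * (4 * \<epsilon> * s\<^sup>2) * (1 + \<zeta>\<^sup>2)"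
    and "\<rho> \<le> 2 * s \<Longrightarrow> 2 * a * s \<le> 1 \<Longrightarrow>
      S \<le> 2 * cost a \<epsilon> \<rho> - 2 * (a\<^sup>2 * \<rho> * s / 4) * indicator {x. 1 \<le> \<bar>x\<bar>} \<zeta> + 2 * (4 * \<epsilon> * \<rho> * s) * (1 + \<zeta>\<^sup>2)"
proof -
  let ?g = "\<lambda>x. 1 - exp (- a * x)" and ?q = "\<lambda>x::real. x\<^sup>2" and ?t = "2 * s * \<zeta>"
  define \<Delta> where "\<Delta> = 2 * ?g \<rho> - (odd_ext ?g (\<rho> + ?t) + odd_ext ?g (\<rho> - ?t))"
  define Q where "Q = odd_ext ?q (\<rho> + ?t) + odd_ext ?q (\<rho> - ?t)"
  have S: "S = 2 * cost a \<epsilon> \<rho> - \<Delta> + \<epsilon> * (Q - 2 * \<rho>\<^sup>2)"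
    unfolding S_def \<Delta>_def Q_def odd_ext_cost cost_def by (simp add: algebra_simps)
  \<comment> \<open>Only the event |\<zeta>| >= 1 is credited with a quantitative gain; on its
    complement \<open>0 \<le> \<Delta>\<close> is enough. This is why a lower bound on a tail
    probability suffices later.\<close>
  have t: "2 * s \<le> \<bar>?t\<bar>" if "1 \<le> \<bar>\<zeta>\<bar>" using that s by (simp add: abs_mult)
  have "Q - 2 * \<rho>\<^sup>2 \<le> 2 * ?t\<^sup>2" using odd_ext_square_pair_le(1)[OF \<rho>, of ?t] by (simp add: Q_def)
  also have "\<dots> \<le> 8 * s\<^sup>2 * (1 + \<zeta>\<^sup>2)" by (simp add: power_mult_distrib algebra_simps)
  finally have Q1: "\<epsilon> * (Q - 2 * \<rho>\<^sup>2) \<le> 2 * (4 * \<epsilon> * s\<^sup>2) * (1 + \<zeta>\<^sup>2)"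
    using mult_left_mono[OF _ \<epsilon>] by (fastforce simp: mult_ac)
  have "\<bar>\<zeta>\<bar> \<le> 1 + \<zeta>\<^sup>2"
    using zero_le_power2[of "\<bar>\<zeta>\<bar> - 1 / 2"] by (simp add: power2_eq_square algebra_simps)
  then have "8 * \<rho> * s * \<bar>\<zeta>\<bar> \<le> 8 * \<rho> * s * (1 + \<zeta>\<^sup>2)"
    using \<rho> s by (intro mult_left_mono) auto
  moreover have "Q - 2 * \<rho>\<^sup>2 \<le> 8 * \<rho> * s * \<bar>\<zeta>\<bar>"
    using odd_ext_square_pair_le(2)[OF \<rho>, of ?t] s by (simp add: Q_def abs_mult)
  ultimately have "Q - 2 * \<rho>\<^sup>2 \<le> 8 * \<rho> * s * (1 + \<zeta>\<^sup>2)" by linarith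
  then have Q2: "\<epsilon> * (Q - 2 * \<rho>\<^sup>2) \<le> 2 * (4 * \<epsilon> * \<rho> * s) * (1 + \<zeta>\<^sup>2)"
    using mult_left_mono[OF _ \<epsilon>] by (fastforce simp: mult_ac)
  have s0: "s \<ge> 0" using s by simp
  note \<Delta> = odd_ext_exp_pair_ge[OF a \<rho> s0, of ?t, folded \<Delta>_def]
  show "S \<le> 2 * cost a \<epsilon> \<rho> + 2 * (4 * \<epsilon> * s\<^sup>2) * (1 + \<zeta>\<^sup>2)"
    unfolding S using Q1 \<Delta>(1) by linarith
  show "S \<le> 2 * cost a \<epsilon> \<rho> - 2 * (a\<^sup>2 * s\<^sup>2 * exp (- a * \<rho>)) * indicator {x. 1 \<le> \<bar>x\<bar>} \<zeta> + 2 * (4 * \<epsilon> * s\<^sup>2) * (1 + \<zeta>\<^sup>2)"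
    if "2 * s \<le> \<rho>"
    unfolding S using Q1 \<Delta>(1) \<Delta>(2)[OF t that] by (cases "1 \<le> \<bar>\<zeta>\<bar>") (simp_all del: minus_mult_minus)
  show "S \<le> 2 * cost a \<epsilon> \<rho> - 2 * (a\<^sup>2 * \<rho> * s / 4) * indicator {x. 1 \<le> \<bar>x\<bar>} \<zeta> + 2 * (4 * \<epsilon> * \<rho> * s) * (1 + \<zeta>\<^sup>2)"
    if "\<rho> \<le> 2 * s" "2 * a * s \<le> 1"
    unfolding S using Q2 \<Delta>(1) \<Delta>(3)[OF t that] by (cases "1 \<le> \<bar>\<zeta>\<bar>") simp_all
qed

section \<open>Averaging the pairwise estimates over the Gaussian law\<close>

lemma integrable_gaussian_inner_square:
  "integrable (gaussian 1) (\<lambda>z :: real ^ 'd. (z \<bullet> v)\<^sup>2)"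
proof (rule Bochner_Integration.integrable_bound)
  show "integrable (gaussian 1) (\<lambda>z :: real ^ 'd. (norm v)\<^sup>2 * (norm z)\<^sup>2)"
    by (intro integrable_mult_right integrable_gaussian_norm_square)
  show "AE z in (gaussian 1 :: (real ^ 'd) measure). norm ((z \<bullet> v)\<^sup>2) \<le> norm ((norm v)\<^sup>2 * (norm z)\<^sup>2)"
  proof (rule AE_I2)
    fix z :: "real ^ 'd"
    have "\<bar>z \<bullet> v\<bar>\<^sup>2 \<le> (norm z * norm v)\<^sup>2"
      by (intro power_mono Cauchy_Schwarz_ineq2) auto
    then show "norm ((z \<bullet> v)\<^sup>2) \<le> norm ((norm v)\<^sup>2 * (norm z)\<^sup>2)"
      by (simp add: power_mult_distrib mult.commute)
  qed
qed auto

lemma integral_gaussian_inner_square_le: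
  fixes e :: "real ^ 'd"
  assumes "norm e = 1"
  shows "(\<integral>z. (z \<bullet> e)\<^sup>2 \<partial>gaussian 1) \<le> (\<integral>z. (norm z)\<^sup>2 \<partial>(gaussian 1 :: (real ^ 'd) measure))"
proof (rule integral_mono[OF integrable_gaussian_inner_square integrable_gaussian_norm_square])
  fix z :: "real ^ 'd"
  have "\<bar>z \<bullet> e\<bar>\<^sup>2 \<le> (norm z * norm e)\<^sup>2"
    by (intro power_mono Cauchy_Schwarz_ineq2) auto
  then show "(z \<bullet> e)\<^sup>2 \<le> (norm z)\<^sup>2" using assms by simp
qed

lemma gaussian_distr_uminus: "distr (gaussian 1 :: (real ^ 'd) measure) borel uminus = gaussian 1"
  by (rule gaussian_distr_orthogonal) (simp add: orthogonal_transformation linear_uminus)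

lemma integrable_odd_ext_cost:
  fixes e :: "real ^ 'd"
  assumes "a \<ge> 0" "\<epsilon> \<ge> 0"
  shows "integrable (gaussian 1) (\<lambda>z. odd_ext (cost a \<epsilon>) (\<rho> + r * (z \<bullet> e)))"
proof (rule Bochner_Integration.integrable_bound)
  interpret prob_space "gaussian 1 :: (real ^ 'd) measure" by (rule prob_space_gaussian)
  show "integrable (gaussian 1) (\<lambda>z :: real ^ 'd. 1 + \<epsilon> * (2 * \<rho>\<^sup>2 + 2 * r\<^sup>2 * (z \<bullet> e)\<^sup>2))"
    by (intro Bochner_Integration.integrable_add integrable_mult_right integrable_gaussian_inner_square) auto
  note [measurable] = odd_ext_measurable[OF cost_measurable]
  show "(\<lambda>z :: real ^ 'd. odd_ext (cost a \<epsilon>) (\<rho> + r * (z \<bullet> e))) \<in> borel_measurable (gaussian 1)"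
    by measurable
  show "AE z in (gaussian 1 :: (real ^ 'd) measure). norm (odd_ext (cost a \<epsilon>) (\<rho> + r * (z \<bullet> e)))
      \<le> norm (1 + \<epsilon> * (2 * \<rho>\<^sup>2 + 2 * r\<^sup>2 * (z \<bullet> e)\<^sup>2))"
  proof (rule AE_I2)
    fix z :: "real ^ 'd"
    have "(\<rho> + r * (z \<bullet> e))\<^sup>2 \<le> 2 * \<rho>\<^sup>2 + 2 * r\<^sup>2 * (z \<bullet> e)\<^sup>2"
      using zero_le_power2[of "\<rho> - r * (z \<bullet> e)"] by (simp add: power2_eq_square algebra_simps)
    then have "1 + \<epsilon> * (\<rho> + r * (z \<bullet> e))\<^sup>2 \<le> 1 + \<epsilon> * (2 * \<rho>\<^sup>2 + 2 * r\<^sup>2 * (z \<bullet> e)\<^sup>2)"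
      using assms by (intro add_left_mono mult_left_mono) auto
    then show "norm (odd_ext (cost a \<epsilon>) (\<rho> + r * (z \<bullet> e))) \<le> norm (1 + \<epsilon> * (2 * \<rho>\<^sup>2 + 2 * r\<^sup>2 * (z \<bullet> e)\<^sup>2))"
      using abs_odd_ext_cost_le[OF assms, of "\<rho> + r * (z \<bullet> e)"] by (simp only: real_norm_def)
  qed
qed

text \<open>The variable \<open>\<rho>\<close> is an upper bound for the distance before the noise is added; \<open>\<kappa>\<close> is the gain due
  to concavity and \<open>\<theta>\<close> the loss due to the quadratic growth of \<open>cost\<close>.\<close>

lemma coupled_cost_le:
  fixes w :: "real ^ 'd"
  assumes a: "a \<ge> 0" and \<epsilon>: "\<epsilon> \<ge> 0" and s: "s > 0" and \<rho>: "s * norm w \<le> \<rho>"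
    and \<kappa>: "\<kappa> \<ge> 0" and \<theta>: "\<theta> \<ge> 0"
    and pair: "\<And>\<zeta>. odd_ext (cost a \<epsilon>) (\<rho> + 2 * s * \<zeta>) + odd_ext (cost a \<epsilon>) (\<rho> - 2 * s * \<zeta>)
      \<le> 2 * cost a \<epsilon> \<rho> - 2 * \<kappa> * indicator {x. 1 \<le> \<bar>x\<bar>} \<zeta> + 2 * \<theta> * (1 + \<zeta>\<^sup>2)"
    and p: "\<And>e :: real ^ 'd. norm e = 1 \<Longrightarrow> p \<le> measure (gaussian 1) {z. \<bar>z \<bullet> e\<bar> \<ge> 1}"
    and m: "1 + (\<integral>z. (norm z)\<^sup>2 \<partial>(gaussian 1 :: (real ^ 'd) measure)) \<le> m"
  shows "(\<integral>\<^sup>+u. ennreal (cost a \<epsilon> (s * norm (w + fst u - coupled_noise w u))) \<partial>pair_noise)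
    \<le> ennreal (cost a \<epsilon> \<rho> - \<kappa> * p + \<theta> * m)"
proof (cases "w = 0")
  \<comment> \<open>With no separation the acceptance probability is 1, the points merge, and the
    expected cost is 0.\<close>
  case True
  have *: "accept_prob 0 z = 1" for z :: "real ^ 'd"
    by (simp add: accept_prob_def)
  show ?thesis
    using nn_integral_coupled_noise[of "\<lambda>u. ennreal (cost a \<epsilon> (s * norm (w + fst u - snd u)))" w] *
    by (simp add: True)
next
  case False
  interpret prob_space "gaussian 1 :: (real ^ 'd) measure" by (rule prob_space_gaussian)
  define e where "e = sgn w"
  have e: "norm e = 1" using False by (simp add: e_def norm_sgn)
  let ?O = "odd_ext (cost a \<epsilon>)"
  have int: "integrable (gaussian 1) (\<lambda>z. ?O (\<rho> + 2 * s * (z \<bullet> e)))"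
    "integrable (gaussian 1) (\<lambda>z. ?O (\<rho> - 2 * s * (z \<bullet> e)))"
    "integrable (gaussian 1) (\<lambda>z. ?O (s * (norm w + 2 * (z \<bullet> e))))"
    using integrable_odd_ext_cost[OF a \<epsilon>, of \<rho> "2 * s" e] integrable_odd_ext_cost[OF a \<epsilon>, of \<rho> "- 2 * s" e]
      integrable_odd_ext_cost[OF a \<epsilon>, of "s * norm w" "2 * s" e]
    by (simp_all add: algebra_simps)
  have tail[measurable]: "{z. 1 \<le> \<bar>z \<bullet> e\<bar>} \<in> sets borel" by measurable
  have ind: "indicator {x. 1 \<le> \<bar>x\<bar>} (z \<bullet> e) = (indicator {z. 1 \<le> \<bar>z \<bullet> e\<bar>} z :: real)" for z
    by (simp split: split_indicator)
  \<comment> \<open>Invariance under z -> -z allows the integrand to be replaced by its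
    symmetrisation, which is what the hypothesis \<open>pair\<close> controls.\<close>
  have sym: "(\<integral>z. ?O (\<rho> + 2 * s * (z \<bullet> e)) \<partial>gaussian 1) = (\<integral>z. ?O (\<rho> - 2 * s * (z \<bullet> e)) \<partial>gaussian 1)"
  proof -
    note [measurable] = odd_ext_measurable[OF cost_measurable]
    show ?thesis
      by (subst gaussian_distr_uminus[symmetric]) (simp add: integral_distr)
  qed
  have "(\<integral>z. ?O (s * (norm w + 2 * (z \<bullet> e))) \<partial>gaussian 1) \<le> (\<integral>z. ?O (\<rho> + 2 * s * (z \<bullet> e)) \<partial>gaussian 1)"
    using \<rho> by (intro integral_mono int odd_ext_cost_mono a \<epsilon>) (simp add: algebra_simps)
  also have "\<dots> = (\<integral>z. (?O (\<rho> + 2 * s * (z \<bullet> e)) + ?O (\<rho> - 2 * s * (z \<bullet> e))) / 2 \<partial>gaussian 1)"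
    using int sym by simp
  also have "\<dots> \<le> (\<integral>z. cost a \<epsilon> \<rho> - \<kappa> * indicator {z. 1 \<le> \<bar>z \<bullet> e\<bar>} z + \<theta> * (1 + (z \<bullet> e)\<^sup>2) \<partial>gaussian 1)"
  proof (rule integral_mono)
    show "integrable (gaussian 1) (\<lambda>z. (?O (\<rho> + 2 * s * (z \<bullet> e)) + ?O (\<rho> - 2 * s * (z \<bullet> e))) / 2)"
      using int by auto
    show "integrable (gaussian 1) (\<lambda>z. cost a \<epsilon> \<rho> - \<kappa> * indicator {z. 1 \<le> \<bar>z \<bullet> e\<bar>} z + \<theta> * (1 + (z \<bullet> e)\<^sup>2))"
      by (intro Bochner_Integration.integrable_add Bochner_Integration.integrable_diff integrable_mult_right
          integrable_gaussian_inner_square integrable_real_indicator) (auto simp: less_top[symmetric])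
    show "(?O (\<rho> + 2 * s * (z \<bullet> e)) + ?O (\<rho> - 2 * s * (z \<bullet> e))) / 2
      \<le> cost a \<epsilon> \<rho> - \<kappa> * indicator {z. 1 \<le> \<bar>z \<bullet> e\<bar>} z + \<theta> * (1 + (z \<bullet> e)\<^sup>2)" for z
    proof -
      have "?O (\<rho> + 2 * s * (z \<bullet> e)) + ?O (\<rho> - 2 * s * (z \<bullet> e))
        \<le> 2 * (cost a \<epsilon> \<rho> - \<kappa> * indicator {z. 1 \<le> \<bar>z \<bullet> e\<bar>} z + \<theta> * (1 + (z \<bullet> e)\<^sup>2))"
        using pair[of "z \<bullet> e"] unfolding ind by (simp add: algebra_simps)
      then show ?thesis by simp
    qed
  qed
  also have "\<dots> = cost a \<epsilon> \<rho> - \<kappa> * prob {z. 1 \<le> \<bar>z \<bullet> e\<bar>} + \<theta> * (1 + (\<integral>z. (z \<bullet> e)\<^sup>2 \<partial>gaussian 1))"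
    by (simp add: integrable_gaussian_inner_square prob_space[simplified] integrable_real_indicator less_top[symmetric])
  also have "\<dots> \<le> cost a \<epsilon> \<rho> - \<kappa> * p + \<theta> * m"
    using p[OF e] m integral_gaussian_inner_square_le[OF e] \<kappa> \<theta>
    by (intro add_mono diff_mono mult_left_mono) auto
  finally show ?thesis
    unfolding e_def
    by (subst nn_integral_coupled_distance)
      (use a \<epsilon> s False int(3) cost_nonneg in \<open>auto simp: e_def intro!: ennreal_leI\<close>)
qed

section \<open>Contraction of one Euler step\<close>

definition euler_step :: "real \<Rightarrow> (real ^ 'd \<Rightarrow> real ^ 'd) \<Rightarrow> real ^ 'd \<Rightarrow> real ^ 'd" where
  "euler_step h b x = x + h *\<^sub>R b x"

abbreviation coupled_euler_cost ::
  "real \<Rightarrow> real \<Rightarrow> real \<Rightarrow> (real ^ 'd \<Rightarrow> real ^ 'd) \<Rightarrow> real ^ 'd \<Rightarrow> real ^ 'd \<Rightarrow> ennreal" where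
  "coupled_euler_cost a \<epsilon> h b x y \<equiv>
    (let w = (1 / sqrt h) *\<^sub>R (euler_step h b x - euler_step h b y) in
      \<integral>\<^sup>+u. ennreal (cost a \<epsilon> (sqrt h * norm (w + fst u - coupled_noise w u))) \<partial>pair_noise)"

lemma exp_shift_ge:
  fixes u v :: real
  shows "exp (- u) * (1 - v) \<le> exp (- (u + v))"
proof -
  have "exp (- u) * (1 - v) \<le> exp (- u) * exp (- v)"
    using exp_ge_add_one_self[of "- v"] by (intro mult_left_mono) auto
  then show ?thesis by (simp add: exp_add[symmetric])
qed

lemma cost_le_square: "cost a \<epsilon> r \<le> 1 + \<epsilon> * r\<^sup>2"
  by (simp add: cost_def)

lemma cost_le_linear:
  assumes "\<epsilon> \<ge> 0" "0 \<le> r" "r \<le> R"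
  shows "cost a \<epsilon> r \<le> (a + \<epsilon> * R) * r"
proof -
  have "r * r \<le> R * r" using assms by (intro mult_right_mono) auto
  then have "\<epsilon> * (r * r) \<le> \<epsilon> * (R * r)" using assms by (intro mult_left_mono) auto
  then show ?thesis
    using exp_ge_add_one_self[of "- a * r"] by (simp add: cost_def power2_eq_square algebra_simps)
qed

text \<open>Dissipativity lowers the quadratic part of the cost by \<epsilon> h K r^2. Half of this
  pays for the noise, since 8 m <= K r^2. The other half pays for c h times the cost, which for r >=
  R is at most (1/R^2 + \<epsilon>) r^2.\<close>

lemma cost_contraction_large:
  fixes a \<epsilon> c h m r \<rho> K R :: real
  assumes "a \<ge> 0" "\<epsilon> > 0" "h > 0" "c > 0" "R > 0" "R \<le> r" "0 \<le> \<rho>" "\<rho> \<le> r"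
    and \<rho>: "\<rho>\<^sup>2 \<le> (1 - K * h) * r\<^sup>2" and m: "8 * m \<le> K * r\<^sup>2"
    and c: "c * (1 / R\<^sup>2 + \<epsilon>) \<le> \<epsilon> * K / 2"
  shows "cost a \<epsilon> \<rho> + 4 * \<epsilon> * h * m \<le> (1 - c * h) * cost a \<epsilon> r"
proof -
  have "exp (- a * r) \<le> exp (- a * \<rho>)" using assms by (simp add: mult_left_mono)
  moreover have "\<epsilon> * \<rho>\<^sup>2 \<le> \<epsilon> * ((1 - K * h) * r\<^sup>2)" using \<rho> assms by (intro mult_left_mono) auto
  ultimately have 1: "cost a \<epsilon> \<rho> \<le> cost a \<epsilon> r - \<epsilon> * h * (K * r\<^sup>2)"
    unfolding cost_def by (simp add: algebra_simps del: exp_le_cancel_iff)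
  have 2: "\<epsilon> * h * (8 * m) \<le> \<epsilon> * h * (K * r\<^sup>2)" using m assms by (intro mult_left_mono) auto
  have "R\<^sup>2 \<le> r\<^sup>2" using assms by (intro power_mono) auto
  then have "1 \<le> (1 / R\<^sup>2) * r\<^sup>2" using assms by (simp add: field_simps)
  then have "cost a \<epsilon> r \<le> (1 / R\<^sup>2 + \<epsilon>) * r\<^sup>2"
    using cost_le_square[of a \<epsilon> r] by (simp add: distrib_right)
  then have "c * cost a \<epsilon> r \<le> c * ((1 / R\<^sup>2 + \<epsilon>) * r\<^sup>2)"
    using assms by (intro mult_left_mono) auto
  also have "\<dots> \<le> \<epsilon> * K / 2 * r\<^sup>2"
    using mult_right_mono[OF c, of "r\<^sup>2"] by (simp add: mult.assoc)
  finally have "h * (c * cost a \<epsilon> r) \<le> h * (\<epsilon> * K / 2 * r\<^sup>2)"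
    using assms by (intro mult_left_mono) auto
  then show ?thesis using 1 2 by (simp add: algebra_simps)
qed

text \<open>Put X = exp(- a r). The gain from concavity is at least p a^2 h X / 2. A share of 1/4
  pays for the stretching of the exponential part by the drift, 1/8 for the quadratic part under
  drift and noise, and 1/8 for c h times the cost.\<close>

lemma cost_contraction_medium:
  fixes a \<epsilon> c h m p r L R :: real
  assumes pos: "a > 0" "\<epsilon> > 0" "h > 0" "c > 0" "p > 0" "L > 0" and r: "0 \<le> r" "r \<le> R" and m: "m \<ge> 0"
    and Lh: "L * h \<le> 1" and aLhR: "a * L * h * R \<le> 1 / 2" and a: "4 * L * R \<le> p * a"
    and \<epsilon>: "\<epsilon> * (3 * L * R\<^sup>2 + 4 * m) \<le> p * a\<^sup>2 * exp (- a * R) / 8"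
    and c: "c * (1 + \<epsilon> * R\<^sup>2) \<le> p * a\<^sup>2 * exp (- a * R) / 8"
  defines "\<rho> \<equiv> (1 + L * h) * r"
  shows "cost a \<epsilon> \<rho> - a\<^sup>2 * h * exp (- a * \<rho>) * p + 4 * \<epsilon> * h * m \<le> (1 - c * h) * cost a \<epsilon> r"
proof -
  define X where "X = exp (- (a * r))"
  have X: "exp (- a * R) \<le> X" "X > 0" unfolding X_def using pos r by auto
  have v: "a * L * h * r \<le> 1 / 2"
  proof -
    have "0 \<le> a * L * h" using pos by simp
    from mult_left_mono[OF r(2) this] show ?thesis using aLhR by linarith
  qed
  have e: "X * (1 - a * L * h * r) \<le> exp (- a * \<rho>)"
    using exp_shift_ge[of "a * r" "a * L * h * r"] by (simp add: X_def \<rho>_def algebra_simps)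
  \<comment> \<open>As \<open>a * L * h * r\<close> is at most 1/2, the drift can shrink the
    exponential factor in the gain by at most one half.\<close>
  have "X * (1 / 2) \<le> X * (1 - a * L * h * r)"
    using v X by (intro mult_left_mono) auto
  with e have e2: "X / 2 \<le> exp (- a * \<rho>)" by linarith
  have gain: "a\<^sup>2 * h * p * (X / 2) \<le> a\<^sup>2 * h * p * exp (- a * \<rho>)"
    using e2 pos by (intro mult_left_mono) auto
  have "L * h * (L * h) \<le> 1 * (L * h)" using Lh pos by (intro mult_right_mono) auto
  then have "(1 + L * h)\<^sup>2 * r\<^sup>2 \<le> (1 + 3 * (L * h)) * r\<^sup>2"
    by (intro mult_right_mono) (auto simp: power2_eq_square algebra_simps)
  then have "\<epsilon> * \<rho>\<^sup>2 \<le> \<epsilon> * ((1 + 3 * (L * h)) * r\<^sup>2)"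
    unfolding \<rho>_def power_mult_distrib using pos by (intro mult_left_mono) auto
  with e have 1: "cost a \<epsilon> \<rho> \<le> cost a \<epsilon> r + h * (a * L * r * X) + h * (\<epsilon> * (3 * L * r\<^sup>2))"
    by (simp add: cost_def X_def algebra_simps)
  have "L * r \<le> L * R" using r pos by (intro mult_left_mono) auto
  then have "4 * L * r \<le> p * a" using a by linarith
  then have "a * X * (4 * L * r) \<le> a * X * (p * a)" using pos X by (intro mult_left_mono) auto
  then have 2: "h * (a * L * r * X) \<le> h * (p * a\<^sup>2 * X / 4)"
    using pos by (intro mult_left_mono) (auto simp: power2_eq_square algebra_simps)
  have pX: "p * a\<^sup>2 * exp (- a * R) \<le> p * a\<^sup>2 * X" using X pos by (intro mult_left_mono) auto
  have r2: "r\<^sup>2 \<le> R\<^sup>2" using r by (intro power_mono) auto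
  then have "\<epsilon> * (3 * L * r\<^sup>2 + 4 * m) \<le> \<epsilon> * (3 * L * R\<^sup>2 + 4 * m)"
    using pos by (intro mult_left_mono add_right_mono) auto
  then have 3: "h * (\<epsilon> * (3 * L * r\<^sup>2 + 4 * m)) \<le> h * (p * a\<^sup>2 * X / 8)"
    using \<epsilon> pX pos by (intro mult_left_mono) linarith+
  have "\<epsilon> * r\<^sup>2 \<le> \<epsilon> * R\<^sup>2" using r2 pos by (intro mult_left_mono) auto
  then have "c * cost a \<epsilon> r \<le> c * (1 + \<epsilon> * R\<^sup>2)"
    using cost_le_square[of a \<epsilon> r] pos by (intro mult_left_mono) linarith+
  then have 4: "h * (c * cost a \<epsilon> r) \<le> h * (p * a\<^sup>2 * X / 8)"
    using c pX pos by (intro mult_left_mono) linarith+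
  show ?thesis using 1 2 3 4 gain by (simp add: algebra_simps)
qed

text \<open>The gain p a^2 \<rho> s / 4 is split in two. One half absorbs the quadratic losses, also
  of order \<rho> s, by smallness of \<epsilon>. The other absorbs the drift and c s^2 times the
  cost: as the cost is at most linear in r, these are of order s^2 r, and their extra factor s makes
  them small.\<close>

lemma cost_contraction_small:
  fixes a \<epsilon> c s m p r L R :: real
  assumes pos: "a > 0" "\<epsilon> > 0" "s > 0" "c > 0" "p > 0" "L > 0" and r: "0 \<le> r" "r \<le> R" and m: "m \<ge> 0"
    and \<epsilon>: "\<epsilon> * (2 + 4 * m) \<le> p * a\<^sup>2 / 8"
    and s: "s * (a * L + c * (a + \<epsilon> * R)) \<le> p * a\<^sup>2 / 8"
  defines "\<rho> \<equiv> (1 + L * s\<^sup>2) * r"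
  assumes \<rho>: "\<rho> \<le> 2 * s"
  shows "cost a \<epsilon> \<rho> - a\<^sup>2 * \<rho> * s / 4 * p + 4 * \<epsilon> * \<rho> * s * m \<le> (1 - c * s\<^sup>2) * cost a \<epsilon> r"
proof -
  have r\<rho>: "r \<le> \<rho>" unfolding \<rho>_def using r pos by (simp add: algebra_simps)
  have "exp (- (a * r)) * (1 - a * L * s\<^sup>2 * r) \<le> exp (- a * \<rho>)"
    using exp_shift_ge[of "a * r" "a * L * s\<^sup>2 * r"] by (simp add: \<rho>_def algebra_simps)
  moreover have "exp (- (a * r)) * (a * L * s\<^sup>2 * r) \<le> 1 * (a * L * s\<^sup>2 * r)"
    using pos r by (intro mult_right_mono) auto
  ultimately have "1 - exp (- a * \<rho>) \<le> 1 - exp (- a * r) + a * L * s\<^sup>2 * r"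
    by (simp add: algebra_simps)
  moreover have "\<rho> * \<rho> \<le> 2 * s * \<rho>" using \<rho> r r\<rho> by (intro mult_right_mono) auto
  then have "\<epsilon> * \<rho>\<^sup>2 \<le> \<epsilon> * (2 * s * \<rho>)" unfolding power2_eq_square using pos by (intro mult_left_mono) auto
  moreover have "0 \<le> \<epsilon> * r\<^sup>2" using pos by simp
  ultimately have 1: "cost a \<epsilon> \<rho> \<le> cost a \<epsilon> r + a * L * s\<^sup>2 * r + \<epsilon> * (2 * s * \<rho>)"
    unfolding cost_def by linarith
  have 2: "(\<rho> * s) * (\<epsilon> * (2 + 4 * m)) \<le> (\<rho> * s) * (p * a\<^sup>2 / 8)"
    using \<epsilon> r r\<rho> pos by (intro mult_left_mono) auto
  have 3: "(p * a\<^sup>2 / 8 * s) * r \<le> (p * a\<^sup>2 / 8 * s) * \<rho>"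
    using r\<rho> pos by (intro mult_left_mono) auto
  have 4: "(s * r) * (s * (a * L + c * (a + \<epsilon> * R))) \<le> (s * r) * (p * a\<^sup>2 / 8)"
    using s pos r by (intro mult_left_mono) auto
  have "(s\<^sup>2 * c) * cost a \<epsilon> r \<le> (s\<^sup>2 * c) * ((a + \<epsilon> * R) * r)"
    using cost_le_linear[OF _ r, of \<epsilon> a] pos by (intro mult_left_mono) auto
  then show ?thesis using 1 2 3 4 by (simp add: algebra_simps power2_eq_square)
qed

lemma norm_euler_step_diff_le:
  assumes "\<And>x y. norm (b x - b y) \<le> L * norm (x - y)" "h \<ge> 0"
  shows "norm (euler_step h b x - euler_step h b y) \<le> (1 + L * h) * norm (x - y)"
proof -
  have "euler_step h b x - euler_step h b y = (x - y) + h *\<^sub>R (b x - b y)"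
    by (simp add: euler_step_def algebra_simps)
  also have "norm \<dots> \<le> norm (x - y) + norm (h *\<^sub>R (b x - b y))"
    by (rule norm_triangle_ineq)
  also have "\<dots> \<le> norm (x - y) + h * (L * norm (x - y))"
    using assms(1)[of x y] assms(2) by (simp add: mult_left_mono)
  finally show ?thesis by (simp add: algebra_simps)
qed

text \<open>The inner product contributes -2 K h; the squared increment gives back at most L^2 h^2
  <= K h.\<close>

lemma norm_euler_step_diff_dissipative:
  assumes lip: "\<And>x y. norm (b x - b y) \<le> L * norm (x - y)"
    and diss: "(x - y) \<bullet> (b x - b y) \<le> - K * (norm (x - y))\<^sup>2"
    and h: "h > 0" "L\<^sup>2 * h \<le> K"
  shows "(norm (euler_step h b x - euler_step h b y))\<^sup>2 \<le> (1 - K * h) * (norm (x - y))\<^sup>2"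
proof -
  have "euler_step h b x - euler_step h b y = (x - y) + h *\<^sub>R (b x - b y)"
    by (simp add: euler_step_def algebra_simps)
  then have "(norm (euler_step h b x - euler_step h b y))\<^sup>2
      = (norm (x - y))\<^sup>2 + 2 * h * ((x - y) \<bullet> (b x - b y)) + h\<^sup>2 * (norm (b x - b y))\<^sup>2"
    by (simp only: power2_norm_eq_inner) (simp add: inner_add_left inner_add_right inner_commute power2_eq_square)
  also have "\<dots> \<le> (norm (x - y))\<^sup>2 + 2 * h * (- K * (norm (x - y))\<^sup>2) + h\<^sup>2 * (L * norm (x - y))\<^sup>2"
    using diss h power_mono[OF lip norm_ge_zero, of x y 2]
    by (intro add_mono mult_left_mono) auto
  also have "\<dots> = (1 - 2 * K * h + h * (L\<^sup>2 * h)) * (norm (x - y))\<^sup>2"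
    by (simp add: algebra_simps power2_eq_square)
  also have "\<dots> \<le> (1 - K * h) * (norm (x - y))\<^sup>2"
    using mult_left_mono[OF h(2), of h] h by (intro mult_right_mono) (auto simp: algebra_simps)
  finally show ?thesis .
qed

text \<open>The constants are chosen in the order R', a, \<epsilon>, c, h0, each depending on
  earlier ones only. Three regimes are then patched together: r > R' (dissipation), and for r <= R'
  the distance \<rho> after the drift being above or below the noise size 2 sqrt h
  (concavity).\<close>

lemma euler_contraction:
  fixes b :: "real ^ 'd \<Rightarrow> real ^ 'd"
  assumes pos: "L > 0" "K > 0" "R > 0"
    and lip: "\<And>x y. norm (b x - b y) \<le> L * norm (x - y)"
    and diss: "\<And>x y. norm (x - y) > R \<Longrightarrow> (x - y) \<bullet> (b x - b y) \<le> - K * (norm (x - y))\<^sup>2"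
  obtains a \<epsilon> c h0 :: real where "a > 0" "\<epsilon> > 0" "c > 0" "h0 > 0" "c * h0 \<le> 1"
    "\<And>h x y. 0 < h \<Longrightarrow> h < h0 \<Longrightarrow>
      coupled_euler_cost a \<epsilon> h b x y \<le> ennreal ((1 - c * h) * cost a \<epsilon> (norm (x - y)))"
proof -
  obtain p where p: "p > 0" "\<And>e :: real ^ 'd. norm e = 1 \<Longrightarrow> p \<le> measure (gaussian 1) {z. \<bar>z \<bullet> e\<bar> \<ge> 1}"
    using gaussian_projection_tail by blast
  define m where "m = 1 + (\<integral>z. (norm z)\<^sup>2 \<partial>(gaussian 1 :: (real ^ 'd) measure))"
  have m: "m \<ge> 1" by (simp add: m_def)
  \<comment> \<open>Beyond \<open>R'\<close> the dissipation must also outweigh the quadratic cost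
    of the noise, so \<open>R\<close> is enlarged until 8 m <= K r^2.\<close>
  define R' where "R' = max R (sqrt (8 * m / K))"
  have R': "R' > 0" "R \<le> R'" using pos by (auto simp: R'_def)
  have mR: "8 * m \<le> K * r\<^sup>2" if "R' \<le> r" for r
  proof -
    have "(sqrt (8 * m / K))\<^sup>2 \<le> r\<^sup>2"
      using that m pos by (intro power_mono) (auto simp: R'_def)
    then show ?thesis using m pos by (simp add: field_simps)
  qed
  \<comment> \<open>The curvature gain is of order p a^2 while the drift stretches the exponential
    part at rate at most a L R'; this value gives the equality 4 L R' = p a.\<close>
  define a where "a = 4 * L * R' / p"
  have a: "a > 0" "4 * L * R' \<le> p * a" using pos R' p by (auto simp: a_def)
  define q where "q = p * a\<^sup>2 * exp (- a * R') / 8"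
  have q: "q > 0" using p a by (simp add: q_def)
  \<comment> \<open>The two entries keep the quadratic losses below an eighth of the gain, at medium
    and at small distances respectively.\<close>
  define \<epsilon> where "\<epsilon> = min (q / (3 * L * R'\<^sup>2 + 4 * m)) (p * a\<^sup>2 / 8 / (2 + 4 * m))"
  have d1: "3 * L * R'\<^sup>2 + 4 * m > 0" "2 + 4 * m > 0"
  proof -
    have "0 \<le> 3 * L * R'\<^sup>2" using pos by simp
    then show "3 * L * R'\<^sup>2 + 4 * m > 0" "2 + 4 * m > 0" using m by linarith+
  qed
  have \<epsilon>: "\<epsilon> > 0" "\<epsilon> * (3 * L * R'\<^sup>2 + 4 * m) \<le> q" "\<epsilon> * (2 + 4 * m) \<le> p * a\<^sup>2 / 8"
  proof -
    show "\<epsilon> > 0" using q d1 p a by (simp add: \<epsilon>_def)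
    have "\<epsilon> \<le> q / (3 * L * R'\<^sup>2 + 4 * m)" "\<epsilon> \<le> p * a\<^sup>2 / 8 / (2 + 4 * m)"
      unfolding \<epsilon>_def by (rule min.cobounded1, rule min.cobounded2)
    then show "\<epsilon> * (3 * L * R'\<^sup>2 + 4 * m) \<le> q" "\<epsilon> * (2 + 4 * m) \<le> p * a\<^sup>2 / 8"
      by (simp_all only: pos_le_divide_eq[OF d1(1)] pos_le_divide_eq[OF d1(2)])
  qed
  \<comment> \<open>The rates available from dissipation for r > R' and from concavity at medium
    distances; small distances are handled by the choice of \<open>h0\<close>.\<close>
  define c where "c = min (\<epsilon> * K / 2 / (1 / R'\<^sup>2 + \<epsilon>)) (q / (1 + \<epsilon> * R'\<^sup>2))"
  have d2: "1 / R'\<^sup>2 + \<epsilon> > 0" "1 + \<epsilon> * R'\<^sup>2 > 0" using \<epsilon> R' by (auto intro!: add_pos_pos)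
  have c: "c > 0" "c * (1 / R'\<^sup>2 + \<epsilon>) \<le> \<epsilon> * K / 2" "c * (1 + \<epsilon> * R'\<^sup>2) \<le> q"
  proof -
    show "c > 0" using q d2 \<epsilon>(1) pos by (simp add: c_def)
    have "c \<le> \<epsilon> * K / 2 / (1 / R'\<^sup>2 + \<epsilon>)" "c \<le> q / (1 + \<epsilon> * R'\<^sup>2)"
      unfolding c_def by (rule min.cobounded1, rule min.cobounded2)
    then show "c * (1 / R'\<^sup>2 + \<epsilon>) \<le> \<epsilon> * K / 2" "c * (1 + \<epsilon> * R'\<^sup>2) \<le> q"
      by (simp_all only: pos_le_divide_eq[OF d2(1)] pos_le_divide_eq[OF d2(2)])
  qed
  define A where "A = a * L + c * (a + \<epsilon> * R')"
  have A: "A > 0" unfolding A_def using a c \<epsilon> pos R' by (intro add_pos_pos mult_pos_pos) auto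
  define D where "D = p * a\<^sup>2 / 8 / A"
  have D: "D > 0" unfolding D_def using p a A by auto
  \<comment> \<open>In order: L h <= 1; control of the exponential under the drift; 2 a sqrt h <= 1
    for the second difference at small distances; sqrt h <= D for the losses there; L^2 h <= K for
    dissipation; c h <= 1.\<close>
  define h0 where "h0 = Min {1 / L, 1 / (2 * a * L * R'), 1 / (4 * a\<^sup>2), D\<^sup>2, K / L\<^sup>2, 1 / c}"
  have h0: "h0 > 0" using a pos R' D c by (simp add: h0_def)
  have "h0 \<le> 1 / c" by (simp add: h0_def)
  then have ch0: "c * h0 \<le> 1" using c by (simp add: field_simps)
  show ?thesis
  proof (rule that[OF a(1) \<epsilon>(1) c(1) h0 ch0])
    fix h and x y :: "real ^ 'd" assume h: "0 < h" "h < h0"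
    define s where "s = sqrt h"
    have s: "s > 0" "h = s\<^sup>2" using h by (auto simp: s_def)
    have hb: "L * h \<le> 1" "a * L * h * R' \<le> 1 / 2" "4 * a\<^sup>2 * h \<le> 1" "h \<le> D\<^sup>2" "L\<^sup>2 * h \<le> K"
    proof -
      have hl: "h < 1 / L" "h < 1 / (2 * a * L * R')" "h < 1 / (4 * a\<^sup>2)" "h < D\<^sup>2" "h < K / L\<^sup>2"
        using h(2) by (simp_all add: h0_def)
      have d: "2 * a * L * R' > 0" "4 * a\<^sup>2 > 0" "L\<^sup>2 > 0" using a pos R' by auto
      show "L * h \<le> 1" using hl(1) unfolding pos_less_divide_eq[OF pos(1)] by (simp add: mult.commute)
      show "a * L * h * R' \<le> 1 / 2" using hl(2) unfolding pos_less_divide_eq[OF d(1)] by (simp add: mult_ac)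
      show "4 * a\<^sup>2 * h \<le> 1" using hl(3) unfolding pos_less_divide_eq[OF d(2)] by (simp add: mult_ac)
      show "h \<le> D\<^sup>2" using hl(4) by simp
      show "L\<^sup>2 * h \<le> K" using hl(5) unfolding pos_less_divide_eq[OF d(3)] by (simp add: mult.commute)
    qed
    have "(2 * a * s)\<^sup>2 \<le> 1\<^sup>2" using hb(3) unfolding s(2) by (simp add: power_mult_distrib)
    then have as: "2 * a * s \<le> 1" by (rule power2_le_imp_le) simp
    have "s\<^sup>2 \<le> D\<^sup>2" using hb(4) unfolding s(2) .
    then have "s \<le> D" by (rule power2_le_imp_le) (use D in simp)
    then have sA: "s * A \<le> p * a\<^sup>2 / 8" using A by (simp add: D_def pos_le_divide_eq)
    define w where "w = (1 / s) *\<^sub>R (euler_step h b x - euler_step h b y)"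
    define r where "r = norm (x - y)"
    have r: "r \<ge> 0" by (simp add: r_def)
    have sw: "s * norm w = norm (euler_step h b x - euler_step h b y)"
      using s by (simp add: w_def)
    have m': "1 + (\<integral>z. (norm z)\<^sup>2 \<partial>(gaussian 1 :: (real ^ 'd) measure)) \<le> m" by (simp add: m_def)
    have a0: "a \<ge> 0" and \<epsilon>0: "\<epsilon> \<ge> 0" using a \<epsilon> by auto
    have "(\<integral>\<^sup>+u. ennreal (cost a \<epsilon> (s * norm (w + fst u - coupled_noise w u))) \<partial>pair_noise)
        \<le> ennreal ((1 - c * h) * cost a \<epsilon> r)" (is "?E \<le> _")
    proof (cases "R' < r")
      case True
      have "(s * norm w)\<^sup>2 \<le> (1 - K * h) * r\<^sup>2"
        unfolding sw r_def using True R' h hb by (intro norm_euler_step_diff_dissipative[OF lip diss]) (auto simp: r_def)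
      moreover have "\<dots> \<le> 1 * r\<^sup>2" using pos h by (intro mult_right_mono) auto
      ultimately have \<rho>: "(s * norm w)\<^sup>2 \<le> r\<^sup>2" "(s * norm w)\<^sup>2 \<le> (1 - K * h) * r\<^sup>2"
        by linarith+
      have \<rho>r: "s * norm w \<le> r" using \<rho>(1) r by (rule power2_le_imp_le)
      have \<rho>0: "0 \<le> s * norm w" using s by simp
      \<comment> \<open>Here the gain from concavity is taken to be 0: at this distance the drift
        alone pays for the noise.\<close>
      have "?E \<le> ennreal (cost a \<epsilon> (s * norm w) - 0 * p + 4 * \<epsilon> * s\<^sup>2 * m)"
        using odd_ext_cost_pair(1)[OF a0 \<epsilon>0 \<rho>0 s(1)] \<epsilon>0
        by (intro coupled_cost_le[OF a0 \<epsilon>0 s(1) order_refl _ _ _ p(2) m']) auto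
      also have "\<dots> \<le> ennreal ((1 - c * h) * cost a \<epsilon> r)"
        using cost_contraction_large[OF a0 \<epsilon>(1) h(1) c(1) R'(1) _ \<rho>0 \<rho>r \<rho>(2) mR c(2)] True s
        by (intro ennreal_leI) simp
      finally show ?thesis .
    next
      case False
      then have rR: "r \<le> R'" by simp
      \<comment> \<open>Inside R' the drift may expand, so only the Lipschitz bound is available and
        \<open>\<rho>\<close> exceeds \<open>r\<close> slightly.\<close>
      define \<rho> where "\<rho> = (1 + L * h) * r"
      have \<rho>: "s * norm w \<le> \<rho>"
        unfolding sw \<rho>_def r_def using h by (intro norm_euler_step_diff_le lip) auto
      have \<rho>0: "0 \<le> \<rho>" using r pos h by (simp add: \<rho>_def)
      show ?thesis
      proof (cases "\<rho> \<le> 2 * s")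
        case True
        have "?E \<le> ennreal (cost a \<epsilon> \<rho> - a\<^sup>2 * \<rho> * s / 4 * p + 4 * \<epsilon> * \<rho> * s * m)"
          using odd_ext_cost_pair(3)[OF a0 \<epsilon>0 \<rho>0 s(1) True as] \<epsilon>0 \<rho>0 s
          by (intro coupled_cost_le[OF a0 \<epsilon>0 s(1) \<rho> _ _ _ p(2) m']) auto
        also have "\<dots> \<le> ennreal ((1 - c * h) * cost a \<epsilon> r)"
          using cost_contraction_small[OF a(1) \<epsilon>(1) s(1) c(1) p(1) pos(1) r rR _ \<epsilon>(3) sA[unfolded A_def]] True m s(2)
          by (intro ennreal_leI) (simp add: \<rho>_def)
        finally show ?thesis .
      next
        case False
        then have *: "2 * s \<le> \<rho>" by simp
        have "?E \<le> ennreal (cost a \<epsilon> \<rho> - a\<^sup>2 * s\<^sup>2 * exp (- a * \<rho>) * p + 4 * \<epsilon> * s\<^sup>2 * m)"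
          using odd_ext_cost_pair(2)[OF a0 \<epsilon>0 \<rho>0 s(1) *] \<epsilon>0
          by (intro coupled_cost_le[OF a0 \<epsilon>0 s(1) \<rho> _ _ _ p(2) m']) auto
        also have "\<dots> \<le> ennreal ((1 - c * h) * cost a \<epsilon> r)"
          using cost_contraction_medium[OF a(1) \<epsilon>(1) h(1) c(1) p(1) pos(1) r rR _ hb(1,2) a(2) \<epsilon>(2)[unfolded q_def] c(3)[unfolded q_def]]
            m s(2) by (intro ennreal_leI) (simp add: \<rho>_def)
        finally show ?thesis .
      qed
    qed
    then show "coupled_euler_cost a \<epsilon> h b x y \<le> ennreal ((1 - c * h) * cost a \<epsilon> (norm (x - y)))"
      unfolding Let_def s_def[symmetric] w_def[symmetric] r_def[symmetric] .
  qed
qed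

section \<open>One step of the coupled chains\<close>

definition step_law ::
  "real \<Rightarrow> (real ^ 'd \<Rightarrow> real ^ 'n \<Rightarrow> real ^ 'd) \<Rightarrow> (real ^ 'n) measure \<Rightarrow> (real ^ 'd) measure \<Rightarrow> (real ^ 'd) measure"
  where "step_law h \<beta> \<upsilon> \<nu> = distr (\<nu> \<Otimes>\<^sub>M (\<upsilon> \<Otimes>\<^sub>M gaussian 1)) borel
    (\<lambda>(x, u, z). x + h *\<^sub>R \<beta> x u + sqrt h *\<^sub>R z)"

lemma sets_step_law[simp, measurable_cong]: "sets (step_law h \<beta> \<upsilon> \<nu>) = sets borel"
  by (simp add: step_law_def)

lemma step_map_measurable:
  fixes \<beta> :: "real ^ 'd \<Rightarrow> real ^ 'n \<Rightarrow> real ^ 'd"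
  assumes [measurable]: "(\<lambda>(x, u). \<beta> x u) \<in> borel_measurable (borel \<Otimes>\<^sub>M borel)"
  shows "(\<lambda>(x, u, z). x + h *\<^sub>R \<beta> x u + sqrt h *\<^sub>R z) \<in> borel_measurable (borel \<Otimes>\<^sub>M (borel \<Otimes>\<^sub>M borel))"
  by measurable

lemma prob_space_step_law:
  fixes \<beta> :: "real ^ 'd \<Rightarrow> real ^ 'n \<Rightarrow> real ^ 'd"
  assumes \<beta>: "(\<lambda>(x, u). \<beta> x u) \<in> borel_measurable (borel \<Otimes>\<^sub>M borel)"
    and \<nu>: "prob_space \<nu>" "sets \<nu> = sets borel" and \<upsilon>: "prob_space \<upsilon>" "sets \<upsilon> = sets borel"
  shows "prob_space (step_law h \<beta> \<upsilon> \<nu>)"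
proof -
  interpret G: prob_space "gaussian 1 :: (real ^ 'd) measure" by (rule prob_space_gaussian)
  interpret V: prob_space \<upsilon> by fact
  interpret N: prob_space \<nu> by fact
  interpret VG: pair_prob_space \<upsilon> "gaussian 1 :: (real ^ 'd) measure" ..
  interpret NVG: pair_prob_space \<nu> "\<upsilon> \<Otimes>\<^sub>M (gaussian 1 :: (real ^ 'd) measure)" ..
  note [measurable_cong] = \<nu>(2) \<upsilon>(2)
  show ?thesis
    unfolding step_law_def
    by (rule NVG.prob_space_distr) (use step_map_measurable[OF \<beta>] in measurable)
qed

lemma nn_integral_step_law:
  fixes \<beta> :: "real ^ 'd \<Rightarrow> real ^ 'n \<Rightarrow> real ^ 'd"
  assumes \<beta>: "(\<lambda>(x, u). \<beta> x u) \<in> borel_measurable (borel \<Otimes>\<^sub>M borel)"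
    and \<upsilon>: "prob_space \<upsilon>" "sets \<upsilon> = sets borel" and \<nu>: "sets \<nu> = sets borel"
    and f[measurable]: "f \<in> borel_measurable borel"
  shows "(\<integral>\<^sup>+x. f x \<partial>step_law h \<beta> \<upsilon> \<nu>)
    = (\<integral>\<^sup>+x. \<integral>\<^sup>+u. \<integral>\<^sup>+z. f (x + h *\<^sub>R \<beta> x u + sqrt h *\<^sub>R z) \<partial>gaussian 1 \<partial>\<upsilon> \<partial>\<nu>)"
proof -
  interpret G: prob_space "gaussian 1 :: (real ^ 'd) measure" by (rule prob_space_gaussian)
  interpret V: prob_space \<upsilon> by fact
  interpret VG: pair_prob_space \<upsilon> "gaussian 1 :: (real ^ 'd) measure" ..
  note [measurable_cong] = \<nu> \<upsilon>(2)
  let ?s = "\<lambda>(x, u, z). x + h *\<^sub>R \<beta> x u + sqrt h *\<^sub>R z"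
  note s[measurable] = step_map_measurable[OF \<beta>, of h]
  have fs: "(\<lambda>p. f (?s p)) \<in> borel_measurable (borel \<Otimes>\<^sub>M (borel \<Otimes>\<^sub>M borel))"
    by measurable
  have "(\<integral>\<^sup>+x. f x \<partial>step_law h \<beta> \<upsilon> \<nu>) = (\<integral>\<^sup>+p. f (?s p) \<partial>(\<nu> \<Otimes>\<^sub>M (\<upsilon> \<Otimes>\<^sub>M gaussian 1)))"
    unfolding step_law_def by (rule nn_integral_distr) measurable
  also have "\<dots> = (\<integral>\<^sup>+x. \<integral>\<^sup>+q. f (?s (x, q)) \<partial>(\<upsilon> \<Otimes>\<^sub>M gaussian 1) \<partial>\<nu>)"
    by (rule VG.nn_integral_fst[symmetric]) measurable
  also have "\<dots> = (\<integral>\<^sup>+x. \<integral>\<^sup>+u. \<integral>\<^sup>+z. f (?s (x, u, z)) \<partial>gaussian 1 \<partial>\<upsilon> \<partial>\<nu>)"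
  proof (rule nn_integral_cong)
    fix x
    have "(\<lambda>q. f (?s (x, q))) \<in> borel_measurable (borel \<Otimes>\<^sub>M borel)"
      by (rule measurable_compose[OF measurable_Pair1' fs]) simp
    then have [measurable]: "(\<lambda>q. f (?s (x, q))) \<in> borel_measurable (\<upsilon> \<Otimes>\<^sub>M gaussian 1)"
      by (subst measurable_cong_sets[OF sets_pair_measure_cong[OF \<upsilon>(2) sets_gaussian] refl])
    show "(\<integral>\<^sup>+q. f (?s (x, q)) \<partial>(\<upsilon> \<Otimes>\<^sub>M gaussian 1)) = (\<integral>\<^sup>+u. \<integral>\<^sup>+z. f (?s (x, u, z)) \<partial>gaussian 1 \<partial>\<upsilon>)"
      by (rule G.nn_integral_fst[symmetric]) measurable
  qed
  finally show ?thesis by simp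
qed

text \<open>The shift of the noise uses the exact drift at both points and hence does not depend on
  \<open>u\<close>. The estimator thus leaves the coupling of the Gaussians unchanged and displaces
  the second point by h (\<beta> y u - b y).\<close>

definition coupled_step ::
  "real \<Rightarrow> (real ^ 'd \<Rightarrow> real ^ 'd) \<Rightarrow> (real ^ 'd \<Rightarrow> real ^ 'n \<Rightarrow> real ^ 'd) \<Rightarrow>
   ((real ^ 'd) \<times> (real ^ 'd)) \<times> ((real ^ 'n) \<times> ((real ^ 'd) \<times> real)) \<Rightarrow> (real ^ 'd) \<times> (real ^ 'd)" where
  "coupled_step h b \<beta> = (\<lambda>((x, y), (u, q)).
     (x + h *\<^sub>R b x + sqrt h *\<^sub>R fst q,
      y + h *\<^sub>R \<beta> y u + sqrt h *\<^sub>R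
        coupled_noise ((1 / sqrt h) *\<^sub>R (euler_step h b x - euler_step h b y)) q))"

lemma coupled_step_measurable:
  fixes \<beta> :: "real ^ 'd \<Rightarrow> real ^ 'n \<Rightarrow> real ^ 'd"
  assumes [measurable]: "(\<lambda>(x, u). \<beta> x u) \<in> borel_measurable (borel \<Otimes>\<^sub>M borel)" "b \<in> borel_measurable borel"
  shows "coupled_step h b \<beta> \<in>
    ((borel \<Otimes>\<^sub>M borel) \<Otimes>\<^sub>M (borel \<Otimes>\<^sub>M (borel \<Otimes>\<^sub>M borel))) \<rightarrow>\<^sub>M (borel \<Otimes>\<^sub>M borel)"
proof -
  let ?N = "((borel \<Otimes>\<^sub>M borel) \<Otimes>\<^sub>M (borel \<Otimes>\<^sub>M (borel \<Otimes>\<^sub>M borel)))"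
  have w: "(\<lambda>p. ((1 / sqrt h) *\<^sub>R (euler_step h b (fst (fst p)) - euler_step h b (snd (fst p))), snd (snd p))) \<in> ?N \<rightarrow>\<^sub>M (borel \<Otimes>\<^sub>M (borel \<Otimes>\<^sub>M borel))"
    unfolding euler_step_def by measurable
  have [measurable]: "(\<lambda>p. coupled_noise ((1 / sqrt h) *\<^sub>R (euler_step h b (fst (fst p)) - euler_step h b (snd (fst p)))) (snd (snd p))) \<in> borel_measurable ?N"
    using measurable_compose[OF w coupled_noise_measurable] by simp
  show ?thesis
    unfolding coupled_step_def case_prod_beta' by measurable
qed

lemma nn_integral_coupled_step:
  fixes \<beta> :: "real ^ 'd \<Rightarrow> real ^ 'n \<Rightarrow> real ^ 'd"
  assumes \<beta>: "(\<lambda>(x, u). \<beta> x u) \<in> borel_measurable (borel \<Otimes>\<^sub>M borel)" and b: "b \<in> borel_measurable borel"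
    and \<upsilon>: "prob_space \<upsilon>" "sets \<upsilon> = sets borel" and \<gamma>: "sets \<gamma> = sets (borel \<Otimes>\<^sub>M borel)"
    and F[measurable]: "F \<in> borel_measurable (borel \<Otimes>\<^sub>M borel)"
  shows "(\<integral>\<^sup>+p. F (coupled_step h b \<beta> p) \<partial>(\<gamma> \<Otimes>\<^sub>M (\<upsilon> \<Otimes>\<^sub>M pair_noise)))
    = (\<integral>\<^sup>+v. \<integral>\<^sup>+u. \<integral>\<^sup>+q. F (coupled_step h b \<beta> (v, u, q)) \<partial>pair_noise \<partial>\<upsilon> \<partial>\<gamma>)"
proof -
  interpret G: prob_space "gaussian 1 :: (real ^ 'd) measure" by (rule prob_space_gaussian)
  interpret I: prob_space unif01 by (rule prob_space_unif01)
  interpret V: prob_space \<upsilon> by fact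
  interpret GI: pair_prob_space "gaussian 1 :: (real ^ 'd) measure" unif01 ..
  interpret VGI: pair_prob_space \<upsilon> "(gaussian 1 :: (real ^ 'd) measure) \<Otimes>\<^sub>M unif01" ..
  note [measurable_cong] = \<gamma> \<upsilon>(2)
  note [measurable] = coupled_step_measurable[OF \<beta> b, of h]
  have FS: "(\<lambda>p. F (coupled_step h b \<beta> p)) \<in> borel_measurable ((borel \<Otimes>\<^sub>M borel) \<Otimes>\<^sub>M (borel \<Otimes>\<^sub>M (borel \<Otimes>\<^sub>M borel)))"
    by measurable
  have "(\<integral>\<^sup>+p. F (coupled_step h b \<beta> p) \<partial>(\<gamma> \<Otimes>\<^sub>M (\<upsilon> \<Otimes>\<^sub>M pair_noise)))
      = (\<integral>\<^sup>+v. \<integral>\<^sup>+r. F (coupled_step h b \<beta> (v, r)) \<partial>(\<upsilon> \<Otimes>\<^sub>M pair_noise) \<partial>\<gamma>)"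
    by (rule VGI.nn_integral_fst[symmetric]) measurable
  also have "\<dots> = (\<integral>\<^sup>+v. \<integral>\<^sup>+u. \<integral>\<^sup>+q. F (coupled_step h b \<beta> (v, u, q)) \<partial>pair_noise \<partial>\<upsilon> \<partial>\<gamma>)"
  proof (rule nn_integral_cong)
    fix v
    have "(\<lambda>r. F (coupled_step h b \<beta> (v, r))) \<in> borel_measurable (borel \<Otimes>\<^sub>M (borel \<Otimes>\<^sub>M borel))"
      by (rule measurable_compose[OF measurable_Pair1' FS]) (simp add: space_pair_measure)
    moreover have "sets (\<upsilon> \<Otimes>\<^sub>M ((gaussian 1 :: (real ^ 'd) measure) \<Otimes>\<^sub>M unif01)) = sets (borel \<Otimes>\<^sub>M (borel \<Otimes>\<^sub>M borel))"
      by (intro sets_pair_measure_cong \<upsilon>(2) sets_gaussian sets_unif01)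
    ultimately have "(\<lambda>r. F (coupled_step h b \<beta> (v, r))) \<in> borel_measurable (\<upsilon> \<Otimes>\<^sub>M pair_noise)"
      using measurable_cong_sets by blast
    then show "(\<integral>\<^sup>+r. F (coupled_step h b \<beta> (v, r)) \<partial>(\<upsilon> \<Otimes>\<^sub>M pair_noise))
        = (\<integral>\<^sup>+u. \<integral>\<^sup>+q. F (coupled_step h b \<beta> (v, u, q)) \<partial>pair_noise \<partial>\<upsilon>)"
      by (rule GI.nn_integral_fst[symmetric])
  qed
  finally show ?thesis .
qed

text \<open>For fixed x, y and u the coupled noise is standard Gaussian whatever the shift, by
  \<open>distr_coupled_noise\<close>; integrating it first therefore removes the dependence on x
  from the second marginal. For the first marginal the uniform variable is integrated out.\<close>

lemma coupled_step_couplings: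
  fixes \<beta> :: "real ^ 'd \<Rightarrow> real ^ 'n \<Rightarrow> real ^ 'd"
  assumes \<beta>: "(\<lambda>(x, u). \<beta> x u) \<in> borel_measurable (borel \<Otimes>\<^sub>M borel)" and b: "b \<in> borel_measurable borel"
    and \<upsilon>: "prob_space \<upsilon>" "sets \<upsilon> = sets borel" and \<gamma>: "\<gamma> \<in> couplings \<mu> \<nu>"
    and \<mu>: "sets \<mu> = sets borel" and \<nu>: "sets \<nu> = sets borel"
  shows "distr (\<gamma> \<Otimes>\<^sub>M (\<upsilon> \<Otimes>\<^sub>M pair_noise)) (borel \<Otimes>\<^sub>M borel) (coupled_step h b \<beta>)
    \<in> couplings (step_law h (\<lambda>x _. b x) \<upsilon> \<mu>) (step_law h \<beta> \<upsilon> \<nu>)" (is "?\<gamma> \<in> _")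
proof -
  interpret G: prob_space "gaussian 1 :: (real ^ 'd) measure" by (rule prob_space_gaussian)
  interpret I: prob_space unif01 by (rule prob_space_unif01)
  interpret V: prob_space \<upsilon> by fact
  note s\<gamma>[measurable_cong] = couplingsD(1)[OF \<gamma>]
  note [measurable_cong] = \<upsilon>(2)
  note [measurable] = coupled_step_measurable[OF \<beta> b, of h] b
  have bu: "(\<lambda>(x, u :: real ^ 'n). b x) \<in> borel_measurable (borel \<Otimes>\<^sub>M borel)"
    by measurable
  have emeasure_F: "emeasure (distr ?\<gamma> borel \<phi>) A
      = (\<integral>\<^sup>+v. \<integral>\<^sup>+u. \<integral>\<^sup>+q. indicator A (\<phi> (coupled_step h b \<beta> (v, u, q))) \<partial>pair_noise \<partial>\<upsilon> \<partial>\<gamma>)"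
    if [measurable]: "A \<in> sets borel" "\<phi> \<in> borel_measurable (borel \<Otimes>\<^sub>M borel)"
    for A :: "(real ^ 'd) set" and \<phi>
  proof -
    have "emeasure (distr ?\<gamma> borel \<phi>) A = (\<integral>\<^sup>+x. indicator A x \<partial>distr ?\<gamma> borel \<phi>)"
      by (rule nn_integral_indicator[symmetric]) simp
    also have "\<dots> = (\<integral>\<^sup>+w. indicator A (\<phi> w) \<partial>?\<gamma>)"
      by (rule nn_integral_distr) measurable
    also have "\<dots> = (\<integral>\<^sup>+p. indicator A (\<phi> (coupled_step h b \<beta> p)) \<partial>(\<gamma> \<Otimes>\<^sub>M (\<upsilon> \<Otimes>\<^sub>M pair_noise)))"
      by (rule nn_integral_distr) measurable
    also have "\<dots> = (\<integral>\<^sup>+v. \<integral>\<^sup>+u. \<integral>\<^sup>+q. indicator A (\<phi> (coupled_step h b \<beta> (v, u, q))) \<partial>pair_noise \<partial>\<upsilon> \<partial>\<gamma>)"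
      by (rule nn_integral_coupled_step[OF \<beta> b \<upsilon> s\<gamma>, where F="\<lambda>w. indicator A (\<phi> w)"]) measurable
    finally show ?thesis .
  qed
  have emeasure_L: "emeasure (step_law h \<beta>' \<upsilon> \<nu>') A
      = (\<integral>\<^sup>+x. \<integral>\<^sup>+u. \<integral>\<^sup>+z. indicator A (x + h *\<^sub>R \<beta>' x u + sqrt h *\<^sub>R z) \<partial>gaussian 1 \<partial>\<upsilon> \<partial>\<nu>')"
    if \<beta>': "(\<lambda>(x, u). \<beta>' x u) \<in> borel_measurable (borel \<Otimes>\<^sub>M borel)" and A: "A \<in> sets borel" and \<nu>': "sets \<nu>' = sets borel"
    for \<beta>' :: "real ^ 'd \<Rightarrow> real ^ 'n \<Rightarrow> real ^ 'd" and \<nu>' and A :: "(real ^ 'd) set"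
  proof -
    have "emeasure (step_law h \<beta>' \<upsilon> \<nu>') A = (\<integral>\<^sup>+x. indicator A x \<partial>step_law h \<beta>' \<upsilon> \<nu>')"
      using A by (intro nn_integral_indicator[symmetric]) simp
    also have "\<dots> = (\<integral>\<^sup>+x. \<integral>\<^sup>+u. \<integral>\<^sup>+z. indicator A (x + h *\<^sub>R \<beta>' x u + sqrt h *\<^sub>R z) \<partial>gaussian 1 \<partial>\<upsilon> \<partial>\<nu>')"
      using A by (intro nn_integral_step_law \<beta>' \<upsilon> \<nu>') simp
    finally show ?thesis .
  qed
  have inner: "(\<lambda>x. \<integral>\<^sup>+u. \<integral>\<^sup>+z. indicator A (x + h *\<^sub>R \<beta>' x u + sqrt h *\<^sub>R z) \<partial>gaussian 1 \<partial>\<upsilon>) \<in> borel_measurable borel"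
    if \<beta>'[measurable]: "(\<lambda>(x, u). \<beta>' x u) \<in> borel_measurable (borel \<Otimes>\<^sub>M borel)" and [measurable]: "A \<in> sets borel"
    for \<beta>' :: "real ^ 'd \<Rightarrow> real ^ 'n \<Rightarrow> real ^ 'd" and A :: "(real ^ 'd) set"
    by measurable
  have "distr ?\<gamma> borel fst = step_law h (\<lambda>x _. b x) \<upsilon> \<mu>"
  proof (rule measure_eqI)
    fix A assume "A \<in> sets (distr ?\<gamma> borel fst)"
    then have A[measurable]: "A \<in> sets borel" by simp
    have q: "(\<integral>\<^sup>+q. indicator A (x + h *\<^sub>R b x + sqrt h *\<^sub>R fst q) \<partial>pair_noise)
        = (\<integral>\<^sup>+z. indicator A (x + h *\<^sub>R b x + sqrt h *\<^sub>R z) \<partial>gaussian 1)" for x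
      by (subst I.nn_integral_fst[symmetric]) (auto simp: I.emeasure_space_1)
    have "emeasure (distr ?\<gamma> borel fst) A = (\<integral>\<^sup>+v. \<integral>\<^sup>+u. \<integral>\<^sup>+z. indicator A (fst v + h *\<^sub>R b (fst v) + sqrt h *\<^sub>R z) \<partial>gaussian 1 \<partial>\<upsilon> \<partial>\<gamma>)"
      by (subst emeasure_F) (auto simp: coupled_step_def q case_prod_beta intro!: nn_integral_cong)
    also have "\<dots> = (\<integral>\<^sup>+x. \<integral>\<^sup>+u. \<integral>\<^sup>+z. indicator A (x + h *\<^sub>R b x + sqrt h *\<^sub>R z) \<partial>gaussian 1 \<partial>\<upsilon> \<partial>distr \<gamma> borel fst)"
      by (rule nn_integral_distr[symmetric]) (use inner[OF bu A] in measurable)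
    also have "\<dots> = emeasure (step_law h (\<lambda>x _. b x) \<upsilon> \<mu>) A"
      unfolding couplingsD(2)[OF \<gamma>] by (rule emeasure_L[OF bu A \<mu>, symmetric])
    finally show "emeasure (distr ?\<gamma> borel fst) A = emeasure (step_law h (\<lambda>x _. b x) \<upsilon> \<mu>) A" .
  qed simp
  moreover have "distr ?\<gamma> borel snd = step_law h \<beta> \<upsilon> \<nu>"
  proof (rule measure_eqI)
    fix A assume "A \<in> sets (distr ?\<gamma> borel snd)"
    then have A[measurable]: "A \<in> sets borel" by simp
    have q: "(\<integral>\<^sup>+q. indicator A (c + sqrt h *\<^sub>R coupled_noise w q) \<partial>pair_noise)
        = (\<integral>\<^sup>+z. indicator A (c + sqrt h *\<^sub>R z) \<partial>gaussian 1)" for c w :: "real ^ 'd"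
    proof -
      note [measurable] = coupled_noise_measurable_noise[of w]
      show ?thesis
        by (subst (2) distr_coupled_noise[of w, symmetric], subst nn_integral_distr) auto
    qed
    have "emeasure (distr ?\<gamma> borel snd) A = (\<integral>\<^sup>+v. \<integral>\<^sup>+u. \<integral>\<^sup>+z. indicator A (snd v + h *\<^sub>R \<beta> (snd v) u + sqrt h *\<^sub>R z) \<partial>gaussian 1 \<partial>\<upsilon> \<partial>\<gamma>)"
      by (subst emeasure_F) (auto simp: coupled_step_def q case_prod_beta intro!: nn_integral_cong)
    also have "\<dots> = (\<integral>\<^sup>+x. \<integral>\<^sup>+u. \<integral>\<^sup>+z. indicator A (x + h *\<^sub>R \<beta> x u + sqrt h *\<^sub>R z) \<partial>gaussian 1 \<partial>\<upsilon> \<partial>distr \<gamma> borel snd)"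
      by (rule nn_integral_distr[symmetric]) (use inner[OF \<beta> A] in measurable)
    also have "\<dots> = emeasure (step_law h \<beta> \<upsilon> \<nu>) A"
      unfolding couplingsD(3)[OF \<gamma>] by (rule emeasure_L[OF \<beta> A \<nu>, symmetric])
    finally show "emeasure (distr ?\<gamma> borel snd) A = emeasure (step_law h \<beta> \<upsilon> \<nu>) A" .
  qed simp
  ultimately show ?thesis by (simp add: couplings_def)
qed

text \<open>The exponential part is a-Lipschitz, and D <= 1 + D^2. The cross term of the square is
  split by 2 r D <= r^2 + D^2, and \<epsilon> r^2 is at most the cost. So a displacement \<eta> D
  enlarges the cost by a factor 1 + \<eta> and an error of order \<eta>.\<close>

lemma cost_perturb:
  fixes a \<epsilon> r r' D \<eta> :: real
  assumes pos: "a > 0" "\<epsilon> > 0" "0 < \<eta>" "\<eta> \<le> 1" and r: "0 \<le> r" "0 \<le> r'" "r' \<le> r + \<eta> * D" and D: "D \<ge> 0"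
  shows "cost a \<epsilon> r' \<le> (1 + \<eta>) * cost a \<epsilon> r + \<eta> * (a + (a + 2 * \<epsilon>) * D\<^sup>2)"
proof -
  define \<delta> where "\<delta> = \<eta> * D"
  have \<delta>: "\<delta> \<ge> 0" using pos D by (simp add: \<delta>_def)
  have "cost a \<epsilon> r' \<le> cost a \<epsilon> (r + \<delta>)"
    unfolding \<delta>_def using pos r by (intro cost_mono) auto
  moreover have "exp (- (a * r)) * (1 - a * \<delta>) \<le> exp (- a * (r + \<delta>))"
    using exp_shift_ge[of "a * r" "a * \<delta>"] by (simp add: algebra_simps)
  moreover have "exp (- (a * r)) * (a * \<delta>) \<le> 1 * (a * \<delta>)"
    using pos r \<delta> by (intro mult_right_mono) auto
  ultimately have 1: "cost a \<epsilon> r' \<le> cost a \<epsilon> r + a * \<delta> + \<epsilon> * (2 * r * \<delta>) + \<epsilon> * \<delta>\<^sup>2"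
    unfolding cost_def by (simp add: algebra_simps power2_eq_square)
  have "D \<le> 1 + D\<^sup>2"
    using zero_le_power2[of "D - 1 / 2"] by (simp add: power2_eq_square algebra_simps)
  then have 2: "(a * \<eta>) * D \<le> (a * \<eta>) * (1 + D\<^sup>2)" using pos by (intro mult_left_mono) auto
  have "2 * r * D \<le> r\<^sup>2 + D\<^sup>2" using sum_squares_bound[of r D] by simp
  then have 3: "(\<epsilon> * \<eta>) * (2 * r * D) \<le> (\<epsilon> * \<eta>) * (r\<^sup>2 + D\<^sup>2)" using pos by (intro mult_left_mono) auto
  have "\<eta> * (\<eta> * D\<^sup>2) \<le> 1 * (\<eta> * D\<^sup>2)" using pos by (intro mult_right_mono) auto
  then have 4: "\<epsilon> * (\<eta> * (\<eta> * D\<^sup>2)) \<le> \<epsilon> * (\<eta> * D\<^sup>2)" using pos by simp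
  have "exp (- a * r) \<le> 1" using pos r by simp
  then have "\<epsilon> * r\<^sup>2 \<le> cost a \<epsilon> r" by (simp add: cost_def)
  then have 5: "\<eta> * (\<epsilon> * r\<^sup>2) \<le> \<eta> * cost a \<epsilon> r" using pos by (intro mult_left_mono) auto
  show ?thesis using 1 2 3 4 5 unfolding \<delta>_def by (simp add: algebra_simps power2_eq_square)
qed

lemma ennreal_plus_mult:
  "0 \<le> x \<Longrightarrow> 0 \<le> y \<Longrightarrow> 0 \<le> z \<Longrightarrow> ennreal (x + y * z) = ennreal x + ennreal y * ennreal z"
  by (simp add: ennreal_mult)

text \<open>\<open>\<tau>\<close> stands for the root mean square scale of the estimator error. With
  \<eta> = h \<tau> and D the error divided by \<tau>, the displacement is \<eta> D. When \<tau> is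
  later chosen to match the variance, D^2 has bounded mean relative to 1 + |y|^2, so all errors are
  of order h \<tau>.\<close>

lemma coupled_step_cost_le:
  fixes b :: "real ^ 'd \<Rightarrow> real ^ 'd" and \<beta> :: "real ^ 'd \<Rightarrow> real ^ 'n \<Rightarrow> real ^ 'd"
  assumes pos: "a > 0" "\<epsilon> > 0" "h > 0" "\<tau> > 0" "h * \<tau> \<le> 1"
    and contr: "coupled_euler_cost a \<epsilon> h b x y \<le> ennreal (\<kappa> * cost a \<epsilon> (norm (x - y)))"
    and \<kappa>: "\<kappa> \<ge> 0"
  shows "(\<integral>\<^sup>+q. ennreal (cost a \<epsilon> (dist (fst (coupled_step h b \<beta> ((x, y), u, q))) (snd (coupled_step h b \<beta> ((x, y), u, q))))) \<partial>pair_noise)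
    \<le> ennreal ((1 + h * \<tau>) * \<kappa> * cost a \<epsilon> (dist x y) + h * \<tau> * a) + ennreal (h * (a + 2 * \<epsilon>) / \<tau>) * ennreal ((norm (\<beta> y u - b y))\<^sup>2)"
proof -
  interpret G: prob_space "gaussian 1 :: (real ^ 'd) measure" by (rule prob_space_gaussian)
  interpret I: prob_space unif01 by (rule prob_space_unif01)
  interpret GI: pair_prob_space "gaussian 1 :: (real ^ 'd) measure" unif01 ..
  define w where "w = (1 / sqrt h) *\<^sub>R (euler_step h b x - euler_step h b y)"
  note [measurable] = coupled_noise_measurable_noise[of w]
  define r where "r q = sqrt h * norm (w + fst q - coupled_noise w q)" for q
  have [measurable]: "r \<in> borel_measurable pair_noise"
    unfolding r_def by measurable
  define D where "D = norm (\<beta> y u - b y) / \<tau>"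
  have D: "D \<ge> 0" using pos by (simp add: D_def)
  have \<eta>: "0 < h * \<tau>" using pos by simp
  let ?\<eta> = "h * \<tau>"
  have cost0: "cost a \<epsilon> r \<ge> 0" if "r \<ge> 0" for r using pos that by (intro cost_nonneg) auto
  have "(\<integral>\<^sup>+q. ennreal (cost a \<epsilon> (dist (fst (coupled_step h b \<beta> ((x, y), u, q))) (snd (coupled_step h b \<beta> ((x, y), u, q))))) \<partial>pair_noise)
      \<le> (\<integral>\<^sup>+q. ennreal (1 + ?\<eta>) * ennreal (cost a \<epsilon> (r q)) + ennreal (?\<eta> * (a + (a + 2 * \<epsilon>) * D\<^sup>2)) \<partial>pair_noise)"
  proof (rule nn_integral_mono)
    fix q :: "(real ^ 'd) \<times> real"
    let ?S = "coupled_step h b \<beta> ((x, y), u, q)"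
    have S: "?S = (x + h *\<^sub>R b x + sqrt h *\<^sub>R fst q, y + h *\<^sub>R \<beta> y u + sqrt h *\<^sub>R coupled_noise w q)"
      by (simp add: coupled_step_def w_def)
    have sw: "sqrt h *\<^sub>R w = euler_step h b x - euler_step h b y"
      using pos by (simp add: w_def)
    have "fst ?S - snd ?S = sqrt h *\<^sub>R (w + fst q - coupled_noise w q) - h *\<^sub>R (\<beta> y u - b y)"
      unfolding scaleR_add_right scaleR_diff_right[of "sqrt h"] sw
      unfolding S by (simp add: euler_step_def algebra_simps)
    then have "dist (fst ?S) (snd ?S) \<le> norm (sqrt h *\<^sub>R (w + fst q - coupled_noise w q)) + norm (h *\<^sub>R (\<beta> y u - b y))"
      unfolding dist_norm by (metis norm_triangle_ineq4)
    also have "\<dots> = r q + ?\<eta> * D"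
      using pos by (simp add: r_def D_def)
    finally have "cost a \<epsilon> (dist (fst ?S) (snd ?S)) \<le> (1 + ?\<eta>) * cost a \<epsilon> (r q) + ?\<eta> * (a + (a + 2 * \<epsilon>) * D\<^sup>2)"
      using pos D \<eta> by (intro cost_perturb) (auto simp: r_def)
    then have "ennreal (cost a \<epsilon> (dist (fst ?S) (snd ?S))) \<le> ennreal ((1 + ?\<eta>) * cost a \<epsilon> (r q) + ?\<eta> * (a + (a + 2 * \<epsilon>) * D\<^sup>2))"
      by (rule ennreal_leI)
    also have "\<dots> = ennreal (1 + ?\<eta>) * ennreal (cost a \<epsilon> (r q)) + ennreal (?\<eta> * (a + (a + 2 * \<epsilon>) * D\<^sup>2))"
      using pos \<eta> cost0[of "r q"] by (subst ennreal_plus) (auto simp: ennreal_mult r_def)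
    finally show "ennreal (cost a \<epsilon> (dist (fst ?S) (snd ?S))) \<le> \<dots>" .
  qed
  also have "\<dots> = ennreal (1 + ?\<eta>) * (\<integral>\<^sup>+q. ennreal (cost a \<epsilon> (r q)) \<partial>pair_noise) + ennreal (?\<eta> * (a + (a + 2 * \<epsilon>) * D\<^sup>2))"
    by (subst nn_integral_add) (auto simp: nn_integral_cmult GI.emeasure_space_1)
  also have "\<dots> \<le> ennreal (1 + ?\<eta>) * ennreal (\<kappa> * cost a \<epsilon> (dist x y)) + ennreal (?\<eta> * (a + (a + 2 * \<epsilon>) * D\<^sup>2))"
    using contr unfolding Let_def w_def[symmetric] r_def[symmetric] dist_norm
    by (intro add_right_mono mult_left_mono) auto
  also have "\<dots> = ennreal ((1 + ?\<eta>) * \<kappa> * cost a \<epsilon> (dist x y) + ?\<eta> * a + h * (a + 2 * \<epsilon>) / \<tau> * (norm (\<beta> y u - b y))\<^sup>2)"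
  proof -
    have "?\<eta> * (a + (a + 2 * \<epsilon>) * D\<^sup>2) = ?\<eta> * a + h * (a + 2 * \<epsilon>) / \<tau> * (norm (\<beta> y u - b y))\<^sup>2"
      using pos by (simp add: D_def power_divide power2_eq_square distrib_left)
    then show ?thesis
      using pos \<eta> \<kappa> cost0[of "dist x y"]
      by (simp add: ennreal_mult[symmetric] ennreal_plus[symmetric] mult.assoc add.assoc del: ennreal_plus)
  qed
  also have "\<dots> = ennreal ((1 + ?\<eta>) * \<kappa> * cost a \<epsilon> (dist x y) + ?\<eta> * a) + ennreal (h * (a + 2 * \<epsilon>) / \<tau>) * ennreal ((norm (\<beta> y u - b y))\<^sup>2)"
    using pos \<kappa> cost0[of "dist x y"] by (intro ennreal_plus_mult) auto
  finally show ?thesis .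
qed

text \<open>Averaging over \<open>u\<close> turns the squared error divided by \<tau> into at most
  \<sigma>^2 (1 + |y|^2) \<tau>, and averaging over the coupling leaves the second moment of the
  perturbed chain. The condition \<open>2 * \<tau> \<le> c\<close> lets half of the contraction
  absorb the factor 1 + h \<tau>.\<close>

lemma coupled_step_expected_cost_le:
  fixes b :: "real ^ 'd \<Rightarrow> real ^ 'd" and \<beta> :: "real ^ 'd \<Rightarrow> real ^ 'n \<Rightarrow> real ^ 'd"
  assumes pos: "a > 0" "\<epsilon> > 0" "h > 0" "\<tau> > 0" "h * \<tau> \<le> 1" "c > 0" "c * h \<le> 1" and \<tau>c: "2 * \<tau> \<le> c"
    and contr: "\<And>x y. coupled_euler_cost a \<epsilon> h b x y \<le> ennreal ((1 - c * h) * cost a \<epsilon> (norm (x - y)))"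
    and \<beta>[measurable]: "(\<lambda>(x, u). \<beta> x u) \<in> borel_measurable (borel \<Otimes>\<^sub>M borel)" and b: "b \<in> borel_measurable borel"
    and \<upsilon>: "prob_space \<upsilon>" "sets \<upsilon> = sets borel" and \<gamma>: "\<gamma> \<in> couplings \<mu> \<nu>" and \<mu>: "prob_space \<mu>"
    and var: "\<And>x. (\<integral>\<^sup>+u. ennreal ((norm (\<beta> x u - b x))\<^sup>2) \<partial>\<upsilon>) \<le> ennreal (\<sigma>\<^sup>2 * (1 + (norm x)\<^sup>2) * \<tau>\<^sup>2)"
    and mom: "(\<integral>\<^sup>+y. ennreal ((norm y)\<^sup>2) \<partial>\<nu>) \<le> ennreal m" "m \<ge> 0"
    and S: "expected_cost a \<epsilon> \<gamma> \<le> ennreal S" "S \<ge> 0"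
  shows "(\<integral>\<^sup>+v. ennreal (cost a \<epsilon> (dist (fst v) (snd v)))
      \<partial>distr (\<gamma> \<Otimes>\<^sub>M (\<upsilon> \<Otimes>\<^sub>M pair_noise)) (borel \<Otimes>\<^sub>M borel) (coupled_step h b \<beta>))
    \<le> ennreal ((1 - c * h / 2) * S + h * \<tau> * (a + (a + 2 * \<epsilon>) * \<sigma>\<^sup>2) * (1 + m))"
proof -
  interpret V: prob_space \<upsilon> by fact
  interpret C: prob_space \<gamma> using couplings_prob_space[OF \<gamma> \<mu>] .
  note s\<gamma>[measurable_cong] = couplingsD(1)[OF \<gamma>]
  note [measurable_cong] = \<upsilon>(2)
  note [measurable] = b coupled_step_measurable[OF \<beta> b, of h]
  define B where "B = a + (a + 2 * \<epsilon>) * \<sigma>\<^sup>2"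
  have B: "B \<ge> 0" using pos by (simp add: B_def)
  have cost0: "cost a \<epsilon> (dist x y) \<ge> 0" for x y :: "real ^ 'd" using pos by (intro cost_nonneg) auto
  have \<kappa>: "1 - c * h \<ge> 0" using pos by simp
  have ch2: "c * h / 2 \<le> 1" using pos by simp
  have \<eta>: "(1 + h * \<tau>) * (1 - c * h) \<le> 1 - c * h / 2"
  proof -
    have "h * (2 * \<tau>) \<le> h * c" using \<tau>c pos by (intro mult_left_mono) auto
    moreover have "0 \<le> h * \<tau> * (c * h)" using pos by simp
    ultimately show ?thesis by (simp add: algebra_simps)
  qed
  have fcost: "(\<lambda>v :: (real ^ 'd) \<times> (real ^ 'd). ennreal (cost a \<epsilon> (dist (fst v) (snd v)))) \<in> borel_measurable (borel \<Otimes>\<^sub>M borel)"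
    by measurable
  have "(\<integral>\<^sup>+v. ennreal (cost a \<epsilon> (dist (fst v) (snd v)))
      \<partial>distr (\<gamma> \<Otimes>\<^sub>M (\<upsilon> \<Otimes>\<^sub>M pair_noise)) (borel \<Otimes>\<^sub>M borel) (coupled_step h b \<beta>))
    = (\<integral>\<^sup>+p. ennreal (cost a \<epsilon> (dist (fst (coupled_step h b \<beta> p)) (snd (coupled_step h b \<beta> p)))) \<partial>(\<gamma> \<Otimes>\<^sub>M (\<upsilon> \<Otimes>\<^sub>M pair_noise)))"
    by (rule nn_integral_distr) measurable
  also have "\<dots> = (\<integral>\<^sup>+v. \<integral>\<^sup>+u. \<integral>\<^sup>+q. ennreal (cost a \<epsilon> (dist (fst (coupled_step h b \<beta> (v, u, q))) (snd (coupled_step h b \<beta> (v, u, q)))))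
      \<partial>pair_noise \<partial>\<upsilon> \<partial>\<gamma>)"
    by (rule nn_integral_coupled_step[OF \<beta> b \<upsilon> s\<gamma> fcost])
  also have "\<dots> \<le> (\<integral>\<^sup>+v. ennreal (1 - c * h / 2) * ennreal (cost a \<epsilon> (dist (fst v) (snd v)))
      + ennreal (h * \<tau> * B) * (1 + ennreal ((norm (snd v))\<^sup>2)) \<partial>\<gamma>)"
  proof (rule nn_integral_mono)
    fix v :: "(real ^ 'd) \<times> (real ^ 'd)"
    obtain x y where v: "v = (x, y)" by (cases v)
    have k: "h * (a + 2 * \<epsilon>) / \<tau> \<ge> 0" using pos by simp
    have "(\<integral>\<^sup>+u. \<integral>\<^sup>+q. ennreal (cost a \<epsilon> (dist (fst (coupled_step h b \<beta> (v, u, q))) (snd (coupled_step h b \<beta> (v, u, q)))))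
      \<partial>pair_noise \<partial>\<upsilon>)
      \<le> (\<integral>\<^sup>+u. ennreal ((1 + h * \<tau>) * (1 - c * h) * cost a \<epsilon> (dist x y) + h * \<tau> * a)
          + ennreal (h * (a + 2 * \<epsilon>) / \<tau>) * ennreal ((norm (\<beta> y u - b y))\<^sup>2) \<partial>\<upsilon>)"
      unfolding v by (intro nn_integral_mono coupled_step_cost_le[OF pos(1-5) contr \<kappa>])
    also have "\<dots> = ennreal ((1 + h * \<tau>) * (1 - c * h) * cost a \<epsilon> (dist x y) + h * \<tau> * a)
        + ennreal (h * (a + 2 * \<epsilon>) / \<tau>) * (\<integral>\<^sup>+u. ennreal ((norm (\<beta> y u - b y))\<^sup>2) \<partial>\<upsilon>)"
      by (subst nn_integral_add) (auto simp: nn_integral_cmult V.emeasure_space_1)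
    also have "\<dots> \<le> ennreal ((1 - c * h / 2) * cost a \<epsilon> (dist x y) + h * \<tau> * a)
        + ennreal (h * (a + 2 * \<epsilon>) / \<tau>) * ennreal (\<sigma>\<^sup>2 * (1 + (norm y)\<^sup>2) * \<tau>\<^sup>2)"
      by (intro add_mono mult_left_mono var ennreal_leI mult_right_mono \<eta> cost0 order_refl) auto
    also have "\<dots> = ennreal ((1 - c * h / 2) * cost a \<epsilon> (dist x y) + (h * \<tau> * a + h * \<tau> * ((a + 2 * \<epsilon>) * \<sigma>\<^sup>2 * (1 + (norm y)\<^sup>2))))"
    proof -
      have *: "h * (a + 2 * \<epsilon>) / \<tau> * (\<sigma>\<^sup>2 * (1 + (norm y)\<^sup>2) * \<tau>\<^sup>2) = h * \<tau> * ((a + 2 * \<epsilon>) * \<sigma>\<^sup>2 * (1 + (norm y)\<^sup>2))"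
        using pos by (simp add: power2_eq_square)
      show ?thesis
        using pos cost0[of x y] ch2
        by (subst ennreal_plus_mult[OF _ k, symmetric]) (simp_all only: *, auto simp: add.assoc)
    qed
    also have "\<dots> \<le> ennreal ((1 - c * h / 2) * cost a \<epsilon> (dist x y) + h * \<tau> * B * (1 + (norm y)\<^sup>2))"
    proof (rule ennreal_leI)
      have "a \<le> a * (1 + (norm y)\<^sup>2)" using pos by (simp add: algebra_simps)
      then have "h * \<tau> * a \<le> h * \<tau> * (a * (1 + (norm y)\<^sup>2))" using pos by (intro mult_left_mono) auto
      then show "(1 - c * h / 2) * cost a \<epsilon> (dist x y) + (h * \<tau> * a + h * \<tau> * ((a + 2 * \<epsilon>) * \<sigma>\<^sup>2 * (1 + (norm y)\<^sup>2)))
        \<le> (1 - c * h / 2) * cost a \<epsilon> (dist x y) + h * \<tau> * B * (1 + (norm y)\<^sup>2)"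
        unfolding B_def by (simp add: algebra_simps)
    qed
    also have "\<dots> = ennreal (1 - c * h / 2) * ennreal (cost a \<epsilon> (dist (fst v) (snd v)))
      + ennreal (h * \<tau> * B) * (1 + ennreal ((norm (snd v))\<^sup>2))"
      using pos cost0[of x y] ch2 B unfolding v by (simp add: ennreal_mult)
    finally show "(\<integral>\<^sup>+u. \<integral>\<^sup>+q. ennreal (cost a \<epsilon> (dist (fst (coupled_step h b \<beta> (v, u, q))) (snd (coupled_step h b \<beta> (v, u, q)))))
      \<partial>pair_noise \<partial>\<upsilon>) \<le> \<dots>" .
  qed
  also have "\<dots> = ennreal (1 - c * h / 2) * expected_cost a \<epsilon> \<gamma>
      + ennreal (h * \<tau> * B) * (1 + (\<integral>\<^sup>+v. ennreal ((norm (snd v))\<^sup>2) \<partial>\<gamma>))"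
    by (simp add: nn_integral_add nn_integral_cmult C.emeasure_space_1)
  also have "(\<integral>\<^sup>+v. ennreal ((norm (snd v))\<^sup>2) \<partial>\<gamma>) = (\<integral>\<^sup>+y. ennreal ((norm y)\<^sup>2) \<partial>\<nu>)"
    unfolding couplingsD(3)[OF \<gamma>, symmetric] by (rule nn_integral_distr[symmetric]) measurable
  also have "ennreal (1 - c * h / 2) * expected_cost a \<epsilon> \<gamma>
      + ennreal (h * \<tau> * B) * (1 + (\<integral>\<^sup>+y. ennreal ((norm y)\<^sup>2) \<partial>\<nu>))
      \<le> ennreal (1 - c * h / 2) * ennreal S + ennreal (h * \<tau> * B) * (1 + ennreal m)"
    by (intro add_mono mult_left_mono S(1) mom(1) order_refl) auto
  also have "\<dots> = ennreal ((1 - c * h / 2) * S + h * \<tau> * B * (1 + m))"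
    using pos ch2 B S(2) mom(2) by (simp add: ennreal_mult)
  finally show ?thesis unfolding B_def .
qed

section \<open>Second moments\<close>

text \<open>Compare y with 0. Within distance R, Cauchy-Schwarz and the Lipschitz bound replace
  dissipativity, at the price of (K + L) R^2; the term with b 0 is absorbed by Young's inequality,
  which costs K/4.\<close>

lemma inner_le_of_dissipative:
  fixes b :: "'a::real_inner \<Rightarrow> 'a"
  assumes pos: "L > 0" "K > 0" "R > 0"
    and lip: "\<And>x y. norm (b x - b y) \<le> L * norm (x - y)"
    and diss: "\<And>x y. norm (x - y) > R \<Longrightarrow> (x - y) \<bullet> (b x - b y) \<le> - K * (norm (x - y))\<^sup>2"
  shows "y \<bullet> b y \<le> - (3 / 4 * K) * (norm y)\<^sup>2 + ((K + L) * R\<^sup>2 + (norm (b 0))\<^sup>2 / K)"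
proof -
  have "y \<bullet> (b y - b 0) \<le> - K * (norm y)\<^sup>2 + (K + L) * R\<^sup>2"
  proof (cases "norm y > R")
    case True
    have "0 \<le> (K + L) * R\<^sup>2" using pos by simp
    then show ?thesis using diss[of y 0] True by simp
  next
    case False
    have "y \<bullet> (b y - b 0) \<le> norm y * norm (b y - b 0)" by (rule norm_cauchy_schwarz)
    also have "\<dots> \<le> norm y * (L * norm y)" using lip[of y 0] by (intro mult_left_mono) auto
    also have "\<dots> = - K * (norm y)\<^sup>2 + (K + L) * (norm y)\<^sup>2" by (simp add: algebra_simps power2_eq_square)
    also have "(norm y)\<^sup>2 \<le> R\<^sup>2" using False by (intro power_mono) auto
    then have "- K * (norm y)\<^sup>2 + (K + L) * (norm y)\<^sup>2 \<le> - K * (norm y)\<^sup>2 + (K + L) * R\<^sup>2"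
      using pos by (intro add_left_mono mult_left_mono) auto
    finally show ?thesis .
  qed
  moreover have "y \<bullet> b 0 \<le> K / 4 * (norm y)\<^sup>2 + (norm (b 0))\<^sup>2 / K"
  proof -
    have "y \<bullet> b 0 \<le> norm y * norm (b 0)" by (rule norm_cauchy_schwarz)
    also have "\<dots> \<le> K / 4 * (norm y)\<^sup>2 + (norm (b 0))\<^sup>2 / K"
    proof -
      have "0 \<le> K * (norm y / 2 - norm (b 0) / K)\<^sup>2" using pos by simp
      also have "\<dots> = K / 4 * (norm y)\<^sup>2 + (norm (b 0))\<^sup>2 / K - norm y * norm (b 0)"
        using pos by (simp add: power2_eq_square field_simps)
      finally show ?thesis by simp
    qed
    finally show ?thesis .
  qed
  ultimately show ?thesis by (simp add: inner_diff_right algebra_simps)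
qed

text \<open>The inner product yields -(3/2) K h |y|^2, and the square of the increment gives back at
  most (1/2) K h |y|^2 when 4 L^2 h <= K.\<close>

lemma norm_euler_step_square_le:
  fixes b :: "real ^ 'd \<Rightarrow> real ^ 'd"
  assumes pos: "L > 0" "K > 0" "R > 0"
    and lip: "\<And>x y. norm (b x - b y) \<le> L * norm (x - y)"
    and diss: "\<And>x y. norm (x - y) > R \<Longrightarrow> (x - y) \<bullet> (b x - b y) \<le> - K * (norm (x - y))\<^sup>2"
    and h: "0 < h" "h \<le> 1" "4 * L\<^sup>2 * h \<le> K"
  shows "(norm (euler_step h b y))\<^sup>2 \<le> (1 - K * h) * (norm y)\<^sup>2
    + h * (2 * ((K + L) * R\<^sup>2 + (norm (b 0))\<^sup>2 / K) + 2 * (norm (b 0))\<^sup>2)"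
proof -
  define C where "C = (K + L) * R\<^sup>2 + (norm (b 0))\<^sup>2 / K"
  have "(norm (euler_step h b y))\<^sup>2 = (norm y)\<^sup>2 + 2 * h * (y \<bullet> b y) + h\<^sup>2 * (norm (b y))\<^sup>2"
    unfolding euler_step_def power2_norm_eq_inner
    by (simp add: inner_add_left inner_add_right inner_commute power2_eq_square)
  moreover have "2 * h * (y \<bullet> b y) \<le> 2 * h * (- (3 / 4 * K) * (norm y)\<^sup>2 + C)"
    using inner_le_of_dissipative[OF pos lip diss, of y] h unfolding C_def by (intro mult_left_mono) auto
  moreover have "h\<^sup>2 * (norm (b y))\<^sup>2 \<le> h * (K / 2 * (norm y)\<^sup>2) + h * (2 * (norm (b 0))\<^sup>2)"
  proof -
    have "norm (b y) \<le> norm (b y - b 0) + norm (b 0)" using norm_triangle_ineq[of "b y - b 0" "b 0"] by simp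
    then have "norm (b y) \<le> L * norm y + norm (b 0)" using lip[of y 0] by simp
    then have "(norm (b y))\<^sup>2 \<le> (L * norm y + norm (b 0))\<^sup>2" by (intro power_mono) auto
    also have "\<dots> \<le> 2 * L\<^sup>2 * (norm y)\<^sup>2 + 2 * (norm (b 0))\<^sup>2"
      using zero_le_power2[of "L * norm y - norm (b 0)"] by (simp add: power2_eq_square algebra_simps)
    finally have "h\<^sup>2 * (norm (b y))\<^sup>2 \<le> h\<^sup>2 * (2 * L\<^sup>2 * (norm y)\<^sup>2 + 2 * (norm (b 0))\<^sup>2)"
      by (intro mult_left_mono) auto
    also have "\<dots> = h * ((4 * L\<^sup>2 * h) / 2 * (norm y)\<^sup>2) + h * (h * (2 * (norm (b 0))\<^sup>2))"
      by (simp add: power2_eq_square algebra_simps)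
    also have "\<dots> \<le> h * (K / 2 * (norm y)\<^sup>2) + h * (1 * (2 * (norm (b 0))\<^sup>2))"
      using h by (intro add_mono mult_left_mono mult_right_mono divide_right_mono) auto
    finally show ?thesis by simp
  qed
  ultimately show ?thesis unfolding C_def[symmetric] by (simp add: algebra_simps)
qed

text \<open>Adding the integrals for z and -z cancels the cross term pointwise, so the computation
  stays within nonnegative integrals.\<close>

lemma nn_integral_gaussian_shift_square:
  fixes A :: "real ^ 'd"
  assumes "h \<ge> 0"
  shows "(\<integral>\<^sup>+z. ennreal ((norm (A + sqrt h *\<^sub>R z))\<^sup>2) \<partial>gaussian 1)
    = ennreal ((norm A)\<^sup>2 + h * (\<integral>z. (norm z)\<^sup>2 \<partial>(gaussian 1 :: (real ^ 'd) measure)))"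
proof -
  interpret G: prob_space "gaussian 1 :: (real ^ 'd) measure" by (rule prob_space_gaussian)
  let ?I = "\<integral>\<^sup>+z. ennreal ((norm (A + sqrt h *\<^sub>R z))\<^sup>2) \<partial>gaussian 1"
  let ?J = "ennreal ((norm A)\<^sup>2 + h * (\<integral>z. (norm z)\<^sup>2 \<partial>(gaussian 1 :: (real ^ 'd) measure)))"
  have "?I = (\<integral>\<^sup>+z. ennreal ((norm (A + sqrt h *\<^sub>R (- z)))\<^sup>2) \<partial>gaussian 1)"
    by (subst gaussian_distr_uminus[symmetric], subst nn_integral_distr) auto
  then have "?I + ?I = (\<integral>\<^sup>+z. ennreal ((norm (A + sqrt h *\<^sub>R z))\<^sup>2) + ennreal ((norm (A + sqrt h *\<^sub>R (- z)))\<^sup>2) \<partial>gaussian 1)"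
    by (subst nn_integral_add) auto
  also have "\<dots> = (\<integral>\<^sup>+z. ennreal 2 * (ennreal ((norm A)\<^sup>2) + ennreal h * ennreal ((norm z)\<^sup>2)) \<partial>(gaussian 1 :: (real ^ 'd) measure))"
  proof (rule nn_integral_cong)
    fix z :: "real ^ 'd"
    have "(norm (A + sqrt h *\<^sub>R z))\<^sup>2 + (norm (A + sqrt h *\<^sub>R (- z)))\<^sup>2 = 2 * ((norm A)\<^sup>2 + (sqrt h * sqrt h) * (norm z)\<^sup>2)"
      unfolding power2_norm_eq_inner by (simp add: inner_add_left inner_add_right inner_diff_left inner_diff_right inner_commute del: real_sqrt_mult_self)
    also have "\<dots> = 2 * ((norm A)\<^sup>2 + h * (norm z)\<^sup>2)" using assms by simp
    finally have "ennreal ((norm (A + sqrt h *\<^sub>R z))\<^sup>2 + (norm (A + sqrt h *\<^sub>R (- z)))\<^sup>2) = ennreal (2 * ((norm A)\<^sup>2 + h * (norm z)\<^sup>2))"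
      by simp
    also have "\<dots> = ennreal 2 * (ennreal ((norm A)\<^sup>2) + ennreal h * ennreal ((norm z)\<^sup>2))"
      using assms by (simp only: ennreal_mult ennreal_plus zero_le_power2 mult_nonneg_nonneg add_nonneg_nonneg zero_le_numeral)
    finally show "ennreal ((norm (A + sqrt h *\<^sub>R z))\<^sup>2) + ennreal ((norm (A + sqrt h *\<^sub>R (- z)))\<^sup>2) = \<dots>"
      by simp
  qed
  also have "\<dots> = ennreal 2 * (ennreal ((norm A)\<^sup>2) + ennreal h * (\<integral>\<^sup>+z. ennreal ((norm z)\<^sup>2) \<partial>(gaussian 1 :: (real ^ 'd) measure)))"
    by (simp add: nn_integral_cmult nn_integral_add G.emeasure_space_1[simplified])
  also have "(\<integral>\<^sup>+z. ennreal ((norm z)\<^sup>2) \<partial>(gaussian 1 :: (real ^ 'd) measure)) = ennreal (\<integral>z. (norm z)\<^sup>2 \<partial>(gaussian 1 :: (real ^ 'd) measure))"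
    by (rule nn_integral_eq_integral[OF integrable_gaussian_norm_square]) auto
  also have "ennreal ((norm A)\<^sup>2) + ennreal h * \<dots> = ?J"
    using assms by (intro ennreal_plus_mult[symmetric]) auto
  finally have "2 * ?I = 2 * ?J" by (simp add: mult_2)
  then show ?thesis by (simp add: ennreal_mult_cancel_left)
qed

text \<open>The Lyapunov estimate for the perturbed chain. Drift and estimator error are separated
  by Young's inequality with weight h \<tau>, as for the cost; the condition on
  \<open>\<tau>\<close> lets half of the drift K h absorb both the factor 1 + h \<tau> and the part
  of the variance growing with |y|^2.\<close>

lemma step_law_second_moment_le:
  fixes b :: "real ^ 'd \<Rightarrow> real ^ 'd" and \<beta> :: "real ^ 'd \<Rightarrow> real ^ 'n \<Rightarrow> real ^ 'd"
  assumes pos: "h > 0" "\<tau> > 0" "\<tau> \<le> 1" "h \<le> 1" "K > 0" "C \<ge> 0" and Kh: "K * h \<le> 1" and \<tau>K: "\<tau> * (1 + 2 * \<sigma>\<^sup>2) \<le> K / 2"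
    and drift: "\<And>y. (norm (euler_step h b y))\<^sup>2 \<le> (1 - K * h) * (norm y)\<^sup>2 + h * C"
    and \<beta>[measurable]: "(\<lambda>(x, u). \<beta> x u) \<in> borel_measurable (borel \<Otimes>\<^sub>M borel)" and b: "b \<in> borel_measurable borel"
    and \<upsilon>: "prob_space \<upsilon>" "sets \<upsilon> = sets borel" and \<nu>: "prob_space \<nu>" "sets \<nu> = sets borel"
    and var: "\<And>x. (\<integral>\<^sup>+u. ennreal ((norm (\<beta> x u - b x))\<^sup>2) \<partial>\<upsilon>) \<le> ennreal (\<sigma>\<^sup>2 * (1 + (norm x)\<^sup>2) * \<tau>\<^sup>2)"
    and mom: "(\<integral>\<^sup>+y. ennreal ((norm y)\<^sup>2) \<partial>\<nu>) \<le> ennreal m" "m \<ge> 0"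
  shows "(\<integral>\<^sup>+y. ennreal ((norm y)\<^sup>2) \<partial>step_law h \<beta> \<upsilon> \<nu>)
    \<le> ennreal ((1 - K * h / 2) * m + h * (2 * C + 2 * \<sigma>\<^sup>2 + (\<integral>z. (norm z)\<^sup>2 \<partial>(gaussian 1 :: (real ^ 'd) measure))))"
proof -
  interpret V: prob_space \<upsilon> by fact
  interpret N: prob_space \<nu> by fact
  note [measurable_cong] = \<upsilon>(2) \<nu>(2)
  note [measurable] = b
  define G where "G = (\<integral>z. (norm z)\<^sup>2 \<partial>(gaussian 1 :: (real ^ 'd) measure))"
  have G: "G \<ge> 0" by (simp add: G_def)
  define E where "E = 2 * C + 2 * \<sigma>\<^sup>2 + G"
  have E: "E \<ge> 0" using G pos by (simp add: E_def)
  define \<eta> where "\<eta> = h * \<tau>"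
  have \<eta>: "\<eta> > 0" "\<eta> \<le> 1" using pos mult_mono[of h 1 \<tau> 1] by (auto simp: \<eta>_def)
  have "(\<integral>\<^sup>+y. ennreal ((norm y)\<^sup>2) \<partial>step_law h \<beta> \<upsilon> \<nu>)
      = (\<integral>\<^sup>+y. \<integral>\<^sup>+u. \<integral>\<^sup>+z. ennreal ((norm (y + h *\<^sub>R \<beta> y u + sqrt h *\<^sub>R z))\<^sup>2) \<partial>gaussian 1 \<partial>\<upsilon> \<partial>\<nu>)"
    by (rule nn_integral_step_law[OF \<beta> \<upsilon> \<nu>(2)]) measurable
  also have "\<dots> \<le> (\<integral>\<^sup>+y. ennreal (h * E) + ennreal (1 - K * h / 2) * ennreal ((norm y)\<^sup>2) \<partial>\<nu>)"
  proof (rule nn_integral_mono)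
    fix y :: "real ^ 'd"
    define A where "A = (norm (euler_step h b y))\<^sup>2"
    have A: "A \<ge> 0" "A \<le> (1 - K * h) * (norm y)\<^sup>2 + h * C" using drift[of y] by (auto simp: A_def)
    have pt: "(norm (y + h *\<^sub>R \<beta> y u))\<^sup>2 + h * G \<le> ((1 + \<eta>) * A + h * G) + 2 * h / \<tau> * (norm (\<beta> y u - b y))\<^sup>2" for u
    proof -
      define D where "D = norm (\<beta> y u - b y) / \<tau>"
      have D: "D \<ge> 0" using pos by (simp add: D_def)
      have "y + h *\<^sub>R \<beta> y u = euler_step h b y + h *\<^sub>R (\<beta> y u - b y)"
        by (simp add: euler_step_def algebra_simps)
      then have "norm (y + h *\<^sub>R \<beta> y u) \<le> norm (euler_step h b y) + norm (h *\<^sub>R (\<beta> y u - b y))"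
        by (metis norm_triangle_ineq)
      also have "norm (h *\<^sub>R (\<beta> y u - b y)) = \<eta> * D" using pos by (simp add: \<eta>_def D_def)
      finally have "(norm (y + h *\<^sub>R \<beta> y u))\<^sup>2 \<le> (norm (euler_step h b y) + \<eta> * D)\<^sup>2" by (intro power_mono) auto
      also have "\<dots> = A + \<eta> * (2 * norm (euler_step h b y) * D) + \<eta> * (\<eta> * D\<^sup>2)"
        by (simp add: A_def power2_eq_square algebra_simps)
      also have "\<dots> \<le> A + \<eta> * (A + D\<^sup>2) + \<eta> * (1 * D\<^sup>2)"
        unfolding A_def using \<eta> sum_squares_bound[of "norm (euler_step h b y)" D]
        by (intro add_mono mult_left_mono mult_right_mono) auto
      also have "\<dots> = (1 + \<eta>) * A + 2 * (\<eta> * D\<^sup>2)" by (simp add: algebra_simps)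
      also have "\<eta> * D\<^sup>2 = h / \<tau> * (norm (\<beta> y u - b y))\<^sup>2"
        using pos by (simp add: \<eta>_def D_def power2_eq_square)
      finally show ?thesis by simp
    qed
    have k: "2 * h / \<tau> \<ge> 0" using pos by simp
    have "(\<integral>\<^sup>+u. \<integral>\<^sup>+z. ennreal ((norm (y + h *\<^sub>R \<beta> y u + sqrt h *\<^sub>R z))\<^sup>2) \<partial>gaussian 1 \<partial>\<upsilon>)
        = (\<integral>\<^sup>+u. ennreal ((norm (y + h *\<^sub>R \<beta> y u))\<^sup>2 + h * G) \<partial>\<upsilon>)"
      unfolding G_def using pos by (intro nn_integral_cong nn_integral_gaussian_shift_square) auto
    also have "\<dots> \<le> (\<integral>\<^sup>+u. ennreal ((1 + \<eta>) * A + h * G) + ennreal (2 * h / \<tau>) * ennreal ((norm (\<beta> y u - b y))\<^sup>2) \<partial>\<upsilon>)"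
    proof (rule nn_integral_mono)
      fix u
      have "ennreal ((norm (y + h *\<^sub>R \<beta> y u))\<^sup>2 + h * G) \<le> ennreal (((1 + \<eta>) * A + h * G) + 2 * h / \<tau> * (norm (\<beta> y u - b y))\<^sup>2)"
        by (rule ennreal_leI[OF pt])
      also have "\<dots> = ennreal ((1 + \<eta>) * A + h * G) + ennreal (2 * h / \<tau>) * ennreal ((norm (\<beta> y u - b y))\<^sup>2)"
        using A G \<eta> pos by (intro ennreal_plus_mult k) auto
      finally show "ennreal ((norm (y + h *\<^sub>R \<beta> y u))\<^sup>2 + h * G) \<le> \<dots>" .
    qed
    also have "\<dots> = ennreal ((1 + \<eta>) * A + h * G) + ennreal (2 * h / \<tau>) * (\<integral>\<^sup>+u. ennreal ((norm (\<beta> y u - b y))\<^sup>2) \<partial>\<upsilon>)"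
      by (subst nn_integral_add) (auto simp: nn_integral_cmult V.emeasure_space_1)
    also have "\<dots> \<le> ennreal ((1 + \<eta>) * A + h * G) + ennreal (2 * h / \<tau>) * ennreal (\<sigma>\<^sup>2 * (1 + (norm y)\<^sup>2) * \<tau>\<^sup>2)"
      by (intro add_left_mono mult_left_mono var) auto
    also have "\<dots> = ennreal (((1 + \<eta>) * A + h * G) + 2 * h / \<tau> * (\<sigma>\<^sup>2 * (1 + (norm y)\<^sup>2) * \<tau>\<^sup>2))"
      using A G \<eta> pos by (intro ennreal_plus_mult[symmetric] k) auto
    also have "2 * h / \<tau> * (\<sigma>\<^sup>2 * (1 + (norm y)\<^sup>2) * \<tau>\<^sup>2) = 2 * h * \<tau> * \<sigma>\<^sup>2 * (1 + (norm y)\<^sup>2)"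
      using pos by (simp add: power2_eq_square)
    also have "ennreal (((1 + \<eta>) * A + h * G) + 2 * h * \<tau> * \<sigma>\<^sup>2 * (1 + (norm y)\<^sup>2))
        \<le> ennreal (h * E + (1 - K * h / 2) * (norm y)\<^sup>2)"
    proof (rule ennreal_leI)
      define Y where "Y = (norm y)\<^sup>2"
      have Y: "Y \<ge> 0" by (simp add: Y_def)
      have 1: "(1 + \<eta>) * A \<le> (1 + \<eta>) * ((1 - K * h) * Y + h * C)"
        unfolding Y_def using A \<eta> by (intro mult_left_mono) auto
      have "\<eta> * (h * C) \<le> 1 * (h * C)" using \<eta> pos by (intro mult_right_mono) auto
      moreover have "0 \<le> \<eta> * (K * h) * Y" using \<eta> pos Y by simp
      ultimately have 2: "(1 + \<eta>) * ((1 - K * h) * Y + h * C) \<le> (1 - K * h) * Y + \<eta> * Y + 2 * (h * C)"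
        by (simp add: algebra_simps)
      have 3: "(h * Y) * (\<tau> * (1 + 2 * \<sigma>\<^sup>2)) \<le> (h * Y) * (K / 2)"
        using \<tau>K pos Y by (intro mult_left_mono) auto
      have 4: "(h * \<sigma>\<^sup>2) * \<tau> \<le> (h * \<sigma>\<^sup>2) * 1" using pos by (intro mult_left_mono) auto
      show "((1 + \<eta>) * A + h * G) + 2 * h * \<tau> * \<sigma>\<^sup>2 * (1 + (norm y)\<^sup>2) \<le> h * E + (1 - K * h / 2) * (norm y)\<^sup>2"
        using 1 2 3 4 unfolding Y_def[symmetric] E_def \<eta>_def by (simp add: algebra_simps)
    qed
    also have "\<dots> = ennreal (h * E) + ennreal (1 - K * h / 2) * ennreal ((norm y)\<^sup>2)"
      using pos E Kh by (intro ennreal_plus_mult) auto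
    finally show "(\<integral>\<^sup>+u. \<integral>\<^sup>+z. ennreal ((norm (y + h *\<^sub>R \<beta> y u + sqrt h *\<^sub>R z))\<^sup>2) \<partial>gaussian 1 \<partial>\<upsilon>) \<le> \<dots>" .
  qed
  also have "\<dots> = ennreal (h * E) + ennreal (1 - K * h / 2) * (\<integral>\<^sup>+y. ennreal ((norm y)\<^sup>2) \<partial>\<nu>)"
    by (subst nn_integral_add) (auto simp: nn_integral_cmult N.emeasure_space_1)
  also have "\<dots> \<le> ennreal (h * E) + ennreal (1 - K * h / 2) * ennreal m"
    by (intro add_left_mono mult_left_mono mom) auto
  also have "\<dots> = ennreal (h * E + (1 - K * h / 2) * m)"
    using pos E Kh mom by (intro ennreal_plus_mult[symmetric]) auto
  finally show ?thesis unfolding E_def G_def by (simp add: add.commute)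
qed

section \<open>Laws of the chains\<close>

text \<open>A recursion on laws instead of random variables, so that the coupling can be built on
  its own space, whatever the joint law of the two chains on \<open>M\<close>. The exact chain is
  the instance \<open>\<lambda>x _. b x\<close>, with the same \<upsilon>.\<close>

primrec chain_law ::
  "real \<Rightarrow> (real ^ 'd \<Rightarrow> real ^ 'n \<Rightarrow> real ^ 'd) \<Rightarrow> (real ^ 'n) measure \<Rightarrow> (real ^ 'd) measure \<Rightarrow> nat \<Rightarrow> (real ^ 'd) measure"
where
  "chain_law h \<beta> \<upsilon> \<mu> 0 = \<mu>"
| "chain_law h \<beta> \<upsilon> \<mu> (Suc k) = step_law h \<beta> \<upsilon> (chain_law h \<beta> \<upsilon> \<mu> k)"

lemma sets_chain_law: "sets \<mu> = sets borel \<Longrightarrow> sets (chain_law h \<beta> \<upsilon> \<mu> k) = sets borel"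
  by (cases k) auto

lemma prob_space_chain_law:
  fixes \<beta> :: "real ^ 'd \<Rightarrow> real ^ 'n \<Rightarrow> real ^ 'd"
  assumes "(\<lambda>(x, u). \<beta> x u) \<in> borel_measurable (borel \<Otimes>\<^sub>M borel)"
    and "prob_space \<upsilon>" "sets \<upsilon> = sets borel" "prob_space \<mu>" "sets \<mu> = sets borel"
  shows "prob_space (chain_law h \<beta> \<upsilon> \<mu> k)"
  by (induction k) (use assms in \<open>auto intro!: prob_space_step_law sets_chain_law\<close>)

lemma diagonal_coupling:
  fixes \<mu> :: "(real ^ 'd) measure"
  assumes "sets \<mu> = sets borel"
  shows "distr \<mu> (borel \<Otimes>\<^sub>M borel) (\<lambda>x. (x, x)) \<in> couplings \<mu> \<mu>"
proof -
  note [measurable_cong] = assms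
  have "distr (distr \<mu> (borel \<Otimes>\<^sub>M borel) (\<lambda>x. (x, x))) borel fst = distr \<mu> borel (\<lambda>x. x)"
    "distr (distr \<mu> (borel \<Otimes>\<^sub>M borel) (\<lambda>x. (x, x))) borel snd = distr \<mu> borel (\<lambda>x. x)"
    by (subst distr_distr; simp add: comp_def)+
  moreover have "distr \<mu> borel (\<lambda>x. x) = \<mu>"
    using assms by (metis distr_id2)
  ultimately show ?thesis by (simp add: couplings_def)
qed

lemma affine_recursion_le:
  fixes \<theta> e x X :: real
  assumes "x \<le> X" "0 \<le> \<theta>" "\<theta> \<le> 1" "e \<le> \<theta> * X"
  shows "(1 - \<theta>) * x + e \<le> X"
proof -
  have "(1 - \<theta>) * x \<le> (1 - \<theta>) * X" using assms by (intro mult_left_mono) auto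
  then show ?thesis using assms by (simp add: algebra_simps)
qed

lemma lipschitz_borel_measurable:
  fixes b :: "'a::real_normed_vector \<Rightarrow> 'b::real_normed_vector"
  assumes "L \<ge> 0" "\<And>x y. norm (b x - b y) \<le> L * norm (x - y)"
  shows "b \<in> borel_measurable borel"
proof (rule borel_measurable_continuous_onI)
  have "L-lipschitz_on UNIV b" using assms by (intro lipschitz_onI) (auto simp: dist_norm)
  then show "continuous_on UNIV b" by (rule lipschitz_on_continuous_on)
qed

text \<open>Moments and expected costs both obey affine recursions with contraction rate of order h
  and source of order h, respectively h \<tau>; a bound preserved by one step is independent of h
  and k in the first case and proportional to \<tau> in the second. The constants precede h, \<beta>
  and \<upsilon>, so the estimator may vary with h.\<close>

lemma chain_laws_coupling:
  fixes b :: "real ^ 'd \<Rightarrow> real ^ 'd"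
  assumes pos: "L > 0" "K > 0" "R > 0" and \<alpha>: "\<alpha> > 0"
    and lip: "\<And>x y. norm (b x - b y) \<le> L * norm (x - y)"
    and diss: "\<And>x y. norm (x - y) > R \<Longrightarrow> (x - y) \<bullet> (b x - b y) \<le> - K * (norm (x - y))\<^sup>2"
    and \<mu>: "\<mu> \<in> P2"
  obtains a \<epsilon> h0 C :: real where "a > 0" "\<epsilon> > 0" "h0 > 0" "C > 0"
    "\<And>h \<beta> (\<upsilon> :: (real ^ 'n) measure) k. 0 < h \<Longrightarrow> h < h0 \<Longrightarrow>
      (\<lambda>(x, u). \<beta> x u) \<in> borel_measurable (borel \<Otimes>\<^sub>M borel) \<Longrightarrow>
      prob_space \<upsilon> \<Longrightarrow> sets \<upsilon> = sets borel \<Longrightarrow>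
      (\<And>x. (\<integral>\<^sup>+u. ennreal ((norm (\<beta> x u - b x))\<^sup>2) \<partial>\<upsilon>) \<le> ennreal (\<sigma>\<^sup>2 * (1 + (norm x)\<^sup>2) * h powr \<alpha>)) \<Longrightarrow>
      \<exists>\<gamma> \<in> couplings (chain_law h (\<lambda>x _. b x) \<upsilon> \<mu> k) (chain_law h \<beta> \<upsilon> \<mu> k).
        expected_cost a \<epsilon> \<gamma> \<le> ennreal (C * h powr (\<alpha> / 2))"
proof (rule euler_contraction[OF pos lip diss])
  fix a \<epsilon> c h1 :: real
  assume ac: "a > 0" "\<epsilon> > 0" "c > 0" "h1 > 0" "c * h1 \<le> 1"
    and contr: "\<And>h x y. 0 < h \<Longrightarrow> h < h1 \<Longrightarrow>
      coupled_euler_cost a \<epsilon> h b x y \<le> ennreal ((1 - c * h) * cost a \<epsilon> (norm (x - y)))"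
  have \<mu>': "prob_space \<mu>" "sets \<mu> = sets borel" "integrable \<mu> (\<lambda>x. (norm x)\<^sup>2)"
    using \<mu> by (auto simp: P2_def)
  have b: "b \<in> borel_measurable borel"
    by (rule lipschitz_borel_measurable[of L]) (use pos lip in auto)
  define Cd where "Cd = 2 * ((K + L) * R\<^sup>2 + (norm (b 0))\<^sup>2 / K) + 2 * (norm (b 0))\<^sup>2"
  have Cd: "Cd \<ge> 0" using pos by (simp add: Cd_def)
  define E where "E = 2 * Cd + 2 * \<sigma>\<^sup>2 + (\<integral>z. (norm z)\<^sup>2 \<partial>(gaussian 1 :: (real ^ 'd) measure))"
  have E: "E \<ge> 0" using Cd by (simp add: E_def)
  define m0 where "m0 = (\<integral>x. (norm x)\<^sup>2 \<partial>\<mu>)"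
  \<comment> \<open>2 E / K is the fixed point of the moment recursion; adding the initial moment
    makes \<open>m\<close> a bound at time 0 that every step preserves.\<close>
  define m where "m = m0 + 2 * E / K"
  have m0: "m0 \<ge> 0" by (simp add: m0_def)
  have m: "m \<ge> 0" "m0 \<le> m" using m0 E pos by (simp_all add: m_def)
  have mE: "E \<le> K / 2 * m" using m0 E pos by (simp add: m_def field_simps)
  define B where "B = a + (a + 2 * \<epsilon>) * \<sigma>\<^sup>2"
  have B: "B > 0" unfolding B_def using ac by (intro add_pos_nonneg) auto
  \<comment> \<open>Chosen so that C \<tau> is the fixed point of the cost recursion: c h / 2 times
    C \<tau> equals the source h \<tau> B (1 + m).\<close>
  define C where "C = 2 * B * (1 + m) / c"
  have C: "C > 0" unfolding C_def using B m ac by (intro divide_pos_pos mult_pos_pos) auto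
  \<comment> \<open>An upper limit for \<tau> = h^(\<alpha>/2); the entries ensure \<tau> <= 1, 2
    \<tau> <= c and \<tau> (1 + 2 \<sigma>^2) <= K/2. In \<open>h0\<close> it appears with exponent
    2 / \<alpha>.\<close>
  define t0 where "t0 = min 1 (min (c / 2) (K / 2 / (1 + 2 * \<sigma>\<^sup>2)))"
  have d: "1 + 2 * \<sigma>\<^sup>2 > 0" by (rule add_pos_nonneg) auto
  have t0: "t0 > 0" using ac pos d by (simp add: t0_def)
  define h0 where "h0 = Min {h1, 1, K / (4 * L\<^sup>2), 1 / K, t0 powr (2 / \<alpha>)}"
  have h0: "h0 > 0" using ac pos t0 by (simp add: h0_def)
  show ?thesis
  proof (rule that[OF ac(1,2) h0 C])
    fix h k and \<beta> :: "real ^ 'd \<Rightarrow> real ^ 'n \<Rightarrow> real ^ 'd" and \<upsilon> :: "(real ^ 'n) measure"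
    assume h: "0 < h" "h < h0"
      and \<beta>: "(\<lambda>(x, u). \<beta> x u) \<in> borel_measurable (borel \<Otimes>\<^sub>M borel)"
      and \<upsilon>: "prob_space \<upsilon>" "sets \<upsilon> = sets borel"
      and var0: "\<And>x. (\<integral>\<^sup>+u. ennreal ((norm (\<beta> x u - b x))\<^sup>2) \<partial>\<upsilon>) \<le> ennreal (\<sigma>\<^sup>2 * (1 + (norm x)\<^sup>2) * h powr \<alpha>)"
    have hl: "h < h1" "h < 1" "h < K / (4 * L\<^sup>2)" "h < 1 / K" "h < t0 powr (2 / \<alpha>)"
      using h(2) by (simp_all add: h0_def)
    have L4: "4 * L\<^sup>2 > 0" using pos by simp
    have Lh: "4 * L\<^sup>2 * h \<le> K" using hl(3) unfolding pos_less_divide_eq[OF L4] by (simp add: mult.commute)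
    have Kh: "K * h \<le> 1" using hl(4) unfolding pos_less_divide_eq[OF pos(2)] by (simp add: mult.commute)
    have "c * h \<le> c * h1" using hl ac by (intro mult_left_mono) auto
    then have ch: "c * h \<le> 1" using ac by linarith
    define \<tau> where "\<tau> = h powr (\<alpha> / 2)"
    have \<tau>: "\<tau> > 0" using h by (simp add: \<tau>_def)
    have "\<tau> \<le> (t0 powr (2 / \<alpha>)) powr (\<alpha> / 2)"
      unfolding \<tau>_def using hl(5) h \<alpha> by (intro powr_mono2) auto
    also have "\<dots> = t0" using \<alpha> t0 by (simp add: powr_powr)
    finally have \<tau>t: "\<tau> \<le> t0" .
    then have \<tau>1: "\<tau> \<le> 1" and \<tau>c: "2 * \<tau> \<le> c" and "\<tau> \<le> K / 2 / (1 + 2 * \<sigma>\<^sup>2)"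
      by (auto simp: t0_def)
    then have \<tau>K: "\<tau> * (1 + 2 * \<sigma>\<^sup>2) \<le> K / 2" unfolding pos_le_divide_eq[OF d] by simp
    have h\<tau>: "h * \<tau> \<le> 1" using mult_mono[of h 1 \<tau> 1] hl \<tau> \<tau>1 h by auto
    have "h powr \<alpha> = \<tau>\<^sup>2"
      unfolding \<tau>_def power2_eq_square powr_add[symmetric] by simp
    with var0 have var: "(\<integral>\<^sup>+u. ennreal ((norm (\<beta> x u - b x))\<^sup>2) \<partial>\<upsilon>) \<le> ennreal (\<sigma>\<^sup>2 * (1 + (norm x)\<^sup>2) * \<tau>\<^sup>2)" for x
      by simp
    have drift: "(norm (euler_step h b y))\<^sup>2 \<le> (1 - K * h) * (norm y)\<^sup>2 + h * Cd" for y
      unfolding Cd_def using hl Lh h by (intro norm_euler_step_square_le[OF pos lip diss]) auto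
    let ?X = "chain_law h (\<lambda>x _. b x) \<upsilon> \<mu>" and ?Y = "chain_law h \<beta> \<upsilon> \<mu>"
    have \<beta>b: "(\<lambda>(x, u :: real ^ 'n). b x) \<in> borel_measurable (borel \<Otimes>\<^sub>M borel)"
      using b by measurable
    have mom: "(\<integral>\<^sup>+y. ennreal ((norm y)\<^sup>2) \<partial>?Y k) \<le> ennreal m" for k
    proof (induction k)
      case 0
      have "(\<integral>\<^sup>+y. ennreal ((norm y)\<^sup>2) \<partial>\<mu>) = ennreal m0"
        unfolding m0_def by (rule nn_integral_eq_integral[OF \<mu>'(3)]) auto
      then show ?case using m by (simp add: ennreal_leI)
    next
      case (Suc k)
      have "(\<integral>\<^sup>+y. ennreal ((norm y)\<^sup>2) \<partial>?Y (Suc k)) \<le> ennreal ((1 - K * h / 2) * m + h * E)"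
        unfolding chain_law.simps E_def
        by (rule step_law_second_moment_le[OF h(1) \<tau> \<tau>1 _ pos(2) Cd Kh \<tau>K drift \<beta> b \<upsilon> _ _ var Suc.IH m(1)])
          (use hl \<mu>' in \<open>auto intro!: sets_chain_law prob_space_chain_law \<beta> \<upsilon>\<close>)
      also have "\<dots> \<le> ennreal m"
        using mult_left_mono[OF mE, of h] h pos Kh
        by (intro ennreal_leI affine_recursion_le) (auto simp: algebra_simps)
      finally show ?case .
    qed
    have "\<exists>\<gamma> \<in> couplings (?X k) (?Y k).
        expected_cost a \<epsilon> \<gamma> \<le> ennreal (C * \<tau>)" for k
    proof (induction k)
      \<comment> \<open>Both chains have the same initial law, so the diagonal coupling starts the
        recursion at cost 0.\<close>
      case 0
      note [measurable_cong] = \<mu>'(2)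
      let ?\<gamma> = "distr \<mu> (borel \<Otimes>\<^sub>M borel) (\<lambda>x. (x, x))"
      have "expected_cost a \<epsilon> ?\<gamma> = 0"
        by (subst nn_integral_distr) auto
      then show ?case
        using diagonal_coupling[OF \<mu>'(2)] by (intro bexI[of _ ?\<gamma>]) auto
    next
      case (Suc k)
      then obtain \<gamma> where \<gamma>: "\<gamma> \<in> couplings (?X k) (?Y k)"
        and S: "expected_cost a \<epsilon> \<gamma> \<le> ennreal (C * \<tau>)"
        by blast
      have pX: "prob_space (?X k)" by (rule prob_space_chain_law[OF \<beta>b \<upsilon> \<mu>'(1,2)])
      have sX: "sets (?X k) = sets borel" "sets (?Y k) = sets borel"
        by (rule sets_chain_law[OF \<mu>'(2)])+
      let ?\<gamma> = "distr (\<gamma> \<Otimes>\<^sub>M (\<upsilon> \<Otimes>\<^sub>M pair_noise)) (borel \<Otimes>\<^sub>M borel) (coupled_step h b \<beta>)"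
      have C\<tau>: "0 \<le> C * \<tau>" using C \<tau> by simp
      have "expected_cost a \<epsilon> ?\<gamma>
          \<le> ennreal ((1 - c * h / 2) * (C * \<tau>) + h * \<tau> * B * (1 + m))"
        unfolding B_def
        by (rule coupled_step_expected_cost_le[OF ac(1,2) h(1) \<tau> h\<tau> ac(3) ch \<tau>c contr[OF h(1) hl(1)] \<beta> b \<upsilon> \<gamma> pX var mom m(1) S C\<tau>])
      also have "\<dots> \<le> ennreal (C * \<tau>)"
      proof (intro ennreal_leI affine_recursion_le)
        have "c * C = 2 * B * (1 + m)" using ac by (simp add: C_def)
        moreover have "c * h / 2 * (C * \<tau>) = h * \<tau> / 2 * (c * C)" by simp
        ultimately have eq: "c * h / 2 * (C * \<tau>) = h * \<tau> / 2 * (2 * B * (1 + m))" by (simp only:)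
        show "h * \<tau> * B * (1 + m) \<le> c * h / 2 * (C * \<tau>)" unfolding eq by simp
      qed (use ac h ch in auto)
      finally have "expected_cost a \<epsilon> ?\<gamma> \<le> ennreal (C * \<tau>)" .
      moreover have "?\<gamma> \<in> couplings (?X (Suc k)) (?Y (Suc k))"
        unfolding chain_law.simps by (rule coupled_step_couplings[OF \<beta> b \<upsilon> \<gamma> sX])
      ultimately show ?case by blast
    qed
    then show "\<exists>\<gamma> \<in> couplings (?X k) (?Y k).
        expected_cost a \<epsilon> \<gamma> \<le> ennreal (C * h powr (\<alpha> / 2))"
      unfolding \<tau>_def .
  qed
qed

section \<open>Independence: from random variables to iterated step laws\<close>

lemma independent_rvs_joint_law:
  assumes M: "prob_space M" and ind: "independent_rvs M A X B Y"
  shows "distr M (A \<Otimes>\<^sub>M B) (\<lambda>\<omega>. (X \<omega>, Y \<omega>)) = distr M A X \<Otimes>\<^sub>M distr M B Y"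
proof -
  interpret prob_space M by fact
  have X[measurable]: "X \<in> M \<rightarrow>\<^sub>M A" and Y[measurable]: "Y \<in> M \<rightarrow>\<^sub>M B"
    and i: "indep_set {X -` S \<inter> space M | S. S \<in> sets A} {Y -` S \<inter> space M | S. S \<in> sets B}"
    using ind by (auto simp: independent_rvs_def)
  show ?thesis
  proof (rule pair_measure_eqI[symmetric])
    show "sigma_finite_measure (distr M A X)" "sigma_finite_measure (distr M B Y)"
      using prob_space_distr[OF X] prob_space_distr[OF Y] by (simp_all add: prob_space_imp_sigma_finite)
    fix S T assume "S \<in> sets (distr M A X)" "T \<in> sets (distr M B Y)"
    then have [measurable]: "S \<in> sets A" "T \<in> sets B" by auto
    have "prob ((X -` S \<inter> space M) \<inter> (Y -` T \<inter> space M)) = prob (X -` S \<inter> space M) * prob (Y -` T \<inter> space M)"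
      by (rule indep_setD[OF i]) auto
    moreover have "(\<lambda>\<omega>. (X \<omega>, Y \<omega>)) -` (S \<times> T) \<inter> space M = (X -` S \<inter> space M) \<inter> (Y -` T \<inter> space M)"
      by auto
    ultimately show "emeasure (distr M A X) S * emeasure (distr M B Y) T
        = emeasure (distr M (A \<Otimes>\<^sub>M B) (\<lambda>\<omega>. (X \<omega>, Y \<omega>))) (S \<times> T)"
      by (simp add: emeasure_distr emeasure_eq_measure ennreal_mult)
  qed simp
qed

lemma nn_integral_PiM_nat:
  fixes P :: "'p measure"
  assumes P: "prob_space P" and H[measurable]: "H \<in> borel_measurable (Pi\<^sub>M (UNIV :: nat set) (\<lambda>_. P))"
  shows "(\<integral>\<^sup>+g. H g \<partial>Pi\<^sub>M (UNIV :: nat set) (\<lambda>_. P)) = (\<integral>\<^sup>+p. \<integral>\<^sup>+g. H (case_nat p g) \<partial>Pi\<^sub>M UNIV (\<lambda>_. P) \<partial>P)"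
proof -
  interpret P: prob_space P by fact
  interpret S: sequence_space P ..
  have "(\<integral>\<^sup>+g. H g \<partial>Pi\<^sub>M (UNIV :: nat set) (\<lambda>_. P))
      = (\<integral>\<^sup>+g. H g \<partial>distr (P \<Otimes>\<^sub>M Pi\<^sub>M UNIV (\<lambda>_. P)) (Pi\<^sub>M UNIV (\<lambda>_. P)) (\<lambda>(p, g). case_nat p g))"
    by (subst S.PiM_iter) simp
  also have "\<dots> = (\<integral>\<^sup>+q. H (case_nat (fst q) (snd q)) \<partial>(P \<Otimes>\<^sub>M Pi\<^sub>M UNIV (\<lambda>_. P)))"
    by (subst nn_integral_distr) (auto simp: case_prod_beta')
  also have "\<dots> = (\<integral>\<^sup>+p. \<integral>\<^sup>+g. H (case_nat p g) \<partial>Pi\<^sub>M UNIV (\<lambda>_. P) \<partial>P)"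
    by (subst S.nn_integral_fst[symmetric]) auto
  finally show ?thesis .
qed

lemma shift_Suc_measurable:
  "(\<lambda>g j. g (Suc j)) \<in> Pi\<^sub>M (UNIV :: nat set) (\<lambda>_. P) \<rightarrow>\<^sub>M Pi\<^sub>M (UNIV :: nat set) (\<lambda>_. P)"
  by (rule measurable_abs_UNIV) measurable

text \<open>For indicators this says that the first terms of two independent i.i.d. sequences are
  independent of the shifted sequences, and that these have the original laws. It is proved by
  splitting off one coordinate of each sequence in turn.\<close>

lemma nn_integral_PiM_nat_pair:
  fixes P :: "'p measure" and Q :: "'q measure"
  assumes P: "prob_space P" and Q: "prob_space Q"
    and \<phi>: "case_prod \<phi> \<in> borel_measurable (P \<Otimes>\<^sub>M Q)"
    and \<psi>: "case_prod \<psi> \<in> borel_measurable (Pi\<^sub>M (UNIV :: nat set) (\<lambda>_. P) \<Otimes>\<^sub>M Pi\<^sub>M (UNIV :: nat set) (\<lambda>_. Q))"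
  shows "(\<integral>\<^sup>+g. \<integral>\<^sup>+u. \<phi> (g 0) (u 0) * \<psi> (\<lambda>j. g (Suc j)) (\<lambda>j. u (Suc j)) \<partial>Pi\<^sub>M UNIV (\<lambda>_. Q) \<partial>Pi\<^sub>M UNIV (\<lambda>_. P))
    = (\<integral>\<^sup>+p. \<integral>\<^sup>+q. \<phi> p q \<partial>Q \<partial>P) * (\<integral>\<^sup>+g. \<integral>\<^sup>+u. \<psi> g u \<partial>Pi\<^sub>M UNIV (\<lambda>_. Q) \<partial>Pi\<^sub>M UNIV (\<lambda>_. P))"
proof -
  interpret P: prob_space P by fact
  interpret Q: prob_space Q by fact
  interpret S: sequence_space P ..
  interpret T: sequence_space Q ..
  let ?S = "Pi\<^sub>M (UNIV :: nat set) (\<lambda>_. P)" and ?T = "Pi\<^sub>M (UNIV :: nat set) (\<lambda>_. Q)"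
  have \<phi>1: "(\<lambda>q. \<phi> p q) \<in> borel_measurable Q" if "p \<in> space P" for p
    using measurable_compose[OF measurable_Pair1'[OF that] \<phi>] by simp
  have \<psi>1: "(\<lambda>u. \<psi> g u) \<in> borel_measurable ?T" if "g \<in> space ?S" for g
    using measurable_compose[OF measurable_Pair1'[OF that] \<psi>] by simp
  have \<phi>2: "(\<lambda>p. \<integral>\<^sup>+q. \<phi> p q \<partial>Q) \<in> borel_measurable P"
    by (rule Q.borel_measurable_nn_integral[OF \<phi>])
  have \<psi>2: "(\<lambda>g. \<integral>\<^sup>+u. \<psi> g u \<partial>?T) \<in> borel_measurable ?S"
    by (rule T.borel_measurable_nn_integral[OF \<psi>])
  have 1: "(\<integral>\<^sup>+u. \<phi> p (u 0) * \<psi> g (\<lambda>j. u (Suc j)) \<partial>?T) = (\<integral>\<^sup>+q. \<phi> p q \<partial>Q) * (\<integral>\<^sup>+u. \<psi> g u \<partial>?T)"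
    if p: "p \<in> space P" and g: "g \<in> space ?S" for p g
  proof -
    have m0: "(\<lambda>u. \<phi> p (u 0)) \<in> borel_measurable ?T"
      by (rule measurable_compose[OF _ \<phi>1[OF p]]) measurable
    have mS: "(\<lambda>u. \<psi> g (\<lambda>j. u (Suc j))) \<in> borel_measurable ?T"
      by (rule measurable_compose[OF shift_Suc_measurable \<psi>1[OF g]])
    have "(\<integral>\<^sup>+u. \<phi> p (u 0) * \<psi> g (\<lambda>j. u (Suc j)) \<partial>?T) = (\<integral>\<^sup>+q. \<integral>\<^sup>+u. \<phi> p q * \<psi> g u \<partial>?T \<partial>Q)"
      using nn_integral_PiM_nat[OF Q borel_measurable_times_ennreal[OF m0 mS]] by simp
    also have "\<dots> = (\<integral>\<^sup>+q. \<phi> p q * (\<integral>\<^sup>+u. \<psi> g u \<partial>?T) \<partial>Q)"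
      by (rule nn_integral_cong, rule nn_integral_cmult[OF \<psi>1[OF g]])
    also have "\<dots> = (\<integral>\<^sup>+q. \<phi> p q \<partial>Q) * (\<integral>\<^sup>+u. \<psi> g u \<partial>?T)"
      by (rule nn_integral_multc[OF \<phi>1[OF p]])
    finally show ?thesis .
  qed
  have m0: "(\<lambda>g. \<integral>\<^sup>+q. \<phi> (g 0) q \<partial>Q) \<in> borel_measurable ?S"
    by (rule measurable_compose[OF _ \<phi>2]) measurable
  have mS: "(\<lambda>g. \<integral>\<^sup>+u. \<psi> (\<lambda>j. g (Suc j)) u \<partial>?T) \<in> borel_measurable ?S"
    by (rule measurable_compose[OF shift_Suc_measurable \<psi>2])
  have "(\<integral>\<^sup>+g. \<integral>\<^sup>+u. \<phi> (g 0) (u 0) * \<psi> (\<lambda>j. g (Suc j)) (\<lambda>j. u (Suc j)) \<partial>?T \<partial>?S)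
      = (\<integral>\<^sup>+g. (\<integral>\<^sup>+q. \<phi> (g 0) q \<partial>Q) * (\<integral>\<^sup>+u. \<psi> (\<lambda>j. g (Suc j)) u \<partial>?T) \<partial>?S)"
    by (intro nn_integral_cong 1) (auto simp: space_PiM PiE_iff)
  also have "\<dots> = (\<integral>\<^sup>+p. \<integral>\<^sup>+g. (\<integral>\<^sup>+q. \<phi> p q \<partial>Q) * (\<integral>\<^sup>+u. \<psi> g u \<partial>?T) \<partial>?S \<partial>P)"
    using nn_integral_PiM_nat[OF P borel_measurable_times_ennreal[OF m0 mS]] by simp
  also have "\<dots> = (\<integral>\<^sup>+p. (\<integral>\<^sup>+q. \<phi> p q \<partial>Q) * (\<integral>\<^sup>+g. \<integral>\<^sup>+u. \<psi> g u \<partial>?T \<partial>?S) \<partial>P)"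
    by (rule nn_integral_cong, rule nn_integral_cmult[OF \<psi>2])
  also have "\<dots> = (\<integral>\<^sup>+p. \<integral>\<^sup>+q. \<phi> p q \<partial>Q \<partial>P) * (\<integral>\<^sup>+g. \<integral>\<^sup>+u. \<psi> g u \<partial>?T \<partial>?S)"
    by (rule nn_integral_multc[OF \<phi>2])
  finally show ?thesis .
qed

lemma consume_noise_measurable:
  fixes \<nu> :: "'x measure" and P :: "'p measure" and Q :: "'q measure" and Y :: "'y measure"
  assumes f: "f \<in> \<nu> \<Otimes>\<^sub>M (Q \<Otimes>\<^sub>M P) \<rightarrow>\<^sub>M Y"
  defines "N \<equiv> Pi\<^sub>M (UNIV :: nat set) (\<lambda>_. P) \<Otimes>\<^sub>M Pi\<^sub>M (UNIV :: nat set) (\<lambda>_. Q)"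
  shows "(\<lambda>(x, g, u). (f (x, u 0, g 0), (\<lambda>j. g (Suc j)), (\<lambda>j. u (Suc j)))) \<in> \<nu> \<Otimes>\<^sub>M N \<rightarrow>\<^sub>M Y \<Otimes>\<^sub>M N"
proof -
  let ?S = "Pi\<^sub>M (UNIV :: nat set) (\<lambda>_. P)" and ?T = "Pi\<^sub>M (UNIV :: nat set) (\<lambda>_. Q)"
  have 1: "(\<lambda>y. (fst y, snd (snd y) 0, fst (snd y) 0)) \<in> \<nu> \<Otimes>\<^sub>M (?S \<Otimes>\<^sub>M ?T) \<rightarrow>\<^sub>M \<nu> \<Otimes>\<^sub>M (Q \<Otimes>\<^sub>M P)"
    by measurable
  have 2: "(\<lambda>y. (\<lambda>j. fst (snd y) (Suc j))) \<in> \<nu> \<Otimes>\<^sub>M (?S \<Otimes>\<^sub>M ?T) \<rightarrow>\<^sub>M ?S"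
    by (rule measurable_abs_UNIV) measurable
  have 3: "(\<lambda>y. (\<lambda>j. snd (snd y) (Suc j))) \<in> \<nu> \<Otimes>\<^sub>M (?S \<Otimes>\<^sub>M ?T) \<rightarrow>\<^sub>M ?T"
    by (rule measurable_abs_UNIV) measurable
  show ?thesis
    unfolding N_def case_prod_beta'
    by (intro measurable_Pair 2 3 measurable_compose[OF 1 f])
qed

text \<open>The Markov property in product form: using the first noise of each sequence and shifting
  leaves a new state independent of noise with the same law as before. It is enough to compare
  rectangles, on which the integral factorises by \<open>nn_integral_PiM_nat_pair\<close>.\<close>

lemma distr_consume_noise:
  fixes \<nu> :: "'x measure" and P :: "'p measure" and Q :: "'q measure" and Y :: "'y measure"
  assumes P: "prob_space P" and Q: "prob_space Q" and \<nu>: "prob_space \<nu>"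
    and f[measurable]: "f \<in> \<nu> \<Otimes>\<^sub>M (Q \<Otimes>\<^sub>M P) \<rightarrow>\<^sub>M Y"
  defines "N \<equiv> Pi\<^sub>M (UNIV :: nat set) (\<lambda>_. P) \<Otimes>\<^sub>M Pi\<^sub>M (UNIV :: nat set) (\<lambda>_. Q)"
  shows "distr (\<nu> \<Otimes>\<^sub>M N) (Y \<Otimes>\<^sub>M N) (\<lambda>(x, g, u). (f (x, u 0, g 0), (\<lambda>j. g (Suc j)), (\<lambda>j. u (Suc j))))
    = distr (\<nu> \<Otimes>\<^sub>M (Q \<Otimes>\<^sub>M P)) Y f \<Otimes>\<^sub>M N" (is "distr _ _ ?\<Psi> = _")
proof (rule pair_measure_eqI[symmetric])
  interpret P: prob_space P by fact
  interpret Q: prob_space Q by fact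
  interpret \<nu>: prob_space \<nu> by fact
  interpret S: sequence_space P ..
  interpret T: sequence_space Q ..
  let ?S = "Pi\<^sub>M (UNIV :: nat set) (\<lambda>_. P)" and ?T = "Pi\<^sub>M (UNIV :: nat set) (\<lambda>_. Q)"
  interpret ST: pair_prob_space ?S ?T ..
  interpret QP: pair_prob_space Q P ..
  interpret PQ: pair_sigma_finite P Q ..
  interpret \<nu>QP: pair_prob_space \<nu> "Q \<Otimes>\<^sub>M P" ..
  show "sigma_finite_measure (distr (\<nu> \<Otimes>\<^sub>M (Q \<Otimes>\<^sub>M P)) Y f)"
    using \<nu>QP.prob_space_distr[OF f] by (simp add: prob_space_imp_sigma_finite)
  show "sigma_finite_measure N"
    unfolding N_def by (rule ST.sigma_finite_measure_axioms)
  show "sets (distr (\<nu> \<Otimes>\<^sub>M (Q \<Otimes>\<^sub>M P)) Y f \<Otimes>\<^sub>M N) = sets (distr (\<nu> \<Otimes>\<^sub>M N) (Y \<Otimes>\<^sub>M N) ?\<Psi>)"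
    by (simp cong: sets_pair_measure_cong)
  have \<Psi>: "?\<Psi> \<in> \<nu> \<Otimes>\<^sub>M N \<rightarrow>\<^sub>M Y \<Otimes>\<^sub>M N"
    unfolding N_def by (rule consume_noise_measurable[OF f])
  fix A D assume "A \<in> sets (distr (\<nu> \<Otimes>\<^sub>M (Q \<Otimes>\<^sub>M P)) Y f)" and D: "D \<in> sets N"
  then have A[measurable]: "A \<in> sets Y" by simp
  have D'[measurable]: "D \<in> sets (?S \<Otimes>\<^sub>M ?T)" using D by (simp add: N_def)
  note fA = measurable_compose[OF f borel_measurable_indicator[OF A]]
  have AD: "A \<times> D \<in> sets (Y \<Otimes>\<^sub>M N)" by (rule pair_measureI[OF A D])
  let ?F = "\<lambda>x q p. indicator A (f (x, q, p)) :: ennreal"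
  let ?I = "\<lambda>g u. indicator D (g, u) :: ennreal"
  define H where "H y = ?F (fst y) (snd (snd y) 0) (fst (snd y) 0) * ?I (\<lambda>j. fst (snd y) (Suc j)) (\<lambda>j. snd (snd y) (Suc j))" for y
  have \<Psi>H: "indicator (A \<times> D) (?\<Psi> y) = H y" for y
    unfolding H_def case_prod_beta' indicator_times fst_conv snd_conv ..
  have "(\<lambda>y. indicator (A \<times> D) (?\<Psi> y) :: ennreal) \<in> borel_measurable (\<nu> \<Otimes>\<^sub>M N)"
    by (rule measurable_compose[OF \<Psi> borel_measurable_indicator[OF AD]])
  then have Hm: "H \<in> borel_measurable (\<nu> \<Otimes>\<^sub>M (?S \<Otimes>\<^sub>M ?T))"
    unfolding \<Psi>H N_def .
  have "emeasure (distr (\<nu> \<Otimes>\<^sub>M N) (Y \<Otimes>\<^sub>M N) ?\<Psi>) (A \<times> D) = (\<integral>\<^sup>+y. indicator (A \<times> D) y \<partial>distr (\<nu> \<Otimes>\<^sub>M N) (Y \<Otimes>\<^sub>M N) ?\<Psi>)"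
    by (rule nn_integral_indicator[symmetric]) (simp only: sets_distr AD)
  also have "\<dots> = (\<integral>\<^sup>+y. indicator (A \<times> D) (?\<Psi> y) \<partial>(\<nu> \<Otimes>\<^sub>M N))"
    by (rule nn_integral_distr[OF \<Psi>]) (rule borel_measurable_indicator, simp only: sets_distr AD)
  also have "\<dots> = (\<integral>\<^sup>+y. H y \<partial>(\<nu> \<Otimes>\<^sub>M (?S \<Otimes>\<^sub>M ?T)))"
    unfolding \<Psi>H N_def ..
  also have "\<dots> = (\<integral>\<^sup>+x. \<integral>\<^sup>+r. H (x, r) \<partial>(?S \<Otimes>\<^sub>M ?T) \<partial>\<nu>)"
    by (rule ST.nn_integral_fst[OF Hm, symmetric])
  also have "\<dots> = (\<integral>\<^sup>+x. \<integral>\<^sup>+g. \<integral>\<^sup>+u. H (x, g, u) \<partial>?T \<partial>?S \<partial>\<nu>)"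
    by (rule nn_integral_cong, rule T.nn_integral_fst[symmetric], rule measurable_compose[OF measurable_Pair1' Hm])
  also have "\<dots> = (\<integral>\<^sup>+x. \<integral>\<^sup>+g. \<integral>\<^sup>+u. ?F x (u 0) (g 0) * ?I (\<lambda>j. g (Suc j)) (\<lambda>j. u (Suc j)) \<partial>?T \<partial>?S \<partial>\<nu>)"
    by (simp only: H_def fst_conv snd_conv)
  also have "\<dots> = (\<integral>\<^sup>+x. (\<integral>\<^sup>+q. \<integral>\<^sup>+p. ?F x q p \<partial>P \<partial>Q) * emeasure N D \<partial>\<nu>)"
  proof (rule nn_integral_cong)
    fix x assume x: "x \<in> space \<nu>"
    have fx: "(\<lambda>r. f (x, r)) \<in> Q \<Otimes>\<^sub>M P \<rightarrow>\<^sub>M Y"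
      by (rule measurable_compose[OF measurable_Pair1'[OF x] f])
    have Fm: "case_prod (?F x) \<in> borel_measurable (Q \<Otimes>\<^sub>M P)"
    proof -
      have "case_prod (?F x) = (\<lambda>r. indicator A (f (x, r)))" by (rule ext) (simp only: split_beta prod.collapse)
      then show ?thesis using measurable_compose[OF fx borel_measurable_indicator[OF A]] by (simp only:)
    qed
    have Fm': "(\<lambda>(p, q). ?F x q p) \<in> borel_measurable (P \<Otimes>\<^sub>M Q)"
    proof -
      have "(\<lambda>(p, q). ?F x q p) = (\<lambda>r. case_prod (?F x) (case r of (p, q) \<Rightarrow> (q, p)))" by (rule ext) (simp only: split_beta fst_conv snd_conv)
      then show ?thesis using measurable_compose[OF measurable_pair_swap' Fm] by (simp only:)
    qed
    have Im: "case_prod ?I \<in> borel_measurable (?S \<Otimes>\<^sub>M ?T)"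
    proof -
      have "case_prod ?I = indicator D" by (rule ext) (simp only: split_beta prod.collapse)
      then show ?thesis using borel_measurable_indicator[OF D'] by (simp only:)
    qed
    have "(\<integral>\<^sup>+g. \<integral>\<^sup>+u. ?F x (u 0) (g 0) * ?I (\<lambda>j. g (Suc j)) (\<lambda>j. u (Suc j)) \<partial>?T \<partial>?S)
        = (\<integral>\<^sup>+p. \<integral>\<^sup>+q. ?F x q p \<partial>Q \<partial>P) * (\<integral>\<^sup>+g. \<integral>\<^sup>+u. ?I g u \<partial>?T \<partial>?S)"
      by (rule nn_integral_PiM_nat_pair[OF P Q Fm' Im])
    also have "(\<integral>\<^sup>+p. \<integral>\<^sup>+q. ?F x q p \<partial>Q \<partial>P) = (\<integral>\<^sup>+q. \<integral>\<^sup>+p. ?F x q p \<partial>P \<partial>Q)"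
      by (rule PQ.Fubini'[OF Fm', symmetric])
    also have "(\<integral>\<^sup>+g. \<integral>\<^sup>+u. ?I g u \<partial>?T \<partial>?S) = emeasure N D"
      unfolding N_def by (rule T.emeasure_pair_measure[OF D', symmetric])
    finally show "(\<integral>\<^sup>+g. \<integral>\<^sup>+u. ?F x (u 0) (g 0) * ?I (\<lambda>j. g (Suc j)) (\<lambda>j. u (Suc j)) \<partial>?T \<partial>?S)
        = (\<integral>\<^sup>+q. \<integral>\<^sup>+p. ?F x q p \<partial>P \<partial>Q) * emeasure N D" .
  qed
  also have "\<dots> = (\<integral>\<^sup>+x. (\<integral>\<^sup>+r. indicator A (f (x, r)) \<partial>(Q \<Otimes>\<^sub>M P)) * emeasure N D \<partial>\<nu>)"
  proof (rule nn_integral_cong)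
    fix x assume x: "x \<in> space \<nu>"
    have fx: "(\<lambda>r. f (x, r)) \<in> Q \<Otimes>\<^sub>M P \<rightarrow>\<^sub>M Y"
      by (rule measurable_compose[OF measurable_Pair1'[OF x] f])
    have "(\<integral>\<^sup>+q. \<integral>\<^sup>+p. ?F x q p \<partial>P \<partial>Q) = (\<integral>\<^sup>+r. indicator A (f (x, r)) \<partial>(Q \<Otimes>\<^sub>M P))"
      using P.nn_integral_fst[OF measurable_compose[OF fx borel_measurable_indicator[OF A]]] .
    then show "(\<integral>\<^sup>+q. \<integral>\<^sup>+p. ?F x q p \<partial>P \<partial>Q) * emeasure N D = (\<integral>\<^sup>+r. indicator A (f (x, r)) \<partial>(Q \<Otimes>\<^sub>M P)) * emeasure N D"
      by (simp only:)
  qed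
  also have "\<dots> = (\<integral>\<^sup>+x. \<integral>\<^sup>+r. indicator A (f (x, r)) \<partial>(Q \<Otimes>\<^sub>M P) \<partial>\<nu>) * emeasure N D"
    using nn_integral_multc[OF QP.borel_measurable_nn_integral_fst[OF fA]] .
  also have "(\<integral>\<^sup>+x. \<integral>\<^sup>+r. indicator A (f (x, r)) \<partial>(Q \<Otimes>\<^sub>M P) \<partial>\<nu>) = (\<integral>\<^sup>+y. indicator A (f y) \<partial>(\<nu> \<Otimes>\<^sub>M (Q \<Otimes>\<^sub>M P)))"
    using QP.nn_integral_fst[OF fA] .
  also have "\<dots> = (\<integral>\<^sup>+y. indicator A y \<partial>distr (\<nu> \<Otimes>\<^sub>M (Q \<Otimes>\<^sub>M P)) Y f)"
    by (rule nn_integral_distr[symmetric, OF f]) (rule borel_measurable_indicator, simp only: sets_distr A)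
  also have "\<dots> = emeasure (distr (\<nu> \<Otimes>\<^sub>M (Q \<Otimes>\<^sub>M P)) Y f) A"
    by (rule nn_integral_indicator) (simp only: sets_distr A)
  finally show "emeasure (distr (\<nu> \<Otimes>\<^sub>M (Q \<Otimes>\<^sub>M P)) Y f) A * emeasure N D
      = emeasure (distr (\<nu> \<Otimes>\<^sub>M N) (Y \<Otimes>\<^sub>M N) ?\<Psi>) (A \<times> D)"
    by (rule sym)
qed

text \<open>The law of the state alone does not carry the induction. What is propagated is that the
  state together with all noise still to come has a product law; projecting to the first component
  at the end gives the claim.\<close>

lemma distr_inaccurate_chain:
  fixes M :: "'w measure" and \<beta> :: "real ^ 'd \<Rightarrow> real ^ 'n \<Rightarrow> real ^ 'd" and U :: "nat \<Rightarrow> 'w \<Rightarrow> real ^ 'n"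
    and \<xi> :: "nat \<Rightarrow> 'w \<Rightarrow> real ^ 'd"
  assumes M: "prob_space M" and \<beta>: "(\<lambda>(x, u). \<beta> x u) \<in> borel_measurable (borel \<Otimes>\<^sub>M borel)"
    and inputs: "independent_inputs M Z \<xi> U"
    and \<xi>_law: "\<And>k. k \<ge> 1 \<Longrightarrow> distr M borel (\<xi> k) = gaussian 1"
    and U_law: "\<And>k. distr M borel (U k) = \<upsilon>"
  shows "distr M borel (inaccurate_chain h \<beta> U \<xi> Z k) = chain_law h \<beta> \<upsilon> (distr M borel Z) k"
proof -
  interpret prob_space M by fact
  let ?A = "Pi\<^sub>M {1::nat..} (\<lambda>_. borel :: (real ^ 'd) measure)" and ?B = "Pi\<^sub>M (UNIV :: nat set) (\<lambda>_. borel :: (real ^ 'n) measure)"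
  let ?NG = "Pi\<^sub>M (UNIV :: nat set) (\<lambda>_. gaussian 1 :: (real ^ 'd) measure)" and ?NU = "Pi\<^sub>M (UNIV :: nat set) (\<lambda>_. \<upsilon>)"
  define \<mu> where "\<mu> = distr M borel Z"
  have ind\<xi>: "indep_vars (\<lambda>_. borel) \<xi> {1..}" and indU: "indep_vars (\<lambda>_. borel) U UNIV"
    and ind1: "independent_rvs M ?A (\<lambda>\<omega>. \<lambda>k\<in>{1..}. \<xi> k \<omega>) ?B (\<lambda>\<omega> k. U k \<omega>)"
    and ind2: "independent_rvs M borel Z (?A \<Otimes>\<^sub>M ?B) (\<lambda>\<omega>. (\<lambda>k\<in>{1..}. \<xi> k \<omega>, \<lambda>k. U k \<omega>))"
    using inputs by (auto simp: independent_inputs_def)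
  have rv\<xi>: "\<xi> k \<in> borel_measurable M" if "k \<ge> 1" for k
    using ind\<xi> that by (auto simp: indep_vars_def2)
  have rvU: "U k \<in> borel_measurable M" for k
    using indU by (auto simp: indep_vars_def2)
  have rvZ: "Z \<in> borel_measurable M" and rv\<Xi>: "(\<lambda>\<omega>. \<lambda>k\<in>{1..}. \<xi> k \<omega>) \<in> M \<rightarrow>\<^sub>M ?A"
    and rvUs: "(\<lambda>\<omega> k. U k \<omega>) \<in> M \<rightarrow>\<^sub>M ?B"
    using ind1 ind2 by (auto simp: independent_rvs_def)
  have s\<upsilon>: "sets \<upsilon> = sets borel" using U_law[of 0] by auto
  have p\<upsilon>: "prob_space \<upsilon>" using prob_space_distr[OF rvU[of 0]] U_law[of 0] by simp
  have p\<mu>: "prob_space \<mu>" unfolding \<mu>_def by (rule prob_space_distr[OF rvZ])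
  have s\<mu>: "sets \<mu> = sets borel" by (simp add: \<mu>_def)
  interpret G: prob_space "gaussian 1 :: (real ^ 'd) measure" by (rule prob_space_gaussian)
  interpret V: prob_space \<upsilon> by (rule p\<upsilon>)
  interpret SG: sequence_space "gaussian 1 :: (real ^ 'd) measure" ..
  interpret SU: sequence_space \<upsilon> ..
  interpret N: pair_prob_space ?NG ?NU ..
  have law\<Xi>: "distr M ?A (\<lambda>\<omega>. \<lambda>k\<in>{1..}. \<xi> k \<omega>) = Pi\<^sub>M {1..} (\<lambda>_. gaussian 1)"
  proof -
    have "distr M ?A (\<lambda>\<omega>. \<lambda>k\<in>{1..}. \<xi> k \<omega>) = (\<Pi>\<^sub>M k\<in>{1..}. distr M borel (\<xi> k))"
      using ind\<xi> rv\<xi> by (subst (asm) indep_vars_iff_distr_eq_PiM') auto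
    also have "\<dots> = Pi\<^sub>M {1..} (\<lambda>_. gaussian 1)"
      by (rule PiM_cong) (auto simp: \<xi>_law)
    finally show ?thesis .
  qed
  have lawU: "distr M ?B (\<lambda>\<omega> k. U k \<omega>) = ?NU"
  proof -
    have "distr M ?B (\<lambda>\<omega>. \<lambda>k\<in>UNIV. U k \<omega>) = (\<Pi>\<^sub>M k\<in>UNIV. distr M borel (U k))"
      using indU rvU by (subst (asm) indep_vars_iff_distr_eq_PiM') auto
    then show ?thesis by (simp add: U_law restrict_UNIV)
  qed
  \<comment> \<open>Reindexes the Gaussian sequence from {1..} to all natural numbers, so that its
    head is the noise of the first step.\<close>
  let ?shift = "\<lambda>g j. g (Suc j) :: real ^ 'd"
  have shift_m: "?shift \<in> ?A \<rightarrow>\<^sub>M ?NG"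
    by (rule measurable_abs_UNIV) (auto intro!: measurable_component_singleton simp: measurable_cong_sets[OF refl sets_gaussian])
  have law_shift: "distr (Pi\<^sub>M {1..} (\<lambda>_. gaussian 1)) ?NG ?shift = ?NG"
    using distr_PiM_reindex[of "{1..}" "\<lambda>_. gaussian 1 :: (real ^ 'd) measure" Suc UNIV] G.prob_space_axioms
    by (simp add: restrict_UNIV)
  \<comment> \<open>Step k + 1 consumes \<xi> (k + 1) and U k; at time k the remaining Gaussian
    sequence therefore starts at \<open>Suc k\<close> and the remaining estimator sequence at
    \<open>k\<close>.\<close>
  define st where "st k \<omega> = (inaccurate_chain h \<beta> U \<xi> Z k \<omega>, (\<lambda>j. \<xi> (Suc (k + j)) \<omega>), (\<lambda>j. U (k + j) \<omega>))" for k \<omega>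
  let ?N = "?NG \<Otimes>\<^sub>M ?NU"
  define f where "f = (\<lambda>(x, u, z). x + h *\<^sub>R \<beta> x u + sqrt h *\<^sub>R z)"
  have f: "f \<in> borel_measurable (borel \<Otimes>\<^sub>M (borel \<Otimes>\<^sub>M borel))"
    unfolding f_def by (rule step_map_measurable[OF \<beta>])
  have f': "f \<in> borel_measurable (\<nu> \<Otimes>\<^sub>M (\<upsilon> \<Otimes>\<^sub>M gaussian 1))" if "sets \<nu> = sets borel" for \<nu>
    using f measurable_cong_sets[OF sets_pair_measure_cong[OF that sets_pair_measure_cong[OF s\<upsilon> sets_gaussian]] refl] by blast
  let ?\<Psi> = "\<lambda>(x, g, u). (f (x, u 0, g 0), (\<lambda>j. g (Suc j)), (\<lambda>j. u (Suc j)))"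
  have \<Psi>: "?\<Psi> \<in> borel \<Otimes>\<^sub>M ?N \<rightarrow>\<^sub>M borel \<Otimes>\<^sub>M ?N"
    by (rule consume_noise_measurable[OF f'[OF refl]])
  have st_Suc: "st (Suc k) = ?\<Psi> \<circ> st k" for k
    by (simp add: fun_eq_iff st_def f_def)
  have joint: "st k \<in> M \<rightarrow>\<^sub>M borel \<Otimes>\<^sub>M ?N \<and> distr M (borel \<Otimes>\<^sub>M ?N) (st k) = chain_law h \<beta> \<upsilon> \<mu> k \<Otimes>\<^sub>M ?N" for k
  proof (induction k)
    case 0
    have sB: "sets ?B = sets ?NU"
      by (rule sets_PiM_cong) (auto simp: s\<upsilon>)
    have id_m: "(\<lambda>x. x) \<in> ?B \<rightarrow>\<^sub>M ?NU" by (rule measurable_ident_sets[OF sB])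
    let ?r = "\<lambda>(x, g, u). (x, ?shift g, u)"
    have r1: "(\<lambda>(g, u). (?shift g, u)) \<in> ?A \<Otimes>\<^sub>M ?B \<rightarrow>\<^sub>M ?N"
      unfolding case_prod_beta'
      by (intro measurable_Pair measurable_compose[OF measurable_fst shift_m] measurable_compose[OF measurable_snd id_m])
    have r: "?r \<in> borel \<Otimes>\<^sub>M (?A \<Otimes>\<^sub>M ?B) \<rightarrow>\<^sub>M borel \<Otimes>\<^sub>M ?N"
      using measurable_Pair[OF measurable_fst measurable_compose[OF measurable_snd r1]]
      by (simp add: case_prod_beta')
    have in_m: "(\<lambda>\<omega>. (Z \<omega>, (\<lambda>k\<in>{1..}. \<xi> k \<omega>, \<lambda>k. U k \<omega>))) \<in> M \<rightarrow>\<^sub>M borel \<Otimes>\<^sub>M (?A \<Otimes>\<^sub>M ?B)"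
      by (intro measurable_Pair rvZ rv\<Xi> rvUs)
    have st0: "st 0 = ?r \<circ> (\<lambda>\<omega>. (Z \<omega>, (\<lambda>k\<in>{1..}. \<xi> k \<omega>, \<lambda>k. U k \<omega>)))"
      by (simp add: fun_eq_iff st_def)
    let ?P = "Pi\<^sub>M {1::nat..} (\<lambda>_. gaussian 1 :: (real ^ 'd) measure)"
    have sA: "sets ?A = sets ?P" by (rule sets_PiM_cong) auto
    have shift_m': "?shift \<in> ?P \<rightarrow>\<^sub>M ?NG"
      using shift_m measurable_cong_sets[OF sA refl] by blast
    have "distr M (borel \<Otimes>\<^sub>M ?N) (st 0) = distr (distr M (borel \<Otimes>\<^sub>M (?A \<Otimes>\<^sub>M ?B)) (\<lambda>\<omega>. (Z \<omega>, (\<lambda>k\<in>{1..}. \<xi> k \<omega>, \<lambda>k. U k \<omega>)))) (borel \<Otimes>\<^sub>M ?N) ?r"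
      unfolding st0 by (rule distr_distr[OF r in_m, symmetric])
    also have "distr M (borel \<Otimes>\<^sub>M (?A \<Otimes>\<^sub>M ?B)) (\<lambda>\<omega>. (Z \<omega>, (\<lambda>k\<in>{1..}. \<xi> k \<omega>, \<lambda>k. U k \<omega>)))
        = \<mu> \<Otimes>\<^sub>M (?P \<Otimes>\<^sub>M ?NU)"
      unfolding independent_rvs_joint_law[OF M ind2] independent_rvs_joint_law[OF M ind1] law\<Xi> lawU \<mu>_def ..
    also have "distr (\<mu> \<Otimes>\<^sub>M (?P \<Otimes>\<^sub>M ?NU)) (borel \<Otimes>\<^sub>M ?N) ?r = \<mu> \<Otimes>\<^sub>M ?N"
    proof -
      have "?N = distr ?P ?NG ?shift \<Otimes>\<^sub>M distr ?NU ?NU (\<lambda>x. x)"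
        unfolding law_shift distr_id2[OF refl] ..
      also have "\<dots> = distr (?P \<Otimes>\<^sub>M ?NU) ?N (\<lambda>(g, u). (?shift g, u))"
        by (rule pair_measure_distr[OF shift_m' measurable_ident_sets[OF refl]]) (simp add: distr_id2 SU.sigma_finite_measure_axioms)
      finally have N: "distr (?P \<Otimes>\<^sub>M ?NU) ?N (\<lambda>(g, u). (?shift g, u)) = ?N" ..
      have r1': "(\<lambda>(g, u). (?shift g, u)) \<in> ?P \<Otimes>\<^sub>M ?NU \<rightarrow>\<^sub>M ?N"
        using r1 measurable_cong_sets[OF sets_pair_measure_cong[OF sA sB] refl] by blast
      have i\<mu>: "(\<lambda>x. x) \<in> \<mu> \<rightarrow>\<^sub>M borel" by (rule measurable_ident_sets[OF s\<mu>])
      have "distr (\<mu> \<Otimes>\<^sub>M (?P \<Otimes>\<^sub>M ?NU)) (borel \<Otimes>\<^sub>M ?N) (\<lambda>(x, y). (x, (\<lambda>(g, u). (?shift g, u)) y))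
          = distr \<mu> borel (\<lambda>x. x) \<Otimes>\<^sub>M distr (?P \<Otimes>\<^sub>M ?NU) ?N (\<lambda>(g, u). (?shift g, u))"
        by (rule pair_measure_distr[OF i\<mu> r1', symmetric]) (unfold N, rule N.sigma_finite_measure_axioms)
      also have "\<dots> = \<mu> \<Otimes>\<^sub>M ?N" unfolding N distr_id2[OF s\<mu>[symmetric]] ..
      finally show ?thesis by (simp add: case_prod_beta')
    qed
    finally have "distr M (borel \<Otimes>\<^sub>M ?N) (st 0) = \<mu> \<Otimes>\<^sub>M ?N" .
    moreover have "st 0 \<in> M \<rightarrow>\<^sub>M borel \<Otimes>\<^sub>M ?N"
      unfolding st0 by (rule measurable_comp[OF in_m r])
    ultimately show ?case by simp
  next
    case (Suc k)
    then have st: "st k \<in> M \<rightarrow>\<^sub>M borel \<Otimes>\<^sub>M ?N"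
      and law: "distr M (borel \<Otimes>\<^sub>M ?N) (st k) = chain_law h \<beta> \<upsilon> \<mu> k \<Otimes>\<^sub>M ?N" by auto
    let ?\<nu> = "chain_law h \<beta> \<upsilon> \<mu> k"
    have "distr M (borel \<Otimes>\<^sub>M ?N) (st (Suc k)) = distr (distr M (borel \<Otimes>\<^sub>M ?N) (st k)) (borel \<Otimes>\<^sub>M ?N) ?\<Psi>"
      unfolding st_Suc by (rule distr_distr[OF \<Psi> st, symmetric])
    also have "\<dots> = distr (?\<nu> \<Otimes>\<^sub>M (\<upsilon> \<Otimes>\<^sub>M gaussian 1)) borel f \<Otimes>\<^sub>M ?N"
      unfolding law
      by (rule distr_consume_noise[OF G.prob_space_axioms p\<upsilon> prob_space_chain_law[OF \<beta> p\<upsilon> s\<upsilon> p\<mu> s\<mu>] f'[OF sets_chain_law[OF s\<mu>]]])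
    also have "\<dots> = chain_law h \<beta> \<upsilon> \<mu> (Suc k) \<Otimes>\<^sub>M ?N"
      by (simp add: step_law_def f_def)
    finally have "distr M (borel \<Otimes>\<^sub>M ?N) (st (Suc k)) = chain_law h \<beta> \<upsilon> \<mu> (Suc k) \<Otimes>\<^sub>M ?N" .
    moreover have "st (Suc k) \<in> M \<rightarrow>\<^sub>M borel \<Otimes>\<^sub>M ?N"
      unfolding st_Suc by (rule measurable_comp[OF st \<Psi>])
    ultimately show ?case by (rule conjI[rotated])
  qed
  have st: "st k \<in> M \<rightarrow>\<^sub>M borel \<Otimes>\<^sub>M ?N" using joint by blast
  have "distr M borel (inaccurate_chain h \<beta> U \<xi> Z k) = distr M borel (fst \<circ> st k)"
    by (simp add: st_def comp_def)
  also have "\<dots> = distr (distr M (borel \<Otimes>\<^sub>M ?N) (st k)) borel fst"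
    by (rule distr_distr[OF measurable_fst st, symmetric])
  also have "\<dots> = distr (chain_law h \<beta> \<upsilon> \<mu> k \<Otimes>\<^sub>M ?N) borel fst"
    using joint by simp
  also have "\<dots> = distr (chain_law h \<beta> \<upsilon> \<mu> k \<Otimes>\<^sub>M ?N) (chain_law h \<beta> \<upsilon> \<mu> k) fst"
    by (rule distr_cong) (simp_all add: sets_chain_law[OF s\<mu>])
  also have "\<dots> = chain_law h \<beta> \<upsilon> \<mu> k"
    by (rule N.distr_pair_fst)
  finally show ?thesis unfolding \<mu>_def .
qed

lemma euler_chain_eq_inaccurate_chain:
  "euler_chain h b \<xi> Z k = inaccurate_chain h (\<lambda>x _. b x) U \<xi> Z k"
  by (induction k) auto

section \<open>From the expected cost to Wasserstein distances\<close>

lemma couplings_swap: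
  assumes "\<gamma> \<in> couplings \<mu> \<nu>"
  shows "distr \<gamma> (borel \<Otimes>\<^sub>M borel) (\<lambda>v. (snd v, fst v)) \<in> couplings \<nu> \<mu>"
proof -
  note [measurable_cong] = couplingsD(1)[OF assms]
  let ?\<gamma> = "distr \<gamma> (borel \<Otimes>\<^sub>M borel) (\<lambda>v. (snd v, fst v))"
  have "distr ?\<gamma> borel fst = distr \<gamma> borel snd" "distr ?\<gamma> borel snd = distr \<gamma> borel fst"
    by (subst distr_distr; simp add: comp_def)+
  then show ?thesis using couplingsD[OF assms] by (simp add: couplings_def)
qed

lemma transport_cost_swap:
  assumes "\<gamma> \<in> couplings \<mu> \<nu>"
  shows "transport_cost p (distr \<gamma> (borel \<Otimes>\<^sub>M borel) (\<lambda>v. (snd v, fst v))) = transport_cost p \<gamma>"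
proof -
  note [measurable_cong] = couplingsD(1)[OF assms]
  show ?thesis
    unfolding transport_cost_def by (subst nn_integral_distr) (auto simp: dist_commute)
qed

lemma square_le_cost:
  assumes "a > 0" "\<epsilon> > 0" "r \<ge> 0"
  shows "r\<^sup>2 \<le> 1 / \<epsilon> * cost a \<epsilon> r"
proof -
  have "\<epsilon> * r\<^sup>2 \<le> cost a \<epsilon> r" using assms by (simp add: cost_def)
  then show ?thesis using assms by (simp add: field_simps)
qed

text \<open>If a r <= 1, the exponential part is at least a r / 2. Otherwise r <= a r^2, and the
  quadratic part suffices.\<close>

lemma le_cost:
  assumes "a > 0" "\<epsilon> > 0" "r \<ge> 0"
  shows "r \<le> (2 / a + a / \<epsilon>) * cost a \<epsilon> r"
proof (cases "a * r \<le> 1")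
  case True
  have u: "0 \<le> a * r" using assms by simp
  have "a * r / 2 \<le> cost a \<epsilon> r"
    using exp_minus_le_half[OF u True] assms by (simp add: cost_def add_increasing2)
  then have "2 / a * (a * r / 2) \<le> 2 / a * cost a \<epsilon> r"
    using assms by (intro mult_left_mono) auto
  moreover have "0 \<le> a / \<epsilon> * cost a \<epsilon> r" using assms cost_nonneg[of a \<epsilon> r] by simp
  ultimately show ?thesis using assms by (simp add: distrib_right)
next
  case False
  have "1 * r \<le> (a * r) * r" using False assms by (intro mult_right_mono) auto
  also have "\<dots> = a * r\<^sup>2" by (simp add: power2_eq_square)
  also have "\<dots> \<le> a * (1 / \<epsilon> * cost a \<epsilon> r)"
    using square_le_cost[OF assms] assms by (intro mult_left_mono) auto
  finally have "r \<le> a / \<epsilon> * cost a \<epsilon> r" by simp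
  moreover have "0 \<le> 2 / a * cost a \<epsilon> r" using assms cost_nonneg[of a \<epsilon> r] by simp
  ultimately show ?thesis by (simp add: distrib_right)
qed

lemma transport_cost_le_cost:
  fixes \<gamma> :: "((real ^ 'd) \<times> (real ^ 'd)) measure"
  assumes s: "sets \<gamma> = sets (borel \<Otimes>\<^sub>M borel)" and c: "c \<ge> 0"
    and le: "\<And>r. r \<ge> 0 \<Longrightarrow> r powr p \<le> c * cost a \<epsilon> r"
    and S: "expected_cost a \<epsilon> \<gamma> \<le> ennreal S"
  shows "transport_cost p \<gamma> \<le> ennreal (c * S)"
proof -
  note [measurable_cong] = s
  have "transport_cost p \<gamma> \<le> (\<integral>\<^sup>+v. ennreal c * ennreal (cost a \<epsilon> (dist (fst v) (snd v))) \<partial>\<gamma>)"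
    unfolding transport_cost_def using c le
    by (intro nn_integral_mono) (simp add: ennreal_mult'[symmetric] ennreal_leI)
  also have "\<dots> = ennreal c * expected_cost a \<epsilon> \<gamma>"
    by (rule nn_integral_cmult) measurable
  also have "\<dots> \<le> ennreal c * ennreal S" by (intro mult_left_mono S) auto
  also have "\<dots> = ennreal (c * S)" using c by (simp add: ennreal_mult')
  finally show ?thesis .
qed

theorem theorem1p4:
  fixes b :: "real ^ 'd \<Rightarrow> real ^ 'd"
    and L K R \<sigma> \<alpha> :: real
    and M :: "'w measure"
    and bbar :: "real \<Rightarrow> real ^ 'd \<Rightarrow> real ^ 'n \<Rightarrow> real ^ 'd"
    and U :: "real \<Rightarrow> 'w \<Rightarrow> real ^ 'n"
    and Us :: "real \<Rightarrow> nat \<Rightarrow> 'w \<Rightarrow> real ^ 'n"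
    and \<xi> :: "nat \<Rightarrow> 'w \<Rightarrow> real ^ 'd"
    and X0 Xbar0 :: "'w \<Rightarrow> real ^ 'd"
    and \<mu>0 \<pi> :: "(real ^ 'd) measure"
  assumes "L > 0" and "K > 0" and "R > 0" and "\<sigma> > 0" and "\<alpha> > 0"
    and lipschitz: "\<And>x y. norm (b x - b y) \<le> L * norm (x - y)"
    and dissipative: "\<And>x y. norm (x - y) > R \<Longrightarrow>
      (x - y) \<bullet> (b x - b y) \<le> - K * (norm (x - y))\<^sup>2"
    and prob: "prob_space M"
    and bbar_measurable: "\<And>h. h > 0 \<Longrightarrow>
      (\<lambda>(x, u). bbar h x u) \<in> borel_measurable (borel \<Otimes>\<^sub>M borel)"
    and U_measurable: "\<And>h. h > 0 \<Longrightarrow> U h \<in> borel_measurable M"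
    and unbiased: "\<And>h x. h > 0 \<Longrightarrow>
      has_bochner_integral M (\<lambda>\<omega>. bbar h x (U h \<omega>)) (b x)"
    and variance: "\<And>h x. h > 0 \<Longrightarrow>
      (\<integral>\<^sup>+ \<omega>. ennreal ((norm (bbar h x (U h \<omega>) - b x))\<^sup>2) \<partial>M)
        \<le> ennreal (\<sigma>\<^sup>2 * (1 + (norm x)\<^sup>2) * h powr \<alpha>)"
    and Us_copies: "\<And>h k. h > 0 \<Longrightarrow> distr M borel (Us h k) = distr M borel (U h)"
    and \<xi>_gaussian: "\<And>k. k \<ge> 1 \<Longrightarrow> distr M borel (\<xi> k) = gaussian 1"
    and \<mu>0: "\<mu>0 \<in> P2"
    and X0_law: "distr M borel X0 = \<mu>0"
    and Xbar0_law: "distr M borel Xbar0 = \<mu>0"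
    and X0_indep: "\<And>h. h > 0 \<Longrightarrow> independent_inputs M X0 \<xi> (Us h)"
    and Xbar0_indep: "\<And>h. h > 0 \<Longrightarrow> independent_inputs M Xbar0 \<xi> (Us h)"
    and invariant: "sde_invariant b \<pi>"
  shows "\<exists>h0 C1 C2 :: real. h0 > 0 \<and> C1 > 0 \<and> C2 > 0 \<and>
    (\<forall>h k. 0 < h \<and> h < h0 \<and> 1 \<le> k \<longrightarrow>
      wasserstein 2 (distr M borel (inaccurate_chain h (bbar h) (Us h) \<xi> Xbar0 k)) \<pi>
        \<le> wasserstein 2 (distr M borel (euler_chain h b \<xi> X0 k)) \<pi> + ennreal (C2 * h powr (\<alpha> / 4)) \<and>
      wasserstein 1 (distr M borel (inaccurate_chain h (bbar h) (Us h) \<xi> Xbar0 k)) \<pi>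
        \<le> wasserstein 1 (distr M borel (euler_chain h b \<xi> X0 k)) \<pi> + ennreal (C1 * h powr (\<alpha> / 2)))"
proof (rule chain_laws_coupling[OF \<open>L > 0\<close> \<open>K > 0\<close> \<open>R > 0\<close> \<open>\<alpha> > 0\<close> lipschitz dissipative \<mu>0, where \<sigma> = \<sigma> and 'n = 'n])
  fix a \<epsilon> h0 C :: real
  assume pos: "a > 0" "\<epsilon> > 0" "h0 > 0" "C > 0"
    and coupling: "\<And>h \<beta> (\<upsilon> :: (real ^ 'n) measure) k. 0 < h \<Longrightarrow> h < h0 \<Longrightarrow>
      (\<lambda>(x, u). \<beta> x u) \<in> borel_measurable (borel \<Otimes>\<^sub>M borel) \<Longrightarrow>
      prob_space \<upsilon> \<Longrightarrow> sets \<upsilon> = sets borel \<Longrightarrow>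
      (\<And>x. (\<integral>\<^sup>+u. ennreal ((norm (\<beta> x u - b x))\<^sup>2) \<partial>\<upsilon>) \<le> ennreal (\<sigma>\<^sup>2 * (1 + (norm x)\<^sup>2) * h powr \<alpha>)) \<Longrightarrow>
      \<exists>\<gamma> \<in> couplings (chain_law h (\<lambda>x _. b x) \<upsilon> \<mu>0 k) (chain_law h \<beta> \<upsilon> \<mu>0 k).
        expected_cost a \<epsilon> \<gamma> \<le> ennreal (C * h powr (\<alpha> / 2))"
  interpret prob_space M by fact
  \<comment> \<open>\<open>C1\<close> is the constant of \<open>le_cost\<close> times C. In
    \<open>C2\<close> the root comes from the squared distance being at most the cost divided by
    \<epsilon>; the same root halves the exponent \<alpha>/2.\<close>
  define C1 where "C1 = (2 / a + a / \<epsilon>) * C"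
  define C2 where "C2 = sqrt (1 / \<epsilon> * C)"
  have C12: "C1 > 0" "C2 > 0" using pos by (simp_all add: C1_def C2_def add_pos_pos)
  have b: "b \<in> borel_measurable borel"
    by (rule lipschitz_borel_measurable[of L]) (use \<open>L > 0\<close> lipschitz in auto)
  have main: "wasserstein 2 (distr M borel (inaccurate_chain h (bbar h) (Us h) \<xi> Xbar0 k)) \<pi>
        \<le> wasserstein 2 (distr M borel (euler_chain h b \<xi> X0 k)) \<pi> + ennreal (C2 * h powr (\<alpha> / 4)) \<and>
      wasserstein 1 (distr M borel (inaccurate_chain h (bbar h) (Us h) \<xi> Xbar0 k)) \<pi>
        \<le> wasserstein 1 (distr M borel (euler_chain h b \<xi> X0 k)) \<pi> + ennreal (C1 * h powr (\<alpha> / 2))"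
    if h: "0 < h" "h < h0" for h k
  proof -
    define \<upsilon> where "\<upsilon> = distr M borel (U h)"
    have \<upsilon>: "prob_space \<upsilon>" "sets \<upsilon> = sets borel"
      unfolding \<upsilon>_def using prob_space_distr[OF U_measurable[OF h(1)]] by auto
    have \<mu>0': "prob_space \<mu>0" "sets \<mu>0 = sets borel" using \<mu>0 by (auto simp: P2_def)
    note \<beta> = bbar_measurable[OF h(1)]
    have \<beta>b: "(\<lambda>(x, u :: real ^ 'n). b x) \<in> borel_measurable (borel \<Otimes>\<^sub>M borel)"
      using b by measurable
    have var: "(\<integral>\<^sup>+u. ennreal ((norm (bbar h x u - b x))\<^sup>2) \<partial>\<upsilon>) \<le> ennreal (\<sigma>\<^sup>2 * (1 + (norm x)\<^sup>2) * h powr \<alpha>)" for x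
    proof -
      have [measurable]: "bbar h x \<in> borel_measurable borel"
        using measurable_compose[OF measurable_Pair1' \<beta>, of x] by simp
      have "(\<integral>\<^sup>+u. ennreal ((norm (bbar h x u - b x))\<^sup>2) \<partial>\<upsilon>) = (\<integral>\<^sup>+\<omega>. ennreal ((norm (bbar h x (U h \<omega>) - b x))\<^sup>2) \<partial>M)"
        unfolding \<upsilon>_def by (rule nn_integral_distr[OF U_measurable[OF h(1)]]) measurable
      then show ?thesis using variance[OF h(1)] by simp
    qed
    let ?X = "chain_law h (\<lambda>x _. b x) \<upsilon> \<mu>0 k" and ?Y = "chain_law h (bbar h) \<upsilon> \<mu>0 k"
    have Us_law: "distr M borel (Us h j) = \<upsilon>" for j
      unfolding \<upsilon>_def by (rule Us_copies[OF h(1)])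
    have Y: "distr M borel (inaccurate_chain h (bbar h) (Us h) \<xi> Xbar0 k) = ?Y"
      using distr_inaccurate_chain[OF prob \<beta> Xbar0_indep[OF h(1)] \<xi>_gaussian Us_law] by (simp add: Xbar0_law)
    have X: "distr M borel (euler_chain h b \<xi> X0 k) = ?X"
      unfolding euler_chain_eq_inaccurate_chain[of h b \<xi> X0 k "Us h"]
      using distr_inaccurate_chain[OF prob \<beta>b X0_indep[OF h(1)] \<xi>_gaussian Us_law] by (simp add: X0_law)
    have pX: "prob_space ?X" and pY: "prob_space ?Y"
      by (rule prob_space_chain_law[OF \<beta>b \<upsilon> \<mu>0'], rule prob_space_chain_law[OF \<beta> \<upsilon> \<mu>0'])
    define \<tau> where "\<tau> = h powr (\<alpha> / 2)"
    have \<tau>: "\<tau> \<ge> 0" by (simp add: \<tau>_def)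
    obtain \<gamma> where \<gamma>: "\<gamma> \<in> couplings ?X ?Y"
      and S: "expected_cost a \<epsilon> \<gamma> \<le> ennreal (C * \<tau>)"
      using coupling[OF h \<beta> \<upsilon> var, of k] unfolding \<tau>_def by blast
    \<comment> \<open>The induction couples the exact chain first, while the triangle inequality
      starts from the perturbed one, hence the swap.\<close>
    let ?\<gamma> = "distr \<gamma> (borel \<Otimes>\<^sub>M borel) (\<lambda>v. (snd v, fst v))"
    have "transport_cost 1 \<gamma> \<le> ennreal ((2 / a + a / \<epsilon>) * (C * \<tau>))"
      by (rule transport_cost_le_cost[OF couplingsD(1)[OF \<gamma>] _ _ S]) (use pos le_cost in auto)
    also have "(2 / a + a / \<epsilon>) * (C * \<tau>) = (C1 * \<tau>) powr 1"
      using C12 \<tau> by (simp add: C1_def)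
    finally have T1: "transport_cost 1 ?\<gamma> \<le> ennreal ((C1 * \<tau>) powr 1)"
      unfolding transport_cost_swap[OF \<gamma>] .
    have W1: "wasserstein 1 ?Y ?X \<le> ennreal (C1 * \<tau>)"
      by (rule wasserstein_le_of_coupling[OF couplings_swap[OF \<gamma>] T1]) (use C12 \<tau> in simp_all)
    have "wasserstein 1 ?Y \<pi> \<le> wasserstein 1 ?Y ?X + wasserstein 1 ?X \<pi>"
      by (rule wasserstein_triangle[OF pY pX]) simp
    also have "\<dots> \<le> ennreal (C1 * \<tau>) + wasserstein 1 ?X \<pi>"
      by (rule add_right_mono[OF W1])
    also have "\<dots> = wasserstein 1 ?X \<pi> + ennreal (C1 * \<tau>)" by (rule add.commute)
    finally have 1: "wasserstein 1 ?Y \<pi> \<le> wasserstein 1 ?X \<pi> + ennreal (C1 * \<tau>)" .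
    have "transport_cost 2 \<gamma> \<le> ennreal (1 / \<epsilon> * (C * \<tau>))"
      by (rule transport_cost_le_cost[OF couplingsD(1)[OF \<gamma>] _ _ S]) (use pos square_le_cost in auto)
    also have "1 / \<epsilon> * (C * \<tau>) = (C2 * h powr (\<alpha> / 4)) powr 2"
    proof -
      have "(h powr (\<alpha> / 4))\<^sup>2 = \<tau>"
        unfolding \<tau>_def power2_eq_square powr_add[symmetric] by simp
      then show ?thesis using C12 pos by (simp add: C2_def power_mult_distrib)
    qed
    finally have T2: "transport_cost 2 ?\<gamma> \<le> ennreal ((C2 * h powr (\<alpha> / 4)) powr 2)"
      unfolding transport_cost_swap[OF \<gamma>] .
    have W2: "wasserstein 2 ?Y ?X \<le> ennreal (C2 * h powr (\<alpha> / 4))"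
      by (rule wasserstein_le_of_coupling[OF couplings_swap[OF \<gamma>] T2]) (use C12 in simp_all)
    have "wasserstein 2 ?Y \<pi> \<le> wasserstein 2 ?Y ?X + wasserstein 2 ?X \<pi>"
      by (rule wasserstein_triangle[OF pY pX]) simp
    also have "\<dots> \<le> ennreal (C2 * h powr (\<alpha> / 4)) + wasserstein 2 ?X \<pi>"
      by (rule add_right_mono[OF W2])
    also have "\<dots> = wasserstein 2 ?X \<pi> + ennreal (C2 * h powr (\<alpha> / 4))" by (rule add.commute)
    finally have 2: "wasserstein 2 ?Y \<pi> \<le> wasserstein 2 ?X \<pi> + ennreal (C2 * h powr (\<alpha> / 4))" .
    show ?thesis unfolding X Y using 2 1[unfolded \<tau>_def] by (rule conjI)
  qed
  show ?thesis
    using pos C12 main by blast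
qed

end
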